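(* Let $\varepsilon>0$, $d\in\mathbb{N}$, choose $L_d\ge(\log_* d)^{1/2+\varepsilon}$ and $R_d=\sqrt{2d}$, and define $\mathcal{Z}_d=\mathcal{Z}^{(L_d)}\cap B_{R_d}(0)$. Given $1\le p<\infty$ there exist positive constants $A=A(p)$, $B=B(p)$, $c=c(\varepsilon,p)$ and $C=C(\varepsilon,p)$ (independent of $d$) satisfying the following. Outside an event of probability at most $Ce^{-c(\log_* d)^{1+\varepsilon/2}}$, there are constants $A_d,B_d>0$ with $B_d/A_d\le B/A$ such that $$A_d\|f\|_p^p\le\sum_{z\in\mathcal{Z}_d}|f(z)|^pe^{-p|z|^2/2}\le B_d\|f\|_p^p$$ for every polynomial $f$ of degree at most $d$. In particular, for every $\delta>0$ there exists $d_0=d_0(\delta,\varepsilon,p)\in\mathbb{N}$ such that, outside an event of probability $\delta$, these inequalities hold simultaneously for every $d\ge d_0$.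
   Context: Notation: $\log_*(x)=\max\{1,\log x\}$; $B_r(z)$ is the disc in $\mathbb{C}$ with centre $z$ and radius $r$; $\mathbb{N}=\{1,2,\dots\}$. For $1\le p<\infty$ and $f$ entire, $\|f\|_p^p=\frac{p}{2\pi}\int_{\mathbb{C}}|f(z)|^pe^{-p|z|^2/2}\,dA(z)$, where $dA$ is Lebesgue measure on $\mathbb{C}$. Gaussian entire function (GEF): for $L>0$, $F_L(z)=\sum_{n=0}^\infty \zeta_n\frac{(\sqrt{L}z)^n}{\sqrt{n!}}$, where $\zeta_n$ ($n\ge 0$) are i.i.d. standard complex normal random variables, and $\mathcal{Z}^{(L)}$ denotes the zero set of $F_L$. *)

theory Defs
  imports "HOL-Probability.Probability" "HOL-Computational_Algebra.Polynomial"
begin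

definition log_star :: "real \<Rightarrow> real" where
  "log_star x = max 1 (ln x)"

text \<open>
  The \<open>p\<close>-th power of the Fock space norm, for \<open>1 \<le> p < \<infinity>\<close>; \<open>lborel\<close> on \<open>complex\<close> is the
  area measure. For polynomials the integrand is integrable, so the Bochner integral takes no
  default value.
\<close>

definition fock_norm_pow :: "real \<Rightarrow> (complex \<Rightarrow> complex) \<Rightarrow> real" where
  "fock_norm_pow p f =
     p / (2 * pi) * (\<integral>z. norm (f z) powr p * exp (- p * (norm z)\<^sup>2 / 2) \<partial>lborel)"

text \<open>
  Standard complex normal means mean zero and \<open>E \<bar>\<zeta>\<bar>\<^sup>2 = 1\<close>, i.e. density \<open>exp (- \<bar>z\<bar>\<^sup>2) / pi\<close>
  with respect to area measure.
\<close>

locale gef_coefficients = prob_space M for M :: "'a measure" +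
  fixes \<zeta> :: "nat \<Rightarrow> 'a \<Rightarrow> complex"
  assumes indep: "indep_vars (\<lambda>_. borel) \<zeta> UNIV"
    and std_complex_normal:
      "\<And>n. distributed M lborel (\<zeta> n) (\<lambda>z. ennreal (exp (- (norm z)\<^sup>2) / pi))"

text \<open>
  The series converges for all \<open>z\<close> outside a null event; on that event the value is unspecified.
\<close>

definition gef :: "(nat \<Rightarrow> 'a \<Rightarrow> complex) \<Rightarrow> real \<Rightarrow> 'a \<Rightarrow> complex \<Rightarrow> complex" where
  "gef \<zeta> L \<omega> z =
     (\<Sum>n. \<zeta> n \<omega> * ((complex_of_real (sqrt L) * z) ^ n / complex_of_real (sqrt (fact n))))"

definition gef_zeros :: "(nat \<Rightarrow> 'a \<Rightarrow> complex) \<Rightarrow> real \<Rightarrow> 'a \<Rightarrow> complex set" where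
  "gef_zeros \<zeta> L \<omega> = {z. gef \<zeta> L \<omega> z = 0}"

text \<open>
  If \<open>Z\<close> is infinite then the sum over \<open>Z\<close> is 0 by convention, and for \<open>a > 0\<close> the lower
  inequality fails for \<open>f = 1\<close>. So the predicate, with \<open>a > 0\<close>, forces \<open>Z\<close> to be finite.
\<close>

definition sampling_inequalities ::
    "real \<Rightarrow> nat \<Rightarrow> complex set \<Rightarrow> real \<Rightarrow> real \<Rightarrow> bool" where
  "sampling_inequalities p d Z a b \<longleftrightarrow>
     (\<forall>f :: complex poly. degree f \<le> d \<longrightarrow>
        a * fock_norm_pow p (poly f)
          \<le> (\<Sum>z\<in>Z. norm (poly f z) powr p * exp (- p * (norm z)\<^sup>2 / 2)) \<and>
        (\<Sum>z\<in>Z. norm (poly f z) powr p * exp (- p * (norm z)\<^sup>2 / 2))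
          \<le> b * fock_norm_pow p (poly f))"

end

theory Submission
  imports Defs "HOL-Complex_Analysis.Complex_Analysis" "HOL-Real_Asymp.Real_Asymp"
begin

text \<open>
  Put \<open>X z = \<bar>F\<^sub>L z\<bar> exp (- L \<bar>z\<bar>\<^sup>2 / 2)\<close>. Outside an event of probability of order \<open>d exp (- c L\<^sup>2)\<close> one has
  \<open>X \<le> exp (\<delta> L)\<close> on the disc of radius \<open>sqrt (2 d) + 2\<close>, by a moment bound of order \<open>L\<close>, and every small
  disc in it contains a point with \<open>X \<ge> exp (- \<delta> L)\<close>, because the values of \<open>F\<^sub>L\<close> at about \<open>L\<close> points
  with distances of order \<open>1 / sqrt L\<close> are almost independent. By the maximum principle and Harnack's
  inequality these two facts force the number of zeros in every disc of a fixed radius \<open>\<eta>\<close> to lie between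
  \<open>a L\<close> and \<open>b L\<close> with absolute constants \<open>a, b\<close>; almost surely the zeros are simple, so it does not matter
  that the sum ignores multiplicities. Conversely, if \<open>\<eta>\<close> is small, such counts imply the sampling
  inequalities with constants proportional to \<open>L\<close>, since \<open>\<bar>f\<bar> exp (- \<bar>z\<bar>\<^sup>2 / 2)\<close> varies little on discs of
  radius \<open>\<eta>\<close> compared with its mean over circles of radius 1, and a polynomial of degree \<open>d\<close> has only a
  small part of its norm outside the disc of radius \<open>sqrt (2 d) - 1\<close>. As \<open>L\<^sup>2 \<ge> (log\<^sub>* d)\<^bsup>1 + 2 \<epsilon>\<^esup>\<close>, the factor
  \<open>d\<close> from the union bound is harmless.
\<close>

section \<open>Zeros of holomorphic functions\<close>

text \<open>A disc cannot contain few zeros because of the convexity of the weight. Once the zeros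
  are divided out, the nonvanishing quotient obeys the minimum principle, which would carry the
  large values near the boundary to the circle of half the radius, where the upper bound is much
  smaller. The margin in this comparison of radii decides the constants
  \<open>\<eta>\<^sup>2 / 100\<close> and \<open>\<eta> / 60\<close>. The exponent L^2 is a product
  of two factors L: about L samples, or a moment of order L, each gaining a factor exp (- const *
  L). With x = log_* d the union bound becomes exp (x - \<kappa> x^(1 + 2 \<epsilon>)), which is at
  most a constant times exp (- x^(1 + \<epsilon> / 2)); hence c = 1 is possible. The constant C also
  covers small d and small L, where the exceptional event is the whole space. For each d randomness
  enters only through finitely many events attached to net points and one null event; all statements
  about discs and polynomials are deterministic consequences.\<close>

lemma three_times_dist_imp_le_double_Re:
  fixes A W :: complex
  assumes "norm (W - A) \<le> norm (W + cnj A) / 3" "Re A > 0" "Re W > 0"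
  shows "Re A \<le> 2 * Re W"
proof -
  have "(norm (W - A))\<^sup>2 \<le> (norm (W + cnj A) / 3)\<^sup>2"
    using assms(1) by (intro power_mono) auto
  hence "9 * ((Re W - Re A)\<^sup>2 + (Im W - Im A)\<^sup>2) \<le> (Re W + Re A)\<^sup>2 + (Im W - Im A)\<^sup>2"
    by (simp add: cmod_power2 power_divide)
  moreover have "(3 * (Re W - Re A))\<^sup>2 = 9 * (Re W - Re A)\<^sup>2"
    by (subst power_mult_distrib) simp
  ultimately have "(3 * (Re W - Re A))\<^sup>2 \<le> (Re W + Re A)\<^sup>2"
    using zero_le_power2[of "Im W - Im A"] by (simp only: distrib_left)
  hence "\<bar>3 * (Re W - Re A)\<bar> \<le> Re W + Re A"
    using assms by (metis abs_le_square_iff abs_of_pos add_pos_pos)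
  thus ?thesis unfolding abs_le_iff by simp
qed

text \<open>Harnack's inequality for the positive harmonic function - log |K|, obtained without
  Poisson kernels: a logarithm of \<open>K\<close> maps the disc into the left half-plane, a Cayley
  transform carries its negative into the unit disc with the centre going to 0, and the Schwarz
  lemma bounds the pseudo-hyperbolic distance by 1/3 on the concentric disc of a third of the
  radius.\<close>

lemma Harnack_norm_sq:
  fixes K :: "complex \<Rightarrow> complex"
  assumes hol: "K holomorphic_on ball y r"
    and nz: "\<And>z. z \<in> ball y r \<Longrightarrow> K z \<noteq> 0"
    and le: "\<And>z. z \<in> ball y r \<Longrightarrow> norm (K z) < 1"
    and t: "norm (t - y) \<le> r / 3" and r: "r > 0"
  shows "(norm (K t))\<^sup>2 \<le> norm (K y)"
proof -
  have y: "y \<in> ball y r" using r by simp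
  have tb: "t \<in> ball y r" using t r by (simp add: dist_norm norm_minus_commute)
  obtain g where g: "g holomorphic_on ball y r" "\<And>x. x \<in> ball y r \<Longrightarrow> exp (g x) = K x"
    using holomorphic_logarithm_exists[OF convex_ball open_ball hol nz y] by metis
  have nK: "norm (K x) = exp (Re (g x))" if "x \<in> ball y r" for x
    using g(2)[OF that] by (metis norm_exp_eq_Re)
  have neg: "Re (g x) < 0" if "x \<in> ball y r" for x
    using nK[OF that] le[OF that] by simp
  define A where "A = - g y"
  have A: "Re A > 0" using neg[OF y] by (simp add: A_def)
  define \<phi> where "\<phi> z = (- g (y + of_real r * z) - A) / (- g (y + of_real r * z) + cnj A)" for z
  have in_ball: "y + of_real r * z \<in> ball y r" if "norm z < 1" for z
    using that r by (simp add: dist_norm norm_mult)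
  have den: "- g (y + of_real r * z) + cnj A \<noteq> 0" if "norm z < 1" for z
  proof
    assume "- g (y + of_real r * z) + cnj A = 0"
    hence "Re (- g (y + of_real r * z) + cnj A) = 0" by simp
    thus False using neg[OF in_ball[OF that]] A by simp
  qed
  have "norm (\<phi> z) \<le> norm z" if "norm z < 1" for z
  proof (rule Schwarz_Lemma(1))
    have "(\<lambda>z. g (y + of_real r * z)) holomorphic_on ball 0 1"
      by (intro holomorphic_on_compose_gen[of "\<lambda>z. y + of_real r * z" _ g "ball y r", unfolded o_def] holomorphic_intros g)
         (use in_ball in auto)
    thus "\<phi> holomorphic_on ball 0 1"
      unfolding \<phi>_def by (intro holomorphic_intros) (use den in auto)
    show "\<phi> 0 = 0" by (simp add: \<phi>_def A_def)
    show "norm (\<phi> z) < 1" if z: "norm z < 1" for z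
    proof -
      let ?W = "- g (y + of_real r * z)"
      have W: "Re ?W > 0" using neg[OF in_ball[OF z]] by simp
      have "(norm (?W - A))\<^sup>2 < (norm (?W + cnj A))\<^sup>2"
        unfolding cmod_power2 using mult_pos_pos[OF W A] by (simp add: power2_eq_square algebra_simps)
      hence "norm (?W - A) < norm (?W + cnj A)"
        using power2_less_imp_less norm_ge_zero by blast
      thus ?thesis by (simp add: \<phi>_def norm_divide divide_less_eq del: minus_diff_eq)
    qed
  qed (use that in auto)
  moreover define z where "z = (t - y) / of_real r"
  have z: "norm z \<le> 1 / 3" using t r by (simp add: z_def norm_divide field_simps)
  ultimately have "norm (\<phi> z) \<le> 1 / 3"
    using order_trans[of "norm (\<phi> z)" "norm z" "1/3"] by auto
  moreover have eqt: "y + of_real r * z = t" using r by (simp add: z_def)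
  moreover have "- g t + cnj A \<noteq> 0" using den[of z] z eqt by simp
  ultimately have "norm (- g t - A) \<le> norm (- g t + cnj A) / 3"
    unfolding \<phi>_def norm_divide by (simp add: divide_le_eq)
  from three_times_dist_imp_le_double_Re[OF this A] neg[OF tb] have "Re A \<le> 2 * Re (- g t)" by simp
  hence "2 * Re (g t) \<le> Re (g y)" by (simp add: A_def)
  hence "exp (2 * Re (g t)) \<le> exp (Re (g y))" by simp
  thus ?thesis using nK[OF tb] nK[OF y] by (simp add: exp_double)
qed

text \<open>Scaling by \<open>e / M\<close> with \<open>e < 1\<close> makes the bound on
  \<open>K\<close> strict; letting \<open>e\<close> tend to 1 gives the claim.\<close>

lemma Harnack_norm_sq_le:
  fixes K :: "complex \<Rightarrow> complex"
  assumes hol: "K holomorphic_on ball y r"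
    and nz: "\<And>z. z \<in> ball y r \<Longrightarrow> K z \<noteq> 0"
    and le: "\<And>z. z \<in> ball y r \<Longrightarrow> norm (K z) \<le> M" and M: "M > 0"
    and t: "norm (t - y) \<le> r / 3" and r: "r > 0"
  shows "(norm (K t))\<^sup>2 \<le> M * norm (K y)"
proof (rule field_le_mult_one_interval)
  fix e :: real assume e: "0 < e" "e < 1"
  define c where "c = e / M"
  have c: "c > 0" using e M by (simp add: c_def)
  have cM: "c * M = e" using M by (simp add: c_def)
  have "(norm (of_real c * K t))\<^sup>2 \<le> norm (of_real c * K y)"
  proof (rule Harnack_norm_sq[of "\<lambda>z. of_real c * K z" y r])
    show "(\<lambda>z. of_real c * K z) holomorphic_on ball y r" by (intro holomorphic_intros hol)
    show "norm (of_real c * K z) < 1" if "z \<in> ball y r" for z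
    proof -
      have "c * norm (K z) \<le> c * M" using le[OF that] c by simp
      thus ?thesis using cM e c by (simp add: norm_mult)
    qed
  qed (use nz c t r in auto)
  hence "c * (c * (norm (K t))\<^sup>2) \<le> c * norm (K y)"
    using c by (simp add: norm_mult power2_eq_square mult_ac)
  hence "c * (norm (K t))\<^sup>2 \<le> norm (K y)" using c by simp
  hence "M * (c * (norm (K t))\<^sup>2) \<le> M * norm (K y)" using M by simp
  thus "e * (norm (K t))\<^sup>2 \<le> M * norm (K y)" unfolding cM[symmetric] by (simp add: mult_ac)
qed

section \<open>Maximum principle and division by zeros\<close>

lemma norm_le_cball_if_le_sphere:
  fixes f :: "complex \<Rightarrow> complex"
  assumes "f holomorphic_on cball 0 r" "\<And>z. norm z = r \<Longrightarrow> norm (f z) \<le> B" "norm w \<le> r" "r > 0"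
  shows "norm (f w) \<le> B"
proof (rule maximum_modulus_frontier[of f "cball 0 r"])
  show "f holomorphic_on interior (cball 0 r)"
    using assms(1) holomorphic_on_subset interior_subset by blast
  show "continuous_on (closure (cball 0 r)) f"
    using assms(1) by (simp add: holomorphic_on_imp_continuous_on)
qed (use assms in auto)

text \<open>Substituting 1 / x turns the product into a polynomial with value 1 at the origin, and
  by the maximum principle it has modulus at least 1 somewhere on the circle of radius
  \<open>1 / \<rho>\<close>. This provides a point at which the divided-out factors are not too
  small.\<close>

lemma exists_prod_diff_ge:
  fixes S :: "complex set"
  assumes S: "finite S" and \<rho>: "\<rho> > 0"
  shows "\<exists>y. norm y = \<rho> \<and> \<rho> ^ card S \<le> norm (\<Prod>s\<in>S. y - s)"
proof -
  define Q where "Q x = (\<Prod>s\<in>S. 1 - s * x)" for x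
  have hol: "Q holomorphic_on A" for A unfolding Q_def by (intro holomorphic_intros)
  have "continuous_on (sphere 0 (1/\<rho>)) (\<lambda>x. norm (Q x))"
    by (intro continuous_intros holomorphic_on_imp_continuous_on hol)
  moreover have "compact (sphere (0::complex) (1/\<rho>))" "sphere (0::complex) (1/\<rho>) \<noteq> {}"
    using \<rho> by simp_all
  ultimately obtain x where x: "x \<in> sphere 0 (1/\<rho>)" "\<And>y. y \<in> sphere 0 (1/\<rho>) \<Longrightarrow> norm (Q y) \<le> norm (Q x)"
    using continuous_attains_sup by metis
  have "norm (Q 0) \<le> norm (Q x)"
    by (rule norm_le_cball_if_le_sphere[OF hol, of "1/\<rho>"]) (use x \<rho> in auto)
  hence Q1: "1 \<le> norm (Q x)" by (simp add: Q_def)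
  have nx: "norm x = 1 / \<rho>" using x by simp
  hence x0: "x \<noteq> 0" using \<rho> by auto
  have "Q x = (\<Prod>s\<in>S. x * (1 / x - s))"
    unfolding Q_def using x0 by (intro prod.cong) (auto simp: field_simps)
  also have "\<dots> = x ^ card S * (\<Prod>s\<in>S. 1 / x - s)" by (simp add: prod.distrib)
  finally have "1 \<le> (1 / \<rho>) ^ card S * norm (\<Prod>s\<in>S. 1 / x - s)"
    using Q1 nx by (simp add: norm_mult norm_power)
  hence "\<rho> ^ card S \<le> norm (\<Prod>s\<in>S. 1 / x - s)"
    using \<rho> by (simp add: power_divide field_simps)
  moreover have "norm (1 / x) = \<rho>" using nx by (simp add: norm_divide)
  ultimately show ?thesis by blast
qed

lemma holomorphic_divide_out_zeros:
  fixes G :: "complex \<Rightarrow> complex"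
  assumes "finite S" "G holomorphic_on UNIV" "\<And>s. s \<in> S \<Longrightarrow> G s = 0"
  shows "\<exists>H. H holomorphic_on UNIV \<and> (\<forall>t. G t = H t * (\<Prod>s\<in>S. t - s))"
  using assms
proof (induction S rule: finite_induct)
  case empty
  thus ?case by auto
next
  case (insert a S)
  then obtain H where H: "H holomorphic_on UNIV" "\<And>t. G t = H t * (\<Prod>s\<in>S. t - s)" by auto
  have "(\<Prod>s\<in>S. a - s) \<noteq> 0" using insert by auto
  hence Ha: "H a = 0" using H(2)[of a] insert.prems(2)[of a] by auto
  define K where "K z = (if z = a then deriv H a else (H z - H a) / (z - a))" for z
  have "K holomorphic_on UNIV"
    unfolding K_def using pole_lemma_open[OF H(1) open_UNIV] .
  moreover have "H t = K t * (t - a)" for t using Ha by (simp add: K_def)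
  hence "G t = K t * (\<Prod>s\<in>insert a S. t - s)" for t
    using H(2)[of t] insert.hyps by (simp add: mult_ac)
  ultimately show ?case by blast
qed

text \<open>By the product rule a remaining zero of \<open>H\<close> at \<open>a\<close> would make
  the derivative of \<open>G\<close> vanish there. In this way simplicity of the zeros enters the
  lower count, since only one factor per point is divided out.\<close>

lemma divide_out_simple_zero_nonzero:
  fixes G H :: "complex \<Rightarrow> complex"
  assumes S: "finite S" and H: "H holomorphic_on UNIV" and GH: "\<And>t. G t = H t * (\<Prod>s\<in>S. t - s)"
    and a: "a \<in> S" "deriv G a \<noteq> 0"
  shows "H a \<noteq> 0"
proof
  assume Ha: "H a = 0"
  define P where "P t = (\<Prod>s\<in>S. t - s)" for t :: complex
  have Pa: "P a = 0" using S a by (auto simp: P_def)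
  have "P holomorphic_on UNIV" unfolding P_def by (intro holomorphic_intros)
  hence "(P has_field_derivative deriv P a) (at a)" "(H has_field_derivative deriv H a) (at a)"
    using H holomorphic_derivI[OF _ open_UNIV UNIV_I] by blast+
  from DERIV_mult[OF this(2,1)] have "((\<lambda>t. H t * P t) has_field_derivative 0) (at a)"
    using Ha Pa by simp
  moreover have "G = (\<lambda>t. H t * P t)" using GH by (auto simp: P_def)
  ultimately have "deriv G a = 0" using DERIV_imp_deriv by blast
  thus False using a by simp
qed

text \<open>Jensen's inequality in elementary form: on the circle of radius
  \<open>5 * \<eta>\<close> each factor \<open>t - s\<close> has modulus at least
  \<open>4 * \<eta>\<close>, at \<open>z0\<close> at most \<open>2 * \<eta>\<close>, so every zero
  gains a factor 2 between the two.\<close>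

lemma card_zeros_upper:
  fixes G :: "complex \<Rightarrow> complex"
  assumes G: "G holomorphic_on UNIV" and \<eta>: "\<eta> > 0"
    and M: "\<And>t. norm t = 5 * \<eta> \<Longrightarrow> norm (G t) \<le> M"
    and z0: "norm z0 \<le> \<eta>" 
    and S: "finite S" "S \<subseteq> ball 0 \<eta>" "\<And>s. s \<in> S \<Longrightarrow> G s = 0"
  shows "2 ^ card S * norm (G z0) \<le> M"
proof -
  obtain H where H: "H holomorphic_on UNIV" "\<And>t. G t = H t * (\<Prod>s\<in>S. t - s)"
    using holomorphic_divide_out_zeros[OF S(1) G S(3)] by auto
  let ?n = "card S"
  have b: "norm (H t) \<le> M / (4 * \<eta>) ^ ?n" if t: "norm t = 5 * \<eta>" for t
  proof -
    have "(4 * \<eta>) ^ ?n = (\<Prod>s\<in>S. 4 * \<eta>)" by simp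
    also have "\<dots> \<le> (\<Prod>s\<in>S. norm (t - s))"
    proof (intro prod_mono conjI)
      fix s assume "s \<in> S"
      hence "norm s < \<eta>" using S(2) by auto
      thus "4 * \<eta> \<le> norm (t - s)" using norm_triangle_ineq2[of t s] t by linarith
    qed (use \<eta> in auto)
    also have "\<dots> = norm (\<Prod>s\<in>S. t - s)" by (simp add: prod_norm)
    finally have "norm (H t) * (4 * \<eta>) ^ ?n \<le> norm (H t) * norm (\<Prod>s\<in>S. t - s)"
      by (intro mult_left_mono) auto
    also have "\<dots> = norm (G t)" by (simp add: H(2) norm_mult)
    finally show ?thesis using M[OF t] \<eta> by (simp add: pos_le_divide_eq)
  qed
  have Hz: "norm (H z0) \<le> M / (4 * \<eta>) ^ ?n"
    by (rule norm_le_cball_if_le_sphere[of H "5 * \<eta>"])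
       (use b \<eta> z0 H(1) holomorphic_on_subset in auto)
  have "norm (\<Prod>s\<in>S. z0 - s) = (\<Prod>s\<in>S. norm (z0 - s))" by (simp add: prod_norm)
  also have "\<dots> \<le> (\<Prod>s\<in>S. 2 * \<eta>)"
  proof (intro prod_mono conjI)
    fix s assume "s \<in> S"
    hence "norm s < \<eta>" using S(2) by auto
    thus "norm (z0 - s) \<le> 2 * \<eta>" using norm_triangle_ineq4[of z0 s] z0 by linarith
  qed auto
  also have "\<dots> = (2 * \<eta>) ^ ?n" by simp
  finally have "norm (G z0) \<le> M / (4 * \<eta>) ^ ?n * (2 * \<eta>) ^ ?n"
    unfolding H(2)[of z0] norm_mult using Hz by (intro mult_mono) (use order_trans[OF norm_ge_zero Hz] in auto)
  also have "\<dots> = M * ((2 * \<eta>) / (4 * \<eta>)) ^ ?n" by (subst power_divide) simp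
  also have "(2 * \<eta>) / (4 * \<eta>) = 1 / 2" using \<eta> by simp
  finally show ?thesis by (simp add: power_divide field_simps)
qed

text \<open>The bound \<open>low\<close> near radius 19/20 \<open>\<eta>\<close> and the bound
  \<open>up\<close> at radius \<open>\<eta> / 2\<close> are incompatible for a function without
  zeros, by a factor exponential in \<open>L * \<eta>\<^sup>2\<close>. Each zero can make up for a
  factor 360 only, so their number is at least of the order of that exponent.\<close>

lemma card_zeros_lower:
  fixes G :: "complex \<Rightarrow> complex"
  assumes G: "G holomorphic_on UNIV" and \<eta>: "\<eta> > 0" and L: "L > 0"
    and up: "\<And>t. norm t \<le> 2 * \<eta> \<Longrightarrow> norm (G t) \<le> exp (L * (\<eta>\<^sup>2 / 100 + (norm t)\<^sup>2 / 2))"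
    and low: "\<And>y. norm y \<le> \<eta> \<Longrightarrow>
       \<exists>t. norm (t - y) \<le> \<eta> / 60 \<and> exp (L * ((norm t)\<^sup>2 / 2 - \<eta>\<^sup>2 / 100)) \<le> norm (G t)"
    and S: "S = {t. norm t < \<eta> \<and> G t = 0}" "finite S"
    and simple: "\<And>t. t \<in> S \<Longrightarrow> deriv G t \<noteq> 0"
  shows "\<eta>\<^sup>2 / 100 * L \<le> real (card S)"
proof -
  obtain H0 where H0: "H0 holomorphic_on UNIV" "\<And>t. G t = H0 t * (\<Prod>s\<in>S. t - s)"
    using holomorphic_divide_out_zeros[OF S(2) G] S(1) by auto
  let ?n = "card S"
  \<comment> \<open>With the divisor \<open>3 * \<eta>\<close> each factor
    \<open>norm (t - s) / (3 * \<eta>)\<close> is at most 1 inside the disc, hence |G| is at most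
    |H| there; on the circle of radius 21/20 \<open>\<eta>\<close> it is at least 1/60, which
    produces \<open>60 ^ ?n\<close> in \<open>M\<close>.\<close>
  define H where "H t = H0 t * of_real ((3 * \<eta>) ^ ?n)" for t
  have hol: "H holomorphic_on A" for A
    unfolding H_def by (intro holomorphic_intros holomorphic_on_subset[OF H0(1)]) auto
  have nG: "norm (G t) = norm (H t) * (\<Prod>s\<in>S. norm (t - s) / (3 * \<eta>))" for t
    using \<eta> by (simp add: H0(2) H_def norm_mult prod_norm prod_dividef norm_power)
  have nz: "H t \<noteq> 0" if "norm t < \<eta>" for t
  proof (cases "t \<in> S")
    case True
    show ?thesis
      using divide_out_simple_zero_nonzero[OF S(2) H0 True simple[OF True]] \<eta> by (simp add: H_def)
  next
    case False
    hence "G t \<noteq> 0" using that S(1) by auto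
    thus ?thesis using H0(2)[of t] \<eta> by (auto simp: H_def)
  qed
  define M where "M = exp (L * (\<eta>\<^sup>2 / 100 + (21/20 * \<eta>)\<^sup>2 / 2)) * 60 ^ ?n"
  have M0: "M > 0" by (simp add: M_def)
  have HM: "norm (H t) \<le> M" if "norm t \<le> 21/20 * \<eta>" for t
  proof (rule norm_le_cball_if_le_sphere[OF hol _ that])
    fix t :: complex assume t: "norm t = 21/20 * \<eta>"
    have "norm (H t) * (1/60) ^ ?n = norm (H t) * (\<Prod>s\<in>S. 1/60)" by simp
    also have "\<dots> \<le> norm (H t) * (\<Prod>s\<in>S. norm (t - s) / (3 * \<eta>))"
    proof (intro mult_left_mono prod_mono conjI)
      fix s assume "s \<in> S"
      hence "norm s < \<eta>" using S(1) by auto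
      hence "\<eta> / 20 \<le> norm (t - s)" using norm_triangle_ineq2[of t s] t by linarith
      thus "1/60 \<le> norm (t - s) / (3 * \<eta>)" using \<eta> by (simp add: field_simps)
    qed auto
    also have "\<dots> = norm (G t)" using nG by simp
    also have "\<dots> \<le> exp (L * (\<eta>\<^sup>2 / 100 + (21/20 * \<eta>)\<^sup>2 / 2))"
      using up[of t] t \<eta> by simp
    finally show "norm (H t) \<le> M" by (simp add: M_def power_divide field_simps)
  qed (use \<eta> in auto)
  \<comment> \<open>Points within \<open>\<eta> / 60\<close> of the circle of radius 19/20
    \<open>\<eta>\<close> have modulus at least 9/10 \<open>\<eta>\<close>. The factor 2 in the
    exponent and the division by \<open>M\<close> come from the square in Harnack's
    inequality.\<close>
  define m where "m = exp (L * (2 * ((9/10 * \<eta>)\<^sup>2 / 2 - \<eta>\<^sup>2 / 100))) / M"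
  have m0: "m > 0" using M0 by (simp add: m_def)
  have Hm: "m \<le> norm (H y)" if y: "norm y = 19/20 * \<eta>" for y
  proof -
    obtain t where t: "norm (t - y) \<le> \<eta> / 60" "exp (L * ((norm t)\<^sup>2 / 2 - \<eta>\<^sup>2 / 100)) \<le> norm (G t)"
      using low[of y] y \<eta> by auto
    have t1: "norm t < \<eta>" using norm_triangle_ineq2[of t y] t(1) y \<eta> by linarith
    have "norm y - norm t \<le> norm (t - y)" by (metis norm_minus_commute norm_triangle_ineq2)
    hence t2: "norm t \<ge> 9/10 * \<eta>" using t(1) y \<eta> by linarith
    have "(\<Prod>s\<in>S. norm (t - s) / (3 * \<eta>)) \<le> (\<Prod>s\<in>S. 1)"
    proof (intro prod_mono conjI)
      fix s assume "s \<in> S"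
      hence "norm s < \<eta>" using S(1) by auto
      hence "norm (t - s) \<le> 3 * \<eta>" using norm_triangle_ineq4[of t s] t1 \<eta> by linarith
      thus "norm (t - s) / (3 * \<eta>) \<le> 1" using \<eta> by simp
    qed (use \<eta> in auto)
    hence "norm (G t) \<le> norm (H t)" unfolding nG using mult_left_mono[of _ 1 "norm (H t)"] by simp
    moreover have "exp (L * ((9/10 * \<eta>)\<^sup>2 / 2 - \<eta>\<^sup>2 / 100)) \<le> exp (L * ((norm t)\<^sup>2 / 2 - \<eta>\<^sup>2 / 100))"
      using power_mono[OF t2, of 2] \<eta> L by simp
    ultimately have le: "exp (L * ((9/10 * \<eta>)\<^sup>2 / 2 - \<eta>\<^sup>2 / 100)) \<le> norm (H t)" using t(2) by linarith
    \<comment> \<open>The disc of radius \<open>\<eta> / 20\<close> about \<open>y\<close> lies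
      where \<open>H\<close> has no zeros, and \<open>\<eta> / 60\<close> is the third of its radius
      that Harnack's inequality requires.\<close>
    have sub: "norm z < \<eta>" if "z \<in> ball y (\<eta>/20)" for z
    proof -
      have "norm (z - y) < \<eta> / 20" using that by (simp add: dist_norm norm_minus_commute)
      thus ?thesis using norm_triangle_ineq2[of z y] y by linarith
    qed
    have "(norm (H t))\<^sup>2 \<le> M * norm (H y)"
    proof (rule Harnack_norm_sq_le[OF hol])
      show "norm (H z) \<le> M" if "z \<in> ball y (\<eta>/20)" for z
        using HM[of z] sub[OF that] \<eta> by linarith
    qed (use nz sub M0 t \<eta> in auto)
    moreover have "(exp (L * ((9/10 * \<eta>)\<^sup>2 / 2 - \<eta>\<^sup>2 / 100)))\<^sup>2 \<le> (norm (H t))\<^sup>2"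
      using le by (intro power_mono) auto
    ultimately have "exp (L * (2 * ((9/10 * \<eta>)\<^sup>2 / 2 - \<eta>\<^sup>2 / 100))) \<le> M * norm (H y)"
      by (simp add: exp_double[symmetric] mult.left_commute)
    thus ?thesis using M0 by (simp add: m_def field_simps)
  qed
  \<comment> \<open>Minimum principle: the maximum principle is applied to the inverse of
    \<open>H\<close>.\<close>
  have Hm': "m \<le> norm (H y)" if y: "norm y \<le> 19/20 * \<eta>" for y
  proof -
    have "norm (inverse (H y)) \<le> inverse m"
    proof (rule norm_le_cball_if_le_sphere[OF _ _ y])
      show "(\<lambda>y. inverse (H y)) holomorphic_on cball 0 (19/20*\<eta>)"
        by (intro holomorphic_intros hol nz) (use \<eta> in auto)
      show "norm (inverse (H z)) \<le> inverse m" if "norm z = 19/20 * \<eta>" for z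
        using Hm[OF that] m0 by (simp add: norm_inverse le_imp_inverse_le)
    qed (use \<eta> in auto)
    moreover have "H y \<noteq> 0" using nz[of y] y \<eta> by auto
    ultimately show ?thesis
      using m0 by (simp add: norm_inverse)
  qed
  \<comment> \<open>At this point the normalised product is at least \<open>(1/6) ^ ?n\<close>;
    together with \<open>60 ^ ?n\<close> from \<open>M\<close> this is the price 360 per
    zero.\<close>
  obtain y where y: "norm y = \<eta>/2" "(\<eta>/2) ^ ?n \<le> norm (\<Prod>s\<in>S. y - s)"
    using exists_prod_diff_ge[OF S(2), of "\<eta>/2"] \<eta> by auto
  have pr: "(\<Prod>s\<in>S. norm (y - s) / (3 * \<eta>)) = norm (\<Prod>s\<in>S. y - s) / (3*\<eta>) ^ ?n"
    by (simp add: prod_norm prod_dividef)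
  have "(1/6) ^ ?n = (\<eta>/2) ^ ?n / (3*\<eta>) ^ ?n" using \<eta> by (subst power_divide[symmetric]) simp
  also have "\<dots> \<le> (\<Prod>s\<in>S. norm (y - s) / (3 * \<eta>))"
    unfolding pr using y(2) \<eta> by (intro divide_right_mono) auto
  finally have "m * (1/6) ^ ?n \<le> norm (H y) * (\<Prod>s\<in>S. norm (y - s) / (3 * \<eta>))"
    using Hm'[of y] y(1) \<eta> m0 by (intro mult_mono) auto
  also have "\<dots> \<le> exp (L * (\<eta>\<^sup>2 / 100 + (\<eta>/2)\<^sup>2 / 2))" using nG[of y] up[of y] y(1) \<eta> by simp
  finally have "exp (L * (2 * ((9/10 * \<eta>)\<^sup>2 / 2 - \<eta>\<^sup>2 / 100))) \<le>
      exp (L * (\<eta>\<^sup>2 / 100 + (\<eta>/2)\<^sup>2 / 2)) * exp (L * (\<eta>\<^sup>2 / 100 + (21/20 * \<eta>)\<^sup>2 / 2)) * (6 ^ ?n * 60 ^ ?n)"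
    unfolding m_def M_def by (simp add: field_simps power_divide)
  also have "(6::real) ^ ?n * 60 ^ ?n = 360 ^ ?n" by (simp add: power_mult_distrib[symmetric])
  also have "(360::real) ^ ?n \<le> exp (9 * real ?n)"
  proof -
    have "(360::real) \<le> 2 ^ 9" by simp
    also have "\<dots> \<le> exp 1 ^ 9" using exp_ge_add_one_self[of 1] by (intro power_mono) auto
    also have "\<dots> = exp 9" by (simp add: exp_of_nat_mult[symmetric])
    finally have "(360::real) ^ ?n \<le> exp 9 ^ ?n" by (intro power_mono) auto
    thus ?thesis by (simp add: exp_of_nat_mult[symmetric] mult.commute)
  qed
  finally have "exp (L * (2 * ((9/10 * \<eta>)\<^sup>2 / 2 - \<eta>\<^sup>2 / 100))) \<le>
      exp (L * (\<eta>\<^sup>2 / 100 + (\<eta>/2)\<^sup>2 / 2) + L * (\<eta>\<^sup>2 / 100 + (21/20 * \<eta>)\<^sup>2 / 2) + 9 * real ?n)"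
    by (simp add: exp_add)
  hence "L * (2 * ((9/10 * \<eta>)\<^sup>2 / 2 - \<eta>\<^sup>2 / 100)) \<le>
      L * (\<eta>\<^sup>2 / 100 + (\<eta>/2)\<^sup>2 / 2) + L * (\<eta>\<^sup>2 / 100 + (21/20 * \<eta>)\<^sup>2 / 2) + 9 * real ?n"
    by simp
  \<comment> \<open>In units of \<open>L * \<eta>\<^sup>2\<close> the two sides are 0.79 and
    0.69625, and the difference is 3/32. Division by 9 leaves 1/96, slightly more than the claimed
    1/100.\<close>
  hence "(L * \<eta>\<^sup>2) * (3 / 32) \<le> 9 * real ?n"
    by (simp add: power2_eq_square field_simps)
  moreover have "0 \<le> L * \<eta>\<^sup>2" using L by simp
  ultimately show ?thesis by (simp add: field_simps)
qed

section \<open>Circle means in Fock space\<close>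

text \<open>As the circle parameter runs through a probability space, circle means are expectations,
  to which Jensen's inequality and Fubini's theorem apply directly.\<close>

definition unit_interval :: "real measure" where
  "unit_interval = restrict_space lborel {0..1}"

definition circ :: "real \<Rightarrow> complex" where
  "circ \<theta> = exp (2 * of_real pi * \<i> * of_real \<theta>)"

lemma norm_circ [simp]: "norm (circ \<theta>) = 1"
  by (simp add: circ_def)

lemma continuous_on_circ [continuous_intros]: "continuous_on A circ"
  unfolding circ_def by (intro continuous_intros)

lemma prob_space_unit_interval: "prob_space unit_interval"
  unfolding unit_interval_def by (rule prob_space_restrict_space) auto

interpretation unit_interval: prob_space unit_interval
  by (rule prob_space_unit_interval)

lemma measurable_unit_interval:
  "f \<in> measurable borel N \<Longrightarrow> f \<in> measurable unit_interval N"
  unfolding unit_interval_def by (rule measurable_restrict_space1) simp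

lemma measurable_circ [measurable]: "circ \<in> borel_measurable borel"
  by (intro borel_measurable_continuous_onI continuous_intros)

lemma integrable_unit_interval:
  fixes f :: "real \<Rightarrow> 'b::{banach, second_countable_topology}"
  assumes "continuous_on UNIV f"
  shows "integrable unit_interval f"
proof -
  have "compact (f ` {0..1})"
    using assms by (intro compact_continuous_image) (auto intro: continuous_on_subset)
  then obtain B where B: "\<And>x. x \<in> {0..1} \<Longrightarrow> norm (f x) \<le> B"
    using compact_imp_bounded bounded_iff by (metis imageI)
  show ?thesis
  proof (rule unit_interval.integrable_const_bound)
    show "AE x in unit_interval. norm (f x) \<le> B"
      using B by (intro AE_I2) (simp add: unit_interval_def space_restrict_space)
    show "f \<in> borel_measurable unit_interval"
      by (intro measurable_unit_interval borel_measurable_continuous_onI assms)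
  qed
qed

lemma integral_unit_interval:
  fixes f :: "real \<Rightarrow> 'b::euclidean_space"
  assumes "continuous_on UNIV f"
  shows "(\<integral>x. f x \<partial>unit_interval) = integral {0..1} f"
proof -
  have "set_integrable lborel {0..1} f"
    using integrable_unit_interval[OF assms]
    unfolding unit_interval_def set_integrable_def by (subst (asm) integrable_restrict_space) auto
  from set_borel_integral_eq_integral(2)[OF this] show ?thesis
    unfolding unit_interval_def set_lebesgue_integral_def by (subst integral_restrict_space) auto
qed

text \<open>Cauchy's integral formula with dz = 2 pi i z d\<theta> inserted, which leaves the kernel
  z / (z - t).\<close>

lemma Cauchy_circle_mean:
  fixes h :: "complex \<Rightarrow> complex"
  assumes h: "h holomorphic_on UNIV" and t: "norm t < r"
  shows "h t = (\<integral>\<theta>. h (of_real r * circ \<theta>) * (of_real r * circ \<theta> / (of_real r * circ \<theta> - t)) \<partial>unit_interval)"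
    (is "_ = integral\<^sup>L _ ?f")
proof -
  have r: "r > 0" using t norm_ge_zero[of t] by linarith
  have ne: "of_real r * circ \<theta> - t \<noteq> 0" for \<theta>
  proof
    assume "of_real r * circ \<theta> - t = 0"
    hence "norm (of_real r * circ \<theta>) = norm t" by simp
    thus False using t r by (simp add: norm_mult)
  qed
  have ch: "continuous_on A (\<lambda>x. h (g x))" if "continuous_on A g" for g and A :: "real set"
    using continuous_on_compose2[OF holomorphic_on_imp_continuous_on[OF h] that] by auto
  have cont: "continuous_on UNIV ?f"
    by (intro continuous_intros ch) (use ne in auto)
  have "((\<lambda>u. h u / (u - t)) has_contour_integral (2 * of_real pi * \<i> * h t)) (circlepath 0 r)"
    by (rule Cauchy_integral_circlepath_simple) (use h t holomorphic_on_subset in auto)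
  hence "((\<lambda>x. (2 * of_real pi * \<i>) * ?f x) has_integral (2 * of_real pi * \<i> * h t)) {0..1}"
    unfolding has_contour_integral_def
  proof (rule has_integral_eq[rotated])
    fix x :: real assume x: "x \<in> {0..1}"
    have "vector_derivative (circlepath 0 r) (at x within {0..1}) = 2 * of_real pi * \<i> * of_real r * exp (2 * of_real pi * \<i> * of_real x)"
      using vector_derivative_at_within_ivl[of "circlepath 0 r" _ x 0 1, OF has_vector_derivative_circlepath] x by simp
    moreover have "circlepath 0 r x = of_real r * circ x" by (simp add: circlepath circ_def)
    ultimately show "h (circlepath 0 r x) / (circlepath 0 r x - t) * vector_derivative (circlepath 0 r) (at x within {0..1})
        = (2 * of_real pi * \<i>) * ?f x"
      using ne[of x] by (simp add: circ_def)
  qed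
  hence "((\<lambda>x. (1 / (2 * of_real pi * \<i>)) * ((2 * of_real pi * \<i>) * ?f x)) has_integral
     (1 / (2 * of_real pi * \<i>)) * (2 * of_real pi * \<i> * h t)) {0..1}"
    by (rule has_integral_mult_right)
  hence "(?f has_integral h t) {0..1}" by simp
  thus ?thesis using integral_unit_interval[OF cont] by (simp add: integral_unique)
qed

lemma norm_kernel_ge:
  assumes "norm (t::complex) < r"
  shows "r - norm t \<le> norm (of_real r * circ \<theta> - t)"
  using norm_triangle_ineq2[of "of_real r * circ \<theta>" t] assms norm_ge_zero[of t]
  by (simp add: norm_mult del: norm_ge_zero)

lemma continuous_on_compose_circ:
  assumes "h holomorphic_on UNIV"
  shows "continuous_on UNIV (\<lambda>\<theta>. h (of_real r * circ \<theta>))"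
  by (rule continuous_on_compose2[OF holomorphic_on_imp_continuous_on[OF assms]])
     (intro continuous_intros, simp)

lemma integrable_Cauchy_kernel:
  assumes h: "h holomorphic_on UNIV" and t: "norm t < r"
  shows "integrable unit_interval (\<lambda>\<theta>. h (of_real r * circ \<theta>) * (of_real r * circ \<theta> / (of_real r * circ \<theta> - t)))"
proof -
  have "of_real r * circ \<theta> - t \<noteq> 0" for \<theta>
    using norm_kernel_ge[OF t, of \<theta>] t by auto
  thus ?thesis
    by (intro integrable_unit_interval continuous_on_mult continuous_on_divide
        continuous_on_compose_circ[OF h] continuous_on_diff continuous_on_const continuous_on_circ) blast
qed

lemma integrable_norm_compose_circ:
  assumes h: "h holomorphic_on UNIV"
  shows "integrable unit_interval (\<lambda>\<theta>. norm (h (of_real r * circ \<theta>)))"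
  by (intro integrable_unit_interval continuous_on_norm continuous_on_compose_circ[OF h])

lemma norm_le_circle_mean:
  assumes h: "h holomorphic_on UNIV" and t: "norm t < r"
  shows "norm (h t) \<le> r / (r - norm t) * (\<integral>\<theta>. norm (h (of_real r * circ \<theta>)) \<partial>unit_interval)"
proof -
  have r: "r > 0" using t norm_ge_zero[of t] by linarith
  have "norm (h t) \<le> (\<integral>\<theta>. norm (h (of_real r * circ \<theta>) * (of_real r * circ \<theta> / (of_real r * circ \<theta> - t))) \<partial>unit_interval)"
    unfolding Cauchy_circle_mean[OF h t] by (rule integral_norm_bound)
  also have "\<dots> \<le> (\<integral>\<theta>. r / (r - norm t) * norm (h (of_real r * circ \<theta>)) \<partial>unit_interval)"
  proof (rule integral_mono)
    show "norm (h (of_real r * circ \<theta>) * (of_real r * circ \<theta> / (of_real r * circ \<theta> - t)))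
       \<le> r / (r - norm t) * norm (h (of_real r * circ \<theta>))" for \<theta>
    proof -
      have "r / norm (of_real r * circ \<theta> - t) \<le> r / (r - norm t)"
        using norm_kernel_ge[OF t, of \<theta>] r t by (intro divide_left_mono mult_pos_pos) auto
      from mult_right_mono[OF this norm_ge_zero] show ?thesis
        using r by (simp add: norm_mult norm_divide mult.commute)
    qed
  qed (rule integrable_norm[OF integrable_Cauchy_kernel[OF h t]] integrable_mult_right[OF integrable_norm_compose_circ[OF h]])+
  also have "\<dots> = r / (r - norm t) * (\<integral>\<theta>. norm (h (of_real r * circ \<theta>)) \<partial>unit_interval)"
    by simp
  finally show ?thesis .
qed

text \<open>The Cauchy kernels for 0 and \<open>t\<close> differ by \<open>t / (c - t)\<close> up to
  sign, where \<open>c\<close> is the point on the circle; this is the source of the small factor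
  \<open>norm t\<close>.\<close>

lemma norm_diff_le_circle_mean:
  assumes h: "h holomorphic_on UNIV" and t: "norm t < r"
  shows "norm (h 0 - h t) \<le> norm t / (r - norm t) * (\<integral>\<theta>. norm (h (of_real r * circ \<theta>)) \<partial>unit_interval)"
proof -
  have r: "r > 0" using t norm_ge_zero[of t] by linarith
  hence z: "norm (0::complex) < r" by simp
  let ?k = "\<lambda>t \<theta>. h (of_real r * circ \<theta>) * (of_real r * circ \<theta> / (of_real r * circ \<theta> - t))"
  have eq: "h 0 - h t = (\<integral>\<theta>. ?k 0 \<theta> - ?k t \<theta> \<partial>unit_interval)"
    unfolding Cauchy_circle_mean[OF h t] Cauchy_circle_mean[OF h z]
    by (rule Bochner_Integration.integral_diff[symmetric, OF integrable_Cauchy_kernel[OF h z] integrable_Cauchy_kernel[OF h t]])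
  have "norm (h 0 - h t) \<le> (\<integral>\<theta>. norm (?k 0 \<theta> - ?k t \<theta>) \<partial>unit_interval)"
    unfolding eq by (rule integral_norm_bound)
  also have "\<dots> \<le> (\<integral>\<theta>. norm t / (r - norm t) * norm (h (of_real r * circ \<theta>)) \<partial>unit_interval)"
  proof (rule integral_mono)
    show "norm (?k 0 \<theta> - ?k t \<theta>) \<le> norm t / (r - norm t) * norm (h (of_real r * circ \<theta>))" for \<theta>
    proof -
      define c where "c = of_real r * circ \<theta>"
      have c: "c \<noteq> 0" "c - t \<noteq> 0" "r - norm t \<le> norm (c - t)"
        using norm_kernel_ge[OF t, of \<theta>] norm_kernel_ge[OF z, of \<theta>] t r by (auto simp: c_def)
      have "h c * (c / (c - 0)) - h c * (c / (c - t)) = - h c * (t / (c - t))"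
        using c by (simp add: field_simps)
      hence "norm (h c * (c / (c - 0)) - h c * (c / (c - t))) = norm (h c) * (norm t / norm (c - t))"
        by (simp add: norm_mult norm_divide)
      also have "\<dots> \<le> norm (h c) * (norm t / (r - norm t))"
        using c t by (intro mult_left_mono divide_left_mono mult_pos_pos) auto
      finally show ?thesis by (simp add: mult.commute c_def)
    qed
  qed (rule integrable_norm[OF Bochner_Integration.integrable_diff[OF integrable_Cauchy_kernel[OF h z] integrable_Cauchy_kernel[OF h t]]]
      integrable_mult_right[OF integrable_norm_compose_circ[OF h]])+
  also have "\<dots> = norm t / (r - norm t) * (\<integral>\<theta>. norm (h (of_real r * circ \<theta>)) \<partial>unit_interval)"
    by simp
  finally show ?thesis .
qed

section \<open>Jensen's inequality for powers\<close>

lemma powr_above_tangent: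
  fixes x m p :: real
  assumes "p \<ge> 1" "m > 0" "x \<ge> 0"
  shows "m powr p + p * m powr (p - 1) * (x - m) \<le> x powr p"
proof (cases "x = 0")
  case True
  have "m powr p = m powr (p - 1) * m" using assms by (simp add: powr_mult_base powr_diff)
  moreover have "m powr p * (1 - p) \<le> 0" using assms by (intro mult_nonneg_nonpos) auto
  ultimately show ?thesis using True assms by (simp add: algebra_simps)
next
  case False
  have "x powr p - m powr p \<ge> (p * m powr (p - 1)) * (x - m)"
  proof (rule convex_on_imp_above_tangent[OF powr_convex[OF assms(1)]])
    show "((\<lambda>x. x powr p) has_real_derivative p * m powr (p - 1)) (at m within {0<..})"
      using assms by (auto intro!: derivative_eq_intros)
    show "m \<in> interior {0<..}" using assms by (simp add: interior_open)
  qed (use False assms in auto)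
  thus ?thesis by linarith
qed

text \<open>The tangent of the power function at the mean is integrated. A vanishing mean, at which
  \<open>powr_above_tangent\<close> does not apply, makes the left side 0.\<close>

lemma (in prob_space) powr_expectation_le:
  fixes X :: "'a \<Rightarrow> real"
  assumes "p \<ge> 1" "integrable M X" "integrable M (\<lambda>x. X x powr p)" "\<And>x. X x \<ge> 0"
  shows "expectation X powr p \<le> expectation (\<lambda>x. X x powr p)"
proof (cases "expectation X = 0")
  case True
  have "0 \<le> expectation (\<lambda>x. X x powr p)" by (rule Bochner_Integration.integral_nonneg) auto
  thus ?thesis using True by simp
next
  case False
  define m where "m = expectation X"
  have "expectation X \<ge> 0" using assms(4) by (rule Bochner_Integration.integral_nonneg)
  hence m: "m > 0" using False by (simp add: m_def)
  have "expectation (\<lambda>x. m powr p + p * m powr (p - 1) * (X x - m)) \<le> expectation (\<lambda>x. X x powr p)"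
    by (intro integral_mono powr_above_tangent assms m Bochner_Integration.integrable_add
        integrable_mult_right Bochner_Integration.integrable_diff integrable_const)
  also have "expectation (\<lambda>x. m powr p + p * m powr (p - 1) * (X x - m)) = m powr p"
    using assms(2) by (simp add: m_def prob_space)
  finally show ?thesis by (simp add: m_def)
qed

lemma powr_add_le_two_powr:
  fixes a b p :: real
  assumes "a \<ge> 0" "b \<ge> 0" "p \<ge> 0"
  shows "(a + b) powr p \<le> 2 powr p * (a powr p + b powr p)"
proof -
  have "(a + b) powr p \<le> (2 * max a b) powr p" using assms by (intro powr_mono2) auto
  also have "\<dots> = 2 powr p * (max a b) powr p" using assms by (simp add: powr_mult)
  also have "(max a b) powr p \<le> a powr p + b powr p" by (auto simp: max_def)
  finally show ?thesis by simp
qed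

section \<open>The weighted modulus and its local estimates\<close>

definition fock_abs :: "(complex \<Rightarrow> complex) \<Rightarrow> complex \<Rightarrow> real" where
  "fock_abs f z = norm (f z) * exp (- (norm z)\<^sup>2 / 2)"

lemma fock_abs_nonneg [simp]: "fock_abs f z \<ge> 0"
  by (simp add: fock_abs_def)

lemma continuous_on_fock_abs:
  assumes "f holomorphic_on UNIV"
  shows "continuous_on A (fock_abs f)"
  unfolding fock_abs_def
  by (intro continuous_intros continuous_on_subset[OF holomorphic_on_imp_continuous_on[OF assms]]) auto

lemma fock_abs_powr:
  "fock_abs f z powr p = norm (f z) powr p * exp (- p * (norm z)\<^sup>2 / 2)"
  by (simp add: fock_abs_def powr_mult exp_powr_real mult.commute)

text \<open>The exponential twist makes the translation compatible with the weight and keeps it holomorphic.\<close>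

definition fock_shift :: "(complex \<Rightarrow> complex) \<Rightarrow> complex \<Rightarrow> complex \<Rightarrow> complex" where
  "fock_shift f \<xi> t = f (\<xi> + t) * exp (- (t * cnj \<xi>) - of_real ((norm \<xi>)\<^sup>2 / 2))"

lemma holomorphic_fock_shift:
  assumes "f holomorphic_on UNIV"
  shows "fock_shift f \<xi> holomorphic_on A"
  unfolding fock_shift_def
  by (intro holomorphic_intros holomorphic_on_compose_gen[OF _ assms, unfolded o_def]) auto

text \<open>The twist cancels the cross term \<open>2 * Re (t * cnj \<xi>)\<close> in the squared
  modulus of \<open>\<xi> + t\<close>, so that only a factor depending on \<open>norm t\<close>
  remains.\<close>

lemma norm_fock_shift: "norm (fock_shift f \<xi> t) = fock_abs f (\<xi> + t) * exp ((norm t)\<^sup>2 / 2)"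
proof -
  have "(norm (\<xi> + t))\<^sup>2 = (norm \<xi>)\<^sup>2 + (norm t)\<^sup>2 + 2 * Re (t * cnj \<xi>)"
    unfolding cmod_power2 by (simp add: power2_eq_square algebra_simps)
  hence "Re (- (t * cnj \<xi>) - of_real ((norm \<xi>)\<^sup>2 / 2)) = - (norm (\<xi> + t))\<^sup>2 / 2 + (norm t)\<^sup>2 / 2"
    by simp (simp add: field_simps)
  thus ?thesis
    unfolding fock_shift_def fock_abs_def norm_mult norm_exp_eq_Re mult.assoc exp_add[symmetric] by simp
qed

text \<open>Both are kernel estimates on the unit circle for the shifted function, with
  \<open>1 / (1 - norm t) \<le> 5/4\<close> and \<open>exp (1/2) \<le> 7/4\<close>. The second has
  an error proportional to \<open>norm t\<close>, which can be absorbed on small discs.\<close>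

lemma fock_abs_circle_estimates:
  fixes \<xi> t :: complex
  assumes f: "f holomorphic_on UNIV" and t: "norm t \<le> 1/5"
  defines "m \<equiv> (\<integral>\<theta>. fock_abs f (\<xi> + circ \<theta>) \<partial>unit_interval)"
  shows "fock_abs f (\<xi> + t) \<le> 3 * m" "fock_abs f \<xi> \<le> 2 * fock_abs f (\<xi> + t) + 3 * norm t * m"
proof -
  let ?h = "fock_shift f \<xi>"
  have h: "?h holomorphic_on UNIV" by (rule holomorphic_fock_shift[OF f])
  have m0: "m \<ge> 0" unfolding m_def by (intro Bochner_Integration.integral_nonneg) auto
  have e: "exp (1/2::real) \<le> 7/4" using exp_bound[of "1/2::real"] by (simp add: power2_eq_square)
  have int: "(\<integral>\<theta>. norm (?h (of_real 1 * circ \<theta>)) \<partial>unit_interval) = exp (1/2) * m"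
    by (simp add: norm_fock_shift m_def mult.commute)
  have "fock_abs f (\<xi> + t) \<le> fock_abs f (\<xi> + t) * exp ((norm t)\<^sup>2 / 2)"
    by (rule mult_right_le_one_le[THEN order_trans[rotated]] mult_left_mono[of 1 _ "fock_abs f (\<xi> + t)", simplified]) auto
  also have "\<dots> \<le> 1 / (1 - norm t) * (exp (1/2) * m)"
    using norm_le_circle_mean[OF h, of t 1] t unfolding int norm_fock_shift by (simp add: m_def mult.commute)
  also have "1 / (1 - norm t) \<le> 5/4" using t by (simp add: field_simps)
  hence "1 / (1 - norm t) * (exp (1/2) * m) \<le> 5/4 * (7/4 * m)"
    using e m0 t by (intro mult_mono) auto
  also have "\<dots> \<le> 3 * m" using m0 by simp
  finally show "fock_abs f (\<xi> + t) \<le> 3 * m" .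
  have "norm t / (1 - norm t) \<le> 5/4 * norm t"
  proof -
    have "norm t * (1 / (1 - norm t)) \<le> norm t * (5/4)" using \<open>1 / (1 - norm t) \<le> 5/4\<close> by (intro mult_left_mono) auto
    thus ?thesis by simp
  qed
  hence "norm t / (1 - norm t) * (exp (1/2) * m) \<le> (5/4 * norm t) * (7/4 * m)"
    using e m0 t by (intro mult_mono) auto
  also have "\<dots> \<le> 3 * norm t * m" using m0 mult_nonneg_nonneg[OF norm_ge_zero[of t] m0] by simp
  finally have d: "norm (?h 0 - ?h t) \<le> 3 * norm t * m"
    using norm_diff_le_circle_mean[OF h, of t 1] t unfolding int by simp
  have "(norm t)\<^sup>2 \<le> (1/5)\<^sup>2" using t by (intro power_mono) auto
  hence "(norm t)\<^sup>2 / 2 \<le> 1/2" by (simp add: power2_eq_square)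
  hence "exp ((norm t)\<^sup>2 / 2) \<le> exp (1/2)" by (rule exp_le_cancel_iff[THEN iffD2])
  hence e2: "exp ((norm t)\<^sup>2 / 2) \<le> 2" using e by linarith
  have "norm (?h t) \<le> 2 * fock_abs f (\<xi> + t)"
    unfolding norm_fock_shift using mult_left_mono[OF e2 fock_abs_nonneg[of f "\<xi> + t"]]
    by (simp only: mult.commute)
  moreover have "norm (?h 0) = fock_abs f \<xi>" by (simp add: norm_fock_shift)
  moreover have "norm (?h 0) \<le> norm (?h t) + norm (?h 0 - ?h t)" by norm
  ultimately show "fock_abs f \<xi> \<le> 2 * fock_abs f (\<xi> + t) + 3 * norm t * m" using d by linarith
qed

definition circle_mean :: "(complex \<Rightarrow> real) \<Rightarrow> complex \<Rightarrow> real" where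
  "circle_mean w \<xi> = (\<integral>\<theta>. w (\<xi> + circ \<theta>) \<partial>unit_interval)"

lemma circle_mean_nonneg: "(\<And>z. w z \<ge> 0) \<Longrightarrow> circle_mean w \<xi> \<ge> 0"
  unfolding circle_mean_def by (intro Bochner_Integration.integral_nonneg) auto

text \<open>By Fubini and translation invariance of area, passing to circle means does not change
  the integral; pointwise bounds by circle means thus become bounds by the Fock norm. The
  computation with nonnegative integrals gives integrability together with the value.\<close>

lemma integral_circle_mean:
  fixes w :: "complex \<Rightarrow> real"
  assumes c: "continuous_on UNIV w" and nn: "\<And>z. w z \<ge> 0" and int: "integrable lborel w"
  shows "integrable lborel (circle_mean w)" "(\<integral>\<xi>. circle_mean w \<xi> \<partial>lborel) = (\<integral>z. w z \<partial>lborel)"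
proof -
  interpret P: pair_sigma_finite lborel unit_interval ..
  have wm [measurable]: "w \<in> borel_measurable borel"
    by (rule borel_measurable_continuous_onI[OF c])
  have m [measurable]: "(\<lambda>(\<xi>, \<theta>). w (\<xi> + circ \<theta>)) \<in> borel_measurable (lborel \<Otimes>\<^sub>M unit_interval)"
  proof -
    have [measurable]: "circ \<in> borel_measurable unit_interval" by (rule measurable_unit_interval) simp
    show ?thesis by measurable
  qed
  have i: "integrable unit_interval (\<lambda>\<theta>. w (\<xi> + circ \<theta>))" for \<xi>
    by (intro integrable_unit_interval continuous_on_compose2[OF c] continuous_intros) auto
  have meas: "circle_mean w \<in> borel_measurable lborel"
    unfolding circle_mean_def[abs_def] using unit_interval.borel_measurable_lebesgue_integral[OF m] by simp
  have "(\<integral>\<^sup>+\<xi>. ennreal (circle_mean w \<xi>) \<partial>lborel) = (\<integral>\<^sup>+\<xi>. (\<integral>\<^sup>+\<theta>. ennreal (w (\<xi> + circ \<theta>)) \<partial>unit_interval) \<partial>lborel)"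
    unfolding circle_mean_def by (intro nn_integral_cong nn_integral_eq_integral[symmetric] i) (auto simp: nn)
  also have "\<dots> = (\<integral>\<^sup>+\<theta>. (\<integral>\<^sup>+\<xi>. ennreal (w (\<xi> + circ \<theta>)) \<partial>lborel) \<partial>unit_interval)"
    by (rule P.Fubini'[symmetric]) (use measurable_compose[OF m measurable_ennreal] in \<open>simp add: split_beta'\<close>)
  also have "\<dots> = (\<integral>\<^sup>+\<theta>. (\<integral>\<^sup>+\<xi>. ennreal (w \<xi>) \<partial>lborel) \<partial>unit_interval)"
  proof (rule nn_integral_cong)
    fix \<theta>
    have "(\<integral>\<^sup>+\<xi>. ennreal (w \<xi>) \<partial>lborel) = (\<integral>\<^sup>+\<xi>. ennreal (w \<xi>) \<partial>distr lborel borel ((+) (circ \<theta>)))"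
      by (simp add: lborel_distr_plus)
    also have "\<dots> = (\<integral>\<^sup>+\<xi>. ennreal (w (circ \<theta> + \<xi>)) \<partial>lborel)" by (subst nn_integral_distr) auto
    finally show "(\<integral>\<^sup>+\<xi>. ennreal (w (\<xi> + circ \<theta>)) \<partial>lborel) = (\<integral>\<^sup>+\<xi>. ennreal (w \<xi>) \<partial>lborel)"
      by (simp add: add.commute)
  qed
  also have "\<dots> = (\<integral>\<^sup>+\<xi>. ennreal (w \<xi>) \<partial>lborel)"
    unfolding nn_integral_const unit_interval.emeasure_space_1 by simp
  also have "\<dots> = ennreal (\<integral>z. w z \<partial>lborel)" by (rule nn_integral_eq_integral[OF int]) (simp add: nn)
  finally have eq: "(\<integral>\<^sup>+\<xi>. ennreal (circle_mean w \<xi>) \<partial>lborel) = ennreal (\<integral>z. w z \<partial>lborel)" .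
  show int': "integrable lborel (circle_mean w)"
  proof (rule integrableI_nonneg[OF meas])
    show "AE x in lborel. 0 \<le> circle_mean w x" by (intro AE_I2 circle_mean_nonneg nn)
  qed (simp add: eq)
  have "ennreal (\<integral>\<xi>. circle_mean w \<xi> \<partial>lborel) = ennreal (\<integral>z. w z \<partial>lborel)"
    by (subst eq[symmetric], rule nn_integral_eq_integral[OF int', symmetric]) (intro AE_I2 circle_mean_nonneg nn)
  moreover have "(\<integral>\<xi>. circle_mean w \<xi> \<partial>lborel) \<ge> 0" "(\<integral>z. w z \<partial>lborel) \<ge> 0"
    by (intro Bochner_Integration.integral_nonneg nn circle_mean_nonneg)+
  ultimately show "(\<integral>\<xi>. circle_mean w \<xi> \<partial>lborel) = (\<integral>z. w z \<partial>lborel)"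
    by (simp only: ennreal_inj)
qed

text \<open>Jensen's inequality moves the power inside the circle mean. Splitting the power of a sum
  costs \<open>2 powr p\<close>, which turns the factors 2 and 3 into 4 and 6.\<close>

lemma fock_abs_powr_estimates:
  fixes \<xi> t :: complex
  assumes f: "f holomorphic_on UNIV" and t: "norm t \<le> 1/5" and p: "p \<ge> 1"
  defines "w \<equiv> \<lambda>z. fock_abs f z powr p"
  shows "w (\<xi> + t) \<le> 3 powr p * circle_mean w \<xi>"
    "w \<xi> \<le> 4 powr p * w (\<xi> + t) + (6 * norm t) powr p * circle_mean w \<xi>"
proof -
  define m where "m = (\<integral>\<theta>. fock_abs f (\<xi> + circ \<theta>) \<partial>unit_interval)"
  have m0: "m \<ge> 0" unfolding m_def by (intro Bochner_Integration.integral_nonneg) auto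
  have c: "continuous_on UNIV (\<lambda>\<theta>. fock_abs f (\<xi> + circ \<theta>))"
    by (intro continuous_on_compose2[OF continuous_on_fock_abs[OF f, of UNIV]] continuous_intros) auto
  have mp: "m powr p \<le> circle_mean w \<xi>"
    unfolding m_def w_def circle_mean_def
    by (intro unit_interval.powr_expectation_le[OF p] integrable_unit_interval c continuous_on_powr' continuous_intros)
       (use p in auto)
  have "w (\<xi> + t) \<le> (3 * m) powr p"
    unfolding w_def using fock_abs_circle_estimates(1)[OF f t, of \<xi>] p by (intro powr_mono2) (auto simp: m_def)
  also have "\<dots> = 3 powr p * m powr p" using m0 by (simp add: powr_mult)
  also have "\<dots> \<le> 3 powr p * circle_mean w \<xi>" using mp by (intro mult_left_mono) auto
  finally show "w (\<xi> + t) \<le> 3 powr p * circle_mean w \<xi>" .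
  have "w \<xi> \<le> (2 * fock_abs f (\<xi> + t) + 3 * norm t * m) powr p"
    unfolding w_def using fock_abs_circle_estimates(2)[OF f t, of \<xi>] p by (intro powr_mono2) (auto simp: m_def)
  also have "\<dots> \<le> 2 powr p * ((2 * fock_abs f (\<xi> + t)) powr p + (3 * norm t * m) powr p)"
    using m0 p by (intro powr_add_le_two_powr) auto
  also have "\<dots> = (2 * 2) powr p * w (\<xi> + t) + (2 * (3 * norm t)) powr p * m powr p"
    using m0 unfolding w_def by (simp only: powr_mult fock_abs_nonneg norm_ge_zero mult_nonneg_nonneg zero_le_numeral) (simp add: algebra_simps)
  also have "\<dots> \<le> 4 powr p * w (\<xi> + t) + (6 * norm t) powr p * circle_mean w \<xi>"
    using mp by (intro add_mono mult_mono) (auto simp: w_def)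
  finally show "w \<xi> \<le> 4 powr p * w (\<xi> + t) + (6 * norm t) powr p * circle_mean w \<xi>" .
qed

section \<open>Sampling from zero counts\<close>

lemma integrable_gaussian_real:
  assumes "c > 0"
  shows "integrable lborel (\<lambda>x::real. exp (- c * x\<^sup>2))"
proof -
  define \<sigma> where "\<sigma> = sqrt (1 / (2 * c))"
  have \<sigma>: "\<sigma> > 0" "\<sigma>\<^sup>2 = 1 / (2 * c)" using assms by (auto simp: \<sigma>_def)
  have "(\<lambda>x::real. exp (- c * x\<^sup>2)) = (\<lambda>x. sqrt (2 * pi * \<sigma>\<^sup>2) * normal_density 0 \<sigma> x)"
    using assms \<sigma> by (auto simp: normal_density_def fun_eq_iff)
  thus ?thesis using integrable_normal_density[OF \<sigma>(1), of 0] by simp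
qed

lemma integrable_gaussian_complex:
  assumes c: "c > 0"
  shows "integrable lborel (\<lambda>z::complex. exp (- c * (norm z)\<^sup>2))"
proof (rule integrableI_nonneg)
  have "(\<integral>\<^sup>+z. ennreal (exp (- c * (norm (z::complex))\<^sup>2)) \<partial>lborel)
      = (\<integral>\<^sup>+z. (\<Prod>b\<in>Basis. ennreal (exp (- c * (z \<bullet> b)\<^sup>2))) \<partial>(lborel :: complex measure))"
    by (intro nn_integral_cong)
       (simp add: Basis_complex_def ennreal_mult[symmetric] exp_add[symmetric] cmod_power2 algebra_simps)
  also have "\<dots> = (\<Prod>b\<in>(Basis :: complex set). (\<integral>\<^sup>+x. ennreal (exp (- c * x\<^sup>2)) \<partial>lborel))"
    by (rule nn_integral_lborel_prod) auto
  also have "\<dots> < \<infinity>"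
    using integrable_gaussian_real[OF c] by (simp add: nn_integral_eq_integral Basis_complex_def ennreal_mult_less_top)
  finally show "(\<integral>\<^sup>+z. ennreal (exp (- c * (norm (z::complex))\<^sup>2)) \<partial>lborel) < \<infinity>" .
qed auto

lemma power_le_fact_exp: "x \<ge> 0 \<Longrightarrow> x ^ i \<le> fact i * exp (x::real)"
proof -
  assume x: "x \<ge> 0"
  have "x ^ i /\<^sub>R fact i \<le> (\<Sum>n. x ^ n /\<^sub>R fact n)"
    using sum_le_suminf[OF summable_exp_generic, of "{i}" x] x by simp
  thus ?thesis by (simp add: exp_def field_simps)
qed

text \<open>The rate 1/4 is half of the rate of the weight, so the weighted modulus of a polynomial
  keeps a Gaussian factor and its powers are integrable.\<close>

lemma norm_poly_le_gaussian:
  fixes f :: "complex poly"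
  shows "\<exists>C\<ge>0. \<forall>z. norm (poly f z) \<le> C * exp ((norm z)\<^sup>2 / 4)"
proof -
  have *: "norm (poly f z) \<le> (\<Sum>i\<le>degree f. norm (coeff f i) * fact i * exp 1) * exp ((norm z)\<^sup>2 / 4)" for z
  proof -
    have "norm z ^ i \<le> fact i * exp 1 * exp ((norm z)\<^sup>2 / 4)" for i
    proof -
      have "norm z ^ i \<le> fact i * exp (norm z)" by (rule power_le_fact_exp) simp
      also have "norm z \<le> 1 + (norm z)\<^sup>2 / 4"
        using zero_le_power2[of "norm z / 2 - 1"] by (simp add: power2_eq_square algebra_simps)
      hence "exp (norm z) \<le> exp 1 * exp ((norm z)\<^sup>2 / 4)" by (simp add: exp_add[symmetric])
      finally show ?thesis by (simp add: mult.assoc)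
    qed
    hence "norm (coeff f i * z ^ i) \<le> norm (coeff f i) * fact i * exp 1 * exp ((norm z)\<^sup>2 / 4)" for i
      using mult_left_mono[of "norm z ^ i" "fact i * exp 1 * exp ((norm z)\<^sup>2 / 4)" "norm (coeff f i)"]
      by (simp add: norm_mult norm_power mult.assoc)
    thus ?thesis unfolding poly_altdef sum_distrib_right by (intro sum_norm_le) auto
  qed
  have "0 \<le> (\<Sum>i\<le>degree f. norm (coeff f i) * fact i * exp 1)" by (intro sum_nonneg) auto
  with * show ?thesis by blast
qed

lemma holomorphic_poly: "poly f holomorphic_on A"
  by (intro holomorphic_intros)

lemma continuous_on_fock_powr:
  assumes "f holomorphic_on UNIV" "p > 0"
  shows "continuous_on UNIV (\<lambda>z. fock_abs f z powr p)"
  by (intro continuous_on_powr' continuous_on_fock_abs assms continuous_on_const) (use assms in auto)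

lemma integrable_fock_powr:
  fixes f :: "complex poly"
  assumes p: "p \<ge> 1"
  shows "integrable lborel (\<lambda>z. fock_abs (poly f) z powr p)"
proof -
  obtain C where C: "C \<ge> 0" "\<And>z. norm (poly f z) \<le> C * exp ((norm z)\<^sup>2 / 4)"
    using norm_poly_le_gaussian by blast
  have le: "fock_abs (poly f) z powr p \<le> C powr p * exp (- (p / 4) * (norm z)\<^sup>2)" for z
  proof -
    have "fock_abs (poly f) z \<le> C * exp ((norm z)\<^sup>2 / 4) * exp (- (norm z)\<^sup>2 / 2)"
      unfolding fock_abs_def using C(2) by (intro mult_right_mono) auto
    also have "\<dots> = C * exp (- (norm z)\<^sup>2 / 4)" by (simp add: mult.assoc exp_add[symmetric])
    finally have "fock_abs (poly f) z powr p \<le> (C * exp (- (norm z)\<^sup>2 / 4)) powr p"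
      using p by (intro powr_mono2) auto
    thus ?thesis using C(1) by (simp add: powr_mult exp_powr_real mult.commute)
  qed
  have "integrable lborel (\<lambda>z::complex. C powr p * exp (- (p / 4) * (norm z)\<^sup>2))"
    using integrable_gaussian_complex[of "p/4"] p by simp
  moreover have "(\<lambda>z. fock_abs (poly f) z powr p) \<in> borel_measurable lborel"
    using borel_measurable_continuous_onI[OF continuous_on_fock_powr[OF holomorphic_poly, of p]] p by simp
  ultimately show ?thesis
  proof (rule Bochner_Integration.integrable_bound)
    show "AE z in lborel. norm (fock_abs (poly f) z powr p) \<le> norm (C powr p * exp (- (p / 4) * (norm z)\<^sup>2))"
      using order_trans[OF le abs_ge_self] by (intro AE_I2) simp
  qed
qed

section \<open>Point evaluation and decay of polynomials\<close>

lemma measure_lborel_ball_complex: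
  "r \<ge> 0 \<Longrightarrow> measure lborel (ball (z::complex) r) = pi * r\<^sup>2"
  using content_ball[of r z] by (simp add: unit_ball_vol_2)

lemma integrable_indicator_ball:
  "integrable lborel (\<lambda>\<xi>. indicator (ball (z::complex) r) \<xi> :: real)"
  by (intro integrable_real_indicator) (use emeasure_bounded_finite[OF bounded_ball, of z r] in auto)

text \<open>The circle estimate is integrated over all centres in the disc of radius 1/5 about
  \<open>z\<close>, whose area is pi / 25.\<close>

lemma fock_powr_le_integral:
  fixes f :: "complex poly"
  assumes p: "p \<ge> 1"
  shows "fock_abs (poly f) z powr p \<le> 25 * 3 powr p / pi * (\<integral>z. fock_abs (poly f) z powr p \<partial>lborel)"
proof -
  define w where "w = (\<lambda>z. fock_abs (poly f) z powr p)"
  have c: "continuous_on UNIV w" unfolding w_def by (rule continuous_on_fock_powr[OF holomorphic_poly]) (use p in simp)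
  have i: "integrable lborel w" unfolding w_def by (rule integrable_fock_powr[OF p])
  have nn: "w z \<ge> 0" for z by (simp add: w_def)
  note V = integral_circle_mean[OF c nn i]
  have "(\<integral>\<xi>. indicator (ball z (1/5)) \<xi> * w z \<partial>lborel) \<le> (\<integral>\<xi>. 3 powr p * circle_mean w \<xi> \<partial>lborel)"
  proof (rule integral_mono)
    show "integrable lborel (\<lambda>\<xi>. indicator (ball z (1/5)) \<xi> * w z)"
      using integrable_indicator_ball by (rule integrable_mult_left)
    show "integrable lborel (\<lambda>\<xi>. 3 powr p * circle_mean w \<xi>)"
      using V(1) by (rule integrable_mult_right)
    show "indicator (ball z (1/5)) \<xi> * w z \<le> 3 powr p * circle_mean w \<xi>" for \<xi>
    proof (cases "\<xi> \<in> ball z (1/5)")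
      case True
      hence "norm (z - \<xi>) \<le> 1/5" by (simp add: dist_norm)
      from fock_abs_powr_estimates(1)[OF holomorphic_poly this p, of f \<xi>] True show ?thesis
        by (simp add: w_def)
    qed (use circle_mean_nonneg[OF nn] in auto)
  qed
  hence "pi / 25 * w z \<le> 3 powr p * (\<integral>z. w z \<partial>lborel)"
    by (simp add: measure_lborel_ball_complex V(2) power2_eq_square)
  thus ?thesis unfolding w_def by (simp add: field_simps)
qed

text \<open>Bernstein-Walsh inequality: the maximum principle for the reflected polynomial on the
  disc of radius \<open>1 / \<rho>\<close> controls \<open>f\<close> outside the disc of radius
  \<open>\<rho>\<close>.\<close>

lemma poly_growth_outside_disc:
  fixes f :: "complex poly"
  assumes \<rho>: "\<rho> > 0" and M: "\<And>z. norm z = \<rho> \<Longrightarrow> norm (poly f z) \<le> M" and d: "degree f \<le> d"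
    and z: "norm z \<ge> \<rho>"
  shows "norm (poly f z) \<le> M * (norm z / \<rho>) ^ d"
proof -
  define q where "q = reflect_poly f"
  have M0: "M \<ge> 0" using order_trans[OF norm_ge_zero M[of "of_real \<rho>"]] \<rho> by simp
  have z0: "z \<noteq> 0" using z \<rho> by auto
  have q: "poly q x = x ^ degree f * poly f (inverse x)" if "x \<noteq> 0" for x
    unfolding q_def using that by (rule poly_reflect_poly_nz)
  have "norm (poly q (inverse z)) \<le> (1 / \<rho>) ^ degree f * M"
  proof (rule maximum_modulus_frontier[of "poly q" "cball 0 (1 / \<rho>)"])
    fix x :: complex assume "x \<in> frontier (cball 0 (1 / \<rho>))"
    hence x: "norm x = 1 / \<rho>" using \<rho> by (simp add: frontier_cball)
    hence x0: "x \<noteq> 0" using \<rho> by auto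
    have "norm (poly f (inverse x)) \<le> M" using M[of "inverse x"] x \<rho> by (simp add: norm_inverse)
    thus "norm (poly q x) \<le> (1 / \<rho>) ^ degree f * M"
      unfolding q[OF x0] norm_mult norm_power x using \<rho> by (intro mult_left_mono) auto
  next
    show "inverse z \<in> cball 0 (1 / \<rho>)"
      using z z0 \<rho> by (simp add: norm_inverse inverse_eq_divide frac_le norm_divide)
  qed (auto intro!: holomorphic_poly continuous_intros)
  hence "inverse (norm z) ^ degree f * norm (poly f z) \<le> (1 / \<rho>) ^ degree f * M"
    using q[of "inverse z"] z0 by (simp add: norm_mult norm_power norm_inverse)
  hence "norm (poly f z) \<le> M * (norm z / \<rho>) ^ degree f"
    using z0 \<rho> by (simp add: field_simps power_divide)
  also have "\<dots> \<le> M * (norm z / \<rho>) ^ d"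
    using M0 z \<rho> d by (intro mult_left_mono power_increasing) auto
  finally show ?thesis .
qed

text \<open>Outside the disc of radius \<open>sqrt d\<close> a polynomial of degree \<open>d\<close> grows at most like \<open>\<bar>z\<bar>\<^sup>d\<close>,
  which is beaten by the weight once \<open>\<bar>z\<bar>\<^sup>2 \<ge> 1.9 d\<close>.\<close>

lemma fock_abs_decay:
  fixes f :: "complex poly"
  assumes d: "degree f \<le> d" "d \<ge> 1" and s: "\<And>z. fock_abs (poly f) z \<le> s"
    and z: "(norm z)\<^sup>2 \<ge> 19/10 * real d"
  shows "fock_abs (poly f) z \<le> s * exp (- (norm z)\<^sup>2 / 20)"
proof -
  have d0: "real d > 0" using d by simp
  define x where "x = (norm z)\<^sup>2 / real d"
  have x: "x \<ge> 19/10" using z d0 by (simp add: x_def field_simps)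
  have s0: "s \<ge> 0" using s[of 0] fock_abs_nonneg order_trans by blast
  have nz: "norm z \<ge> sqrt (real d)" using z d0 by (intro real_le_lsqrt) auto
  have "norm (poly f y) \<le> s * exp (real d / 2)" if y: "norm y = sqrt (real d)" for y
  proof -
    have "norm (poly f y) = fock_abs (poly f) y * exp ((norm y)\<^sup>2 / 2)"
      by (simp add: fock_abs_def mult.assoc exp_add[symmetric])
    also have "\<dots> \<le> s * exp ((norm y)\<^sup>2 / 2)" using s by (intro mult_right_mono) auto
    finally show ?thesis using y by simp
  qed
  from poly_growth_outside_disc[OF _ this d(1) nz] d0
  have le: "norm (poly f z) \<le> s * exp (real d / 2) * (norm z / sqrt (real d)) ^ d" by simp
  have z0: "norm z > 0" using nz d0 by (meson less_le_trans real_sqrt_gt_zero)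
  have "(norm z / sqrt (real d)) ^ d = exp (ln (norm z / sqrt (real d)) * real d)"
    using z0 d0 by (simp add: exp_of_nat2_mult)
  also have "ln (norm z / sqrt (real d)) = ln x / 2"
  proof -
    have "x = (norm z / sqrt (real d))\<^sup>2" using d0 by (simp add: x_def power_divide)
    thus ?thesis using z0 d0 by (simp add: ln_realpow)
  qed
  \<comment> \<open>The linear bound is tailored to what follows: -1 cancels
    \<open>real d / 2\<close>, and 9/10 leaves exactly \<open>- (norm z)\<^sup>2 / 20\<close> in the
    exponent. It follows from the tangent of \<open>ln\<close> at 2 once \<open>x\<close> is at
    least 7/4.\<close>
  also have "ln x \<le> x * (9/10) - 1"
  proof -
    have "ln (x / 2) \<le> x / 2 - 1" using x by (intro ln_le_minus_one) auto
    hence "ln x \<le> ln 2 + x / 2 - 1" using x by (simp add: ln_div)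
    moreover have "ln 2 \<le> (7/10::real)" using ln2_le_25_over_36 by linarith
    ultimately show ?thesis using x by linarith
  qed
  finally have "(norm z / sqrt (real d)) ^ d \<le> exp ((x * (9/10) - 1) / 2 * real d)" using d0 by simp
  hence "norm (poly f z) \<le> s * exp (real d / 2) * exp ((x * (9/10) - 1) / 2 * real d)"
    using le s0 by (meson exp_ge_zero mult_left_mono mult_nonneg_nonneg order_trans)
  hence "fock_abs (poly f) z \<le> s * exp (real d / 2) * exp ((x * (9/10) - 1) / 2 * real d) * exp (- (norm z)\<^sup>2 / 2)"
    unfolding fock_abs_def by (intro mult_right_mono) auto
  also have "\<dots> = s * exp (real d / 2 + (x * (9/10) - 1) / 2 * real d + (- (norm z)\<^sup>2 / 2))"
    by (simp only: exp_add mult.assoc)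
  also have "real d / 2 + (x * (9/10) - 1) / 2 * real d + (- (norm z)\<^sup>2 / 2) = - (norm z)\<^sup>2 / 20"
    using d0 by (simp add: x_def field_simps)
  finally show ?thesis .
qed

text \<open>Point evaluation bounds the supremum of the weighted modulus by the norm, so the decay
  estimate holds with \<open>s\<close> of that size. Half of the Gaussian decay makes the integral
  converge, the other half is exponentially small in \<open>d\<close>. For large \<open>d\<close>
  the square of \<open>sqrt (2 * real d) - 1\<close> exceeds 19/10 \<open>d\<close>, as the decay
  requires.\<close>

lemma fock_tail:
  assumes p: "p \<ge> 1"
  shows "\<exists>d1::nat. \<forall>d\<ge>d1. \<forall>f::complex poly. degree f \<le> d \<longrightarrow>
    (\<integral>z. indicator (- cball 0 (sqrt (2 * real d) - 1)) z * fock_abs (poly f) z powr p \<partial>lborel)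
      \<le> (\<integral>z. fock_abs (poly f) z powr p \<partial>lborel) / 4"
proof -
  define K where "K = 25 * 3 powr p / pi"
  define G where "G = (\<integral>z. exp (- (p/40) * (norm (z::complex))\<^sup>2) \<partial>lborel)"
  have K0: "K \<ge> 0" by (simp add: K_def)
  have G0: "G \<ge> 0" unfolding G_def by (intro Bochner_Integration.integral_nonneg) auto
  have "eventually (\<lambda>d::nat. K * G * exp (- (p/40) * (19/10 * real d)) < 1/4) sequentially"
  proof -
    have "((\<lambda>d::nat. K * G * exp (- (p/40) * (19/10 * real d))) \<longlongrightarrow> K * G * 0) sequentially"
      using p by (intro tendsto_intros filterlim_compose[OF exp_at_bot]) real_asymp
    from order_tendstoD(2)[OF this, of "1/4"] show ?thesis by simp
  qed
  moreover have "eventually (\<lambda>d::nat. 19/10 * real d \<le> (sqrt (2 * real d) - 1)\<^sup>2) sequentially"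
  proof -
    have "eventually (\<lambda>d::nat. 19/10 * real d \<le> 2 * real d - 2 * sqrt (2 * real d) + 1) sequentially"
      by real_asymp
    moreover have "(sqrt (2 * real d) - 1)\<^sup>2 = 2 * real d - 2 * sqrt (2 * real d) + 1" for d
      by (simp add: power2_diff)
    ultimately show ?thesis by simp
  qed
  moreover have "eventually (\<lambda>d::nat. sqrt (2 * real d) - 1 \<ge> 0) sequentially" by real_asymp
  ultimately have "eventually (\<lambda>d::nat. K * G * exp (- (p/40) * (19/10 * real d)) < 1/4 \<and>
     19/10 * real d \<le> (sqrt (2 * real d) - 1)\<^sup>2 \<and> sqrt (2 * real d) - 1 \<ge> 0 \<and> d \<ge> 1) sequentially"
    using eventually_ge_at_top[of "1::nat"] by eventually_elim auto
  then obtain d1 where d1: "\<And>d. d \<ge> d1 \<Longrightarrow> K * G * exp (- (p/40) * (19/10 * real d)) < 1/4 \<and>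
     19/10 * real d \<le> (sqrt (2 * real d) - 1)\<^sup>2 \<and> sqrt (2 * real d) - 1 \<ge> 0 \<and> d \<ge> 1"
    unfolding eventually_sequentially by blast
  show ?thesis
  proof (intro exI allI impI)
    fix d :: nat and f :: "complex poly" assume d: "d \<ge> d1" and deg: "degree f \<le> d"
    define R where "R = sqrt (2 * real d) - 1"
    define I where "I = (\<integral>z. fock_abs (poly f) z powr p \<partial>lborel)"
    have I0: "I \<ge> 0" unfolding I_def by (intro Bochner_Integration.integral_nonneg) auto
    have R: "19/10 * real d \<le> R\<^sup>2" "R \<ge> 0" "d \<ge> 1" using d1[OF d] by (auto simp: R_def)
    define s where "s = (K * I) powr (1 / p)"
    have sp: "s powr p = K * I" using p K0 I0 by (simp add: s_def powr_powr)
    have s: "fock_abs (poly f) z \<le> s" for z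
    proof -
      have "(fock_abs (poly f) z powr p) powr (1/p) \<le> s"
        unfolding s_def K_def I_def using p by (intro powr_mono2 fock_powr_le_integral) auto
      thus ?thesis using p by (simp add: powr_powr)
    qed
    have s0: "s \<ge> 0" by (simp add: s_def)
    have bound: "indicator (- cball 0 R) z * fock_abs (poly f) z powr p
        \<le> K * I * exp (- (p/40) * (19/10 * real d)) * exp (- (p/40) * (norm z)\<^sup>2)" for z
    proof (cases "z \<in> cball 0 R")
      case True
      thus ?thesis using K0 I0 by simp
    next
      case False
      hence "R\<^sup>2 \<le> (norm z)\<^sup>2" using R by (intro power_mono) auto
      hence z: "19/10 * real d \<le> (norm z)\<^sup>2" using R by linarith
      have "fock_abs (poly f) z powr p \<le> (s * exp (- (norm z)\<^sup>2 / 20)) powr p"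
        using fock_abs_decay[OF deg R(3) s z] p by (intro powr_mono2) auto
      also have "\<dots> = K * I * exp (- (p/40) * (norm z)\<^sup>2 + - (p/40) * (norm z)\<^sup>2)"
        using s0 by (simp add: powr_mult sp exp_powr_real)
      also have "\<dots> \<le> K * I * exp (- (p/40) * (19/10 * real d) + - (p/40) * (norm z)\<^sup>2)"
      proof -
        have "(p/40) * (19/10 * real d) \<le> (p/40) * (norm z)\<^sup>2" using z p by (intro mult_left_mono) auto
        thus ?thesis using K0 I0 by (intro mult_left_mono) auto
      qed
      finally show ?thesis using False unfolding exp_add by (simp add: mult.assoc)
    qed
    have "(\<integral>z. indicator (- cball 0 R) z * fock_abs (poly f) z powr p \<partial>lborel)
       \<le> (\<integral>z. K * I * exp (- (p/40) * (19/10 * real d)) * exp (- (p/40) * (norm (z::complex))\<^sup>2) \<partial>lborel)"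
    proof (rule integral_mono[OF _ _ bound])
      show "integrable lborel (\<lambda>z. indicator (- cball 0 R) z * fock_abs (poly f) z powr p)"
        using integrable_mult_indicator[OF _ integrable_fock_powr[OF p], of "- cball 0 R" f] by simp
      show "integrable lborel (\<lambda>z::complex. K * I * exp (- (p/40) * (19/10 * real d)) * exp (- (p/40) * (norm z)\<^sup>2))"
        by (rule integrable_mult_right[OF integrable_gaussian_complex]) (use p in simp)
    qed
    also have "\<dots> = I * (K * G * exp (- (p/40) * (19/10 * real d)))"
      by (simp add: G_def)
    also have "\<dots> \<le> I * (1/4)" using d1[OF d] I0 by (intro mult_left_mono) auto
    finally show "(\<integral>z. indicator (- cball 0 (sqrt (2 * real d) - 1)) z * fock_abs (poly f) z powr p \<partial>lborel)
      \<le> (\<integral>z. fock_abs (poly f) z powr p \<partial>lborel) / 4" by (simp add: R_def I_def)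
  qed
qed

text \<open>Double counting of the pairs of a point of \<open>Z\<close> and a centre
  \<open>\<xi>\<close> at distance below \<open>\<eta>\<close>. The upper estimate averages over the
  centres near a point, the lower one over the points near a centre. In the latter the error
  coefficient is at most \<open>(6 * \<eta>) powr p\<close>, hence at most 1/4, because
  \<open>\<eta> \<le> 1/24\<close> and \<open>p \<ge> 1\<close>.\<close>

lemma sampling_from_counts:
  fixes f :: "complex poly" and Z :: "complex set"
  assumes p: "p \<ge> 1" and Z: "finite Z" and \<eta>: "0 < \<eta>" "\<eta> \<le> 1/24"
    and N1: "N1 > 0" and up: "\<And>\<xi>. real (card {z\<in>Z. dist z \<xi> < \<eta>}) \<le> N2"
    and low: "\<And>\<xi>. norm \<xi> \<le> R \<Longrightarrow> N1 \<le> real (card {z\<in>Z. dist z \<xi> < \<eta>})"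
    and tail: "(\<integral>z. indicator (- cball 0 R) z * fock_abs (poly f) z powr p \<partial>lborel)
      \<le> (\<integral>z. fock_abs (poly f) z powr p \<partial>lborel) / 4"
  shows "pi * \<eta>\<^sup>2 * (\<Sum>z\<in>Z. fock_abs (poly f) z powr p) \<le> 3 powr p * N2 * (\<integral>z. fock_abs (poly f) z powr p \<partial>lborel)"
    and "N1 * (\<integral>z. fock_abs (poly f) z powr p \<partial>lborel) \<le> 2 * 4 powr p * pi * \<eta>\<^sup>2 * (\<Sum>z\<in>Z. fock_abs (poly f) z powr p)"
proof -
  define w where "w = (\<lambda>z. fock_abs (poly f) z powr p)"
  define V where "V = circle_mean w"
  define I where "I = (\<integral>z. w z \<partial>lborel)"
  define n where "n \<xi> = real (card {z\<in>Z. dist z \<xi> < \<eta>})" for \<xi>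
  have c: "continuous_on UNIV w" unfolding w_def by (rule continuous_on_fock_powr[OF holomorphic_poly]) (use p in simp)
  have i: "integrable lborel w" unfolding w_def by (rule integrable_fock_powr[OF p])
  have nn: "w z \<ge> 0" for z by (simp add: w_def)
  have Vint: "integrable lborel V" and VI: "(\<integral>z. V z \<partial>lborel) = I"
    using integral_circle_mean[OF c nn i] by (auto simp: V_def I_def)
  have Vnn: "V \<xi> \<ge> 0" for \<xi> unfolding V_def by (rule circle_mean_nonneg[OF nn])
  have n_eq: "n \<xi> = (\<Sum>z\<in>Z. indicator (ball z \<eta>) \<xi>)" for \<xi>
    using Z by (simp add: n_def indicator_def sum.If_cases Int_def)
  have iV: "integrable lborel (\<lambda>\<xi>. indicator (ball z \<eta>) \<xi> * V \<xi>)" for z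
    using integrable_mult_indicator[OF _ Vint, of "ball z \<eta>"] by simp
  have ib: "integrable lborel (\<lambda>\<xi>. indicator (ball z \<eta>) \<xi> * w z)" for z
    by (rule integrable_mult_left[OF integrable_indicator_ball])
  have ibI: "(\<integral>\<xi>. indicator (ball z \<eta>) \<xi> * w z \<partial>lborel) = pi * \<eta>\<^sup>2 * w z" for z
    using \<eta> by (simp add: measure_lborel_ball_complex)
  have "pi * \<eta>\<^sup>2 * (\<Sum>z\<in>Z. w z) = (\<Sum>z\<in>Z. (\<integral>\<xi>. indicator (ball z \<eta>) \<xi> * w z \<partial>lborel))"
    unfolding ibI by (simp add: sum_distrib_left)
  also have "\<dots> \<le> (\<Sum>z\<in>Z. (\<integral>\<xi>. 3 powr p * (indicator (ball z \<eta>) \<xi> * V \<xi>) \<partial>lborel))"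
  proof (intro sum_mono integral_mono ib integrable_mult_right iV)
    fix z \<xi>
    show "indicator (ball z \<eta>) \<xi> * w z \<le> 3 powr p * (indicator (ball z \<eta>) \<xi> * V \<xi>)"
    proof (cases "\<xi> \<in> ball z \<eta>")
      case True
      hence "norm (z - \<xi>) \<le> 1/5" using \<eta> by (simp add: dist_norm)
      from fock_abs_powr_estimates(1)[OF holomorphic_poly this p, of f \<xi>] True show ?thesis
        by (simp add: w_def V_def)
    qed auto
  qed
  also have "\<dots> = (\<integral>\<xi>. (\<Sum>z\<in>Z. 3 powr p * (indicator (ball z \<eta>) \<xi> * V \<xi>)) \<partial>lborel)"
    by (subst Bochner_Integration.integral_sum) (intro integrable_mult_right iV refl)+
  also have "\<dots> = (\<integral>\<xi>. 3 powr p * (n \<xi> * V \<xi>) \<partial>lborel)"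
    by (simp add: n_eq sum_distrib_left sum_distrib_right)
  also have "\<dots> \<le> (\<integral>\<xi>. 3 powr p * (N2 * V \<xi>) \<partial>lborel)"
  proof (rule integral_mono)
    have "integrable lborel (\<lambda>\<xi>. \<Sum>z\<in>Z. 3 powr p * (indicator (ball z \<eta>) \<xi> * V \<xi>))"
      by (intro Bochner_Integration.integrable_sum integrable_mult_right iV)
    thus "integrable lborel (\<lambda>\<xi>. 3 powr p * (n \<xi> * V \<xi>))"
      by (simp add: n_eq sum_distrib_left sum_distrib_right)
    show "integrable lborel (\<lambda>\<xi>. 3 powr p * (N2 * V \<xi>))" using Vint by simp
    show "3 powr p * (n \<xi> * V \<xi>) \<le> 3 powr p * (N2 * V \<xi>)" for \<xi>
      using up[of \<xi>] Vnn by (intro mult_left_mono mult_right_mono) (auto simp: n_def)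
  qed
  also have "\<dots> = 3 powr p * N2 * I" by (simp add: VI)
  finally show "pi * \<eta>\<^sup>2 * (\<Sum>z\<in>Z. fock_abs (poly f) z powr p) \<le> 3 powr p * N2 * (\<integral>z. fock_abs (poly f) z powr p \<partial>lborel)"
    by (simp add: w_def I_def)
  define S where "S \<xi> = (\<Sum>z\<in>Z. indicator (ball z \<eta>) \<xi> * w z)" for \<xi>
  have Sint: "integrable lborel S" unfolding S_def[abs_def] by (intro Bochner_Integration.integrable_sum ib)
  have SI: "(\<integral>\<xi>. S \<xi> \<partial>lborel) = pi * \<eta>\<^sup>2 * (\<Sum>z\<in>Z. w z)"
    unfolding S_def by (subst Bochner_Integration.integral_sum) (auto simp only: ib ibI sum_distrib_left)
  have point: "indicator (cball 0 R) \<xi> * w \<xi> \<le> 4 powr p / N1 * S \<xi> + 1/4 * V \<xi>" for \<xi>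
  proof (cases "\<xi> \<in> cball 0 R")
    case False
    have "S \<xi> \<ge> 0" unfolding S_def by (intro sum_nonneg) (auto simp: nn)
    thus ?thesis using False N1 Vnn[of \<xi>] by simp
  next
    case True
    define A where "A = {z\<in>Z. dist z \<xi> < \<eta>}"
    have nA: "N1 \<le> n \<xi>" "n \<xi> = real (card A)" using low[of \<xi>] True by (auto simp: n_def A_def)
    have SA: "S \<xi> = (\<Sum>z\<in>A. w z)"
      unfolding S_def A_def sum.inter_filter[OF Z] by (intro sum.cong) (auto simp: indicator_def)
    have est: "w \<xi> \<le> 4 powr p * w z + 1/4 * V \<xi>" if "z \<in> A" for z
    proof -
      have d: "norm (z - \<xi>) < \<eta>" using that by (simp add: A_def dist_norm)
      hence "norm (z - \<xi>) \<le> 1/5" using \<eta> by simp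
      from fock_abs_powr_estimates(2)[OF holomorphic_poly this p, of f \<xi>]
      have "w \<xi> \<le> 4 powr p * w z + (6 * norm (z - \<xi>)) powr p * V \<xi>" by (simp add: w_def V_def)
      also have "(6 * norm (z - \<xi>)) powr p \<le> (1/4) powr p" using d \<eta> p by (intro powr_mono2) auto
      also have "(1/4::real) powr p \<le> (1/4) powr 1" using p by (intro powr_mono') auto
      finally show ?thesis using Vnn[of \<xi>] by (simp add: mult_right_mono)
    qed
    have "n \<xi> * w \<xi> = (\<Sum>z\<in>A. w \<xi>)" by (simp add: nA)
    also have "\<dots> \<le> (\<Sum>z\<in>A. 4 powr p * w z + 1/4 * V \<xi>)" by (intro sum_mono est)
    also have "\<dots> = 4 powr p * S \<xi> + n \<xi> * (1/4 * V \<xi>)" by (simp add: sum.distrib SA nA sum_distrib_left)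
    finally have "n \<xi> * (w \<xi> - 1/4 * V \<xi>) \<le> 4 powr p * S \<xi>" by (simp add: algebra_simps)
    hence "w \<xi> - 1/4 * V \<xi> \<le> 4 powr p * S \<xi> / n \<xi>" using nA N1 by (simp add: pos_le_divide_eq mult.commute)
    also have "\<dots> \<le> 4 powr p * S \<xi> / N1"
      using nA N1 SA nn by (intro divide_left_mono mult_nonneg_nonneg mult_pos_pos sum_nonneg) (auto intro: sum_nonneg)
    finally show ?thesis using True by simp
  qed
  have i1: "integrable lborel (\<lambda>\<xi>. indicator (cball 0 R) \<xi> * w \<xi>)" "integrable lborel (\<lambda>\<xi>. indicator (- cball 0 R) \<xi> * w \<xi>)"
    using integrable_mult_indicator[OF _ i, of "cball 0 R"] integrable_mult_indicator[OF _ i, of "- cball 0 R"] by simp_all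
  have "I = (\<integral>\<xi>. indicator (cball 0 R) \<xi> * w \<xi> + indicator (- cball 0 R) \<xi> * w \<xi> \<partial>lborel)"
    unfolding I_def by (intro Bochner_Integration.integral_cong) (auto simp: indicator_def)
  also have "\<dots> = (\<integral>\<xi>. indicator (cball 0 R) \<xi> * w \<xi> \<partial>lborel) + (\<integral>\<xi>. indicator (- cball 0 R) \<xi> * w \<xi> \<partial>lborel)"
    by (rule Bochner_Integration.integral_add[OF i1])
  also have "(\<integral>\<xi>. indicator (cball 0 R) \<xi> * w \<xi> \<partial>lborel) \<le> (\<integral>\<xi>. 4 powr p / N1 * S \<xi> + 1/4 * V \<xi> \<partial>lborel)"
    by (rule integral_mono[OF i1(1) Bochner_Integration.integrable_add[OF integrable_mult_right[OF Sint] integrable_mult_right[OF Vint]] point])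
  also have "\<dots> = 4 powr p / N1 * (pi * \<eta>\<^sup>2 * (\<Sum>z\<in>Z. w z)) + 1/4 * I"
    using Sint Vint by (simp add: SI VI)
  also have "(\<integral>\<xi>. indicator (- cball 0 R) \<xi> * w \<xi> \<partial>lborel) \<le> I / 4" using tail by (simp add: w_def I_def)
  \<comment> \<open>The circle mean term and the tail consume a quarter of \<open>I\<close>
    each.\<close>
  finally have "I / 2 \<le> 4 powr p / N1 * (pi * \<eta>\<^sup>2 * (\<Sum>z\<in>Z. w z))" by linarith
  hence "N1 * I \<le> 2 * 4 powr p * pi * \<eta>\<^sup>2 * (\<Sum>z\<in>Z. w z)" using N1 by (simp add: field_simps)
  thus "N1 * (\<integral>z. fock_abs (poly f) z powr p \<partial>lborel) \<le> 2 * 4 powr p * pi * \<eta>\<^sup>2 * (\<Sum>z\<in>Z. fock_abs (poly f) z powr p)"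
    by (simp add: w_def I_def)
qed

section \<open>Gaussian coefficients\<close>

text \<open>Area measure is the image of the product measure on the coordinates indexed by
  \<open>Basis\<close>. The formula makes expectations of products of a function of the real part
  and one of the imaginary part factor.\<close>

lemma lborel_complex_product:
  fixes f1 f2 :: "real \<Rightarrow> complex"
  assumes f1: "integrable lborel f1" and f2: "integrable lborel f2"
  shows "integrable lborel (\<lambda>z. f1 (Re z) * f2 (Im z))"
    and "(\<integral>z. f1 (Re z) * f2 (Im z) \<partial>lborel) = (\<integral>x. f1 x \<partial>lborel) * (\<integral>x. f2 x \<partial>lborel)"
proof -
  interpret P: product_sigma_finite "\<lambda>_::complex. lborel :: real measure" ..
  define F where "F b = (if b = (1::complex) then f1 else f2)" for b
  let ?T = "\<lambda>f. \<Sum>b\<in>(Basis :: complex set). f b *\<^sub>R b"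
  have F: "integrable lborel (F b)" for b using f1 f2 by (simp add: F_def)
  have [measurable]: "f1 \<in> borel_measurable borel" "f2 \<in> borel_measurable borel"
    using borel_measurable_integrable[OF f1] borel_measurable_integrable[OF f2] by simp_all
  have eq: "f1 (Re (?T f)) * f2 (Im (?T f)) = (\<Prod>b\<in>Basis. F b (f b))" for f
    by (simp add: Basis_complex_def F_def complex_eq_iff)
  have m: "?T \<in> measurable (\<Pi>\<^sub>M b\<in>Basis. lborel) borel" by measurable
  have i: "integrable (\<Pi>\<^sub>M b\<in>Basis. lborel) (\<lambda>f. f1 (Re (?T f)) * f2 (Im (?T f)))"
    unfolding eq by (rule P.product_integrable_prod) (auto simp: F)
  show "integrable lborel (\<lambda>z. f1 (Re z) * f2 (Im z))"
    by (subst lborel_eq, subst integrable_distr_eq[OF m]) (use i in auto)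
  have "(\<integral>z. f1 (Re z) * f2 (Im z) \<partial>lborel) = (\<integral>f. f1 (Re (?T f)) * f2 (Im (?T f)) \<partial>(\<Pi>\<^sub>M b\<in>Basis. lborel))"
    by (subst lborel_eq, subst integral_distr[OF m]) auto
  also have "\<dots> = (\<Prod>b\<in>Basis. \<integral>x. F b x \<partial>lborel)"
    unfolding eq by (rule P.product_integral_prod) (auto simp: F)
  also have "\<dots> = (\<integral>x. f1 x \<partial>lborel) * (\<integral>x. f2 x \<partial>lborel)"
    by (simp add: Basis_complex_def F_def complex_eq_iff)
  finally show "(\<integral>z. f1 (Re z) * f2 (Im z) \<partial>lborel) = (\<integral>x. f1 x \<partial>lborel) * (\<integral>x. f2 x \<partial>lborel)" .
qed

text \<open>Density of the normal law of variance 1/2, that of the real and of the imaginary part of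
  a standard complex normal variable; not the law of the modulus of a normal variable.\<close>

definition half_normal :: "real \<Rightarrow> real" where
  "half_normal x = exp (- x\<^sup>2) / sqrt pi"

lemma half_normal_eq: "half_normal x = normal_density 0 (1 / sqrt 2) x"
  by (simp add: half_normal_def normal_density_def power_divide)

lemma half_normal_mgf:
  "integrable lborel (\<lambda>x. half_normal x * exp (\<beta> * x))"
  "(\<integral>x. half_normal x * exp (\<beta> * x) \<partial>lborel) = exp (\<beta>\<^sup>2 / 4)"
proof -
  have eq: "half_normal x * exp (\<beta> * x) = exp (\<beta>\<^sup>2 / 4) * normal_density (\<beta> / 2) (1 / sqrt 2) x" for x
    by (simp add: half_normal_def normal_density_def power_divide exp_add[symmetric] power2_eq_square algebra_simps)
  show "integrable lborel (\<lambda>x. half_normal x * exp (\<beta> * x))"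
    unfolding eq by (intro integrable_mult_right integrable_normal_density) simp
  show "(\<integral>x. half_normal x * exp (\<beta> * x) \<partial>lborel) = exp (\<beta>\<^sup>2 / 4)"
    unfolding eq using integral_normal_density[of "1 / sqrt 2" "\<beta> / 2"] by simp
qed

lemma std_normal_char:
  "(\<integral>x. iexp (t * x) \<partial>std_normal_distribution) = complex_of_real (exp (- t\<^sup>2 / 2))"
  using fun_cong[OF char_std_normal_distribution, of t] by (simp add: char_def)

lemma half_normal_char:
  "integrable lborel (\<lambda>x. complex_of_real (half_normal x) * iexp (\<beta> * x))"
  "(\<integral>x. complex_of_real (half_normal x) * iexp (\<beta> * x) \<partial>lborel) = complex_of_real (exp (- \<beta>\<^sup>2 / 4))"
proof -
  let ?h = "\<lambda>x. complex_of_real (half_normal x) * iexp (\<beta> * x)"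
  have [measurable]: "half_normal \<in> borel_measurable borel" unfolding half_normal_def by measurable
  have i: "integrable lborel half_normal"
    unfolding half_normal_eq[abs_def] by (intro integrable_normal_density) simp
  show int: "integrable lborel ?h"
  proof (rule Bochner_Integration.integrable_bound[OF i])
    show "AE x in lborel. norm (?h x) \<le> norm (half_normal x)"
      by (intro AE_I2) (simp add: norm_mult)
  qed measurable
  have hs: "half_normal (x / sqrt 2) = sqrt 2 * std_normal_density x" for x
    by (simp add: half_normal_def std_normal_density_def power_divide real_sqrt_mult field_simps)
  have "(\<integral>x. ?h x \<partial>lborel) = (1 / sqrt 2) *\<^sub>R (\<integral>x. ?h (0 + (1 / sqrt 2) * x) \<partial>lborel)"
    by (subst lborel_integral_real_affine[of "1 / sqrt 2" _ 0]) auto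
  also have "(\<integral>x. ?h (0 + (1 / sqrt 2) * x) \<partial>lborel) = (\<integral>x. sqrt 2 *\<^sub>R (std_normal_density x *\<^sub>R iexp ((\<beta> / sqrt 2) * x)) \<partial>lborel)"
    by (intro Bochner_Integration.integral_cong) (simp_all add: hs scaleR_conv_of_real)
  also have "\<dots> = sqrt 2 *\<^sub>R (\<integral>x. std_normal_density x *\<^sub>R iexp ((\<beta> / sqrt 2) * x) \<partial>lborel)"
    by (rule integral_scaleR_right)
  also have "(\<integral>x. std_normal_density x *\<^sub>R iexp ((\<beta> / sqrt 2) * x) \<partial>lborel) = (\<integral>x. iexp ((\<beta> / sqrt 2) * x) \<partial>std_normal_distribution)"
    by (subst integral_density) auto
  also have "\<dots> = complex_of_real (exp (- \<beta>\<^sup>2 / 4))"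
    by (subst std_normal_char) (simp add: power_divide)
  finally show "(\<integral>x. ?h x \<partial>lborel) = complex_of_real (exp (- \<beta>\<^sup>2 / 4))" by simp
qed

context gef_coefficients
begin

lemma measurable_coeff [measurable]: "\<zeta> n \<in> borel_measurable M"
  using distributed_measurable[OF std_complex_normal] by simp

text \<open>With complex factors the same formula yields both the Laplace transform and the
  characteristic function of a coefficient.\<close>

lemma coeff_integral:
  fixes g1 g2 :: "real \<Rightarrow> complex"
  assumes g1: "integrable lborel (\<lambda>x. of_real (half_normal x) * g1 x)"
    and g2: "integrable lborel (\<lambda>x. of_real (half_normal x) * g2 x)"
    and [measurable]: "g1 \<in> borel_measurable borel" "g2 \<in> borel_measurable borel"
  shows "integrable M (\<lambda>\<omega>. g1 (Re (\<zeta> n \<omega>)) * g2 (Im (\<zeta> n \<omega>)))"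
    and "expectation (\<lambda>\<omega>. g1 (Re (\<zeta> n \<omega>)) * g2 (Im (\<zeta> n \<omega>))) =
      (\<integral>x. of_real (half_normal x) * g1 x \<partial>lborel) * (\<integral>x. of_real (half_normal x) * g2 x \<partial>lborel)"
proof -
  let ?D = "\<lambda>z::complex. exp (- (norm z)\<^sup>2) / pi"
  let ?g = "\<lambda>z. g1 (Re z) * g2 (Im z)"
  have d: "distr M lborel (\<zeta> n) = density lborel (\<lambda>z. ennreal (?D z))"
    using std_complex_normal by (rule distributed_distr_eq_density)
  have m: "\<zeta> n \<in> measurable M lborel" by measurable
  have eq: "?D z *\<^sub>R ?g z = (of_real (half_normal (Re z)) * g1 (Re z)) * (of_real (half_normal (Im z)) * g2 (Im z))" for z
  proof -
    have "?D z = half_normal (Re z) * half_normal (Im z)"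
      by (simp add: half_normal_def cmod_power2 exp_add[symmetric])
    thus ?thesis by (simp add: scaleR_conv_of_real)
  qed
  note P = lborel_complex_product[OF g1 g2]
  have "integrable (distr M lborel (\<zeta> n)) ?g"
    unfolding d by (subst integrable_density) (auto simp only: eq P, auto)
  thus "integrable M (\<lambda>\<omega>. g1 (Re (\<zeta> n \<omega>)) * g2 (Im (\<zeta> n \<omega>)))"
    by (subst (asm) integrable_distr_eq[OF m]) auto
  have "expectation (\<lambda>\<omega>. g1 (Re (\<zeta> n \<omega>)) * g2 (Im (\<zeta> n \<omega>))) = (\<integral>z. ?g z \<partial>distr M lborel (\<zeta> n))"
    by (subst integral_distr[OF m]) auto
  also have "\<dots> = (\<integral>z. ?D z *\<^sub>R ?g z \<partial>lborel)"
    unfolding d by (subst integral_density) auto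
  finally show "expectation (\<lambda>\<omega>. g1 (Re (\<zeta> n \<omega>)) * g2 (Im (\<zeta> n \<omega>))) =
      (\<integral>x. of_real (half_normal x) * g1 x \<partial>lborel) * (\<integral>x. of_real (half_normal x) * g2 x \<partial>lborel)"
    unfolding eq P(2) .
qed

lemma coeff_mgf:
  "integrable M (\<lambda>\<omega>. exp (Re (\<zeta> n \<omega> * b)))"
  "expectation (\<lambda>\<omega>. exp (Re (\<zeta> n \<omega> * b))) = exp ((norm b)\<^sup>2 / 4)"
proof -
  let ?g = "\<lambda>\<beta> x. complex_of_real (exp (\<beta> * x))"
  have h: "integrable lborel (\<lambda>x. of_real (half_normal x) * ?g \<beta> x)"
      "(\<integral>x. of_real (half_normal x) * ?g \<beta> x \<partial>lborel) = of_real (exp (\<beta>\<^sup>2 / 4))" for \<beta>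
    unfolding of_real_mult[symmetric]
    using half_normal_mgf[of \<beta>] by (simp_all only: complex_of_real_integrable_eq integral_complex_of_real)
  have eq: "?g (Re b) (Re z) * ?g (- Im b) (Im z) = of_real (exp (Re (z * b)))" for z
    by (simp add: of_real_mult[symmetric] exp_add[symmetric] mult.commute del: of_real_mult)
  have m: "?g \<beta> \<in> borel_measurable borel" for \<beta> by measurable
  note C = coeff_integral[OF h(1)[of "Re b"] h(1)[of "- Im b"] m m, of n, unfolded eq h(2)]
  show "integrable M (\<lambda>\<omega>. exp (Re (\<zeta> n \<omega> * b)))"
    using C(1) by (simp only: complex_of_real_integrable_eq)
  have "complex_of_real (expectation (\<lambda>\<omega>. exp (Re (\<zeta> n \<omega> * b)))) = of_real (exp ((Re b)\<^sup>2 / 4)) * of_real (exp ((- Im b)\<^sup>2 / 4))"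
    using C(2) by (simp only: integral_complex_of_real)
  also have "\<dots> = of_real (exp ((norm b)\<^sup>2 / 4))"
    unfolding of_real_mult[symmetric] exp_add[symmetric] by (simp add: cmod_power2 add_divide_distrib)
  finally show "expectation (\<lambda>\<omega>. exp (Re (\<zeta> n \<omega> * b))) = exp ((norm b)\<^sup>2 / 4)"
    by (simp only: of_real_eq_iff)
qed

lemma coeff_char:
  "integrable M (\<lambda>\<omega>. iexp (Re (\<zeta> n \<omega> * b)))"
  "expectation (\<lambda>\<omega>. iexp (Re (\<zeta> n \<omega> * b))) = of_real (exp (- (norm b)\<^sup>2 / 4))"
proof -
  let ?g = "\<lambda>\<beta> x. iexp (\<beta> * x)"
  have eq: "?g (Re b) (Re z) * ?g (- Im b) (Im z) = iexp (Re (z * b))" for z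
    unfolding exp_add[symmetric] by (simp add: algebra_simps)
  have m: "?g \<beta> \<in> borel_measurable borel" for \<beta> by measurable
  note C = coeff_integral[OF half_normal_char(1)[of "Re b"] half_normal_char(1)[of "- Im b"] m m, of n, unfolded eq half_normal_char(2)]
  show "integrable M (\<lambda>\<omega>. iexp (Re (\<zeta> n \<omega> * b)))" using C(1) by simp
  have "expectation (\<lambda>\<omega>. iexp (Re (\<zeta> n \<omega> * b))) = of_real (exp (- (Re b)\<^sup>2 / 4)) * of_real (exp (- (- Im b)\<^sup>2 / 4))"
    using C(2) by simp
  also have "\<dots> = of_real (exp (- (norm b)\<^sup>2 / 4))"
    unfolding of_real_mult[symmetric] exp_add[symmetric] by (simp add: cmod_power2 add_divide_distrib)
  finally show "expectation (\<lambda>\<omega>. iexp (Re (\<zeta> n \<omega> * b))) = of_real (exp (- (norm b)\<^sup>2 / 4))" .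
qed

text \<open>Stated as a nonnegative integral, the form that Fatou's lemma extends to the infinite
  series.\<close>

lemma partial_sum_mgf:
  "(\<integral>\<^sup>+\<omega>. ennreal (exp (Re (\<Sum>n<N. \<zeta> n \<omega> * b n))) \<partial>M) = ennreal (exp ((\<Sum>n<N. (norm (b n))\<^sup>2) / 4))"
proof -
  have ind: "indep_vars (\<lambda>_. borel) (\<lambda>n \<omega>. exp (Re (\<zeta> n \<omega> * b n))) {..<N}"
    by (rule indep_vars_compose2[OF indep_vars_subset[OF indep]]) auto
  have eq: "exp (Re (\<Sum>n<N. \<zeta> n \<omega> * b n)) = (\<Prod>n<N. exp (Re (\<zeta> n \<omega> * b n)))" for \<omega>
    by (simp add: exp_sum)
  have "(\<integral>\<^sup>+\<omega>. ennreal (exp (Re (\<Sum>n<N. \<zeta> n \<omega> * b n))) \<partial>M) = ennreal (expectation (\<lambda>\<omega>. \<Prod>n<N. exp (Re (\<zeta> n \<omega> * b n))))"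
    unfolding eq
  proof (rule nn_integral_eq_integral[OF indep_vars_integrable[OF finite_lessThan ind]])
    show "AE \<omega> in M. 0 \<le> (\<Prod>n<N. exp (Re (\<zeta> n \<omega> * b n)))" by (intro AE_I2 prod_nonneg) simp
  qed (rule coeff_mgf)
  also have "expectation (\<lambda>\<omega>. \<Prod>n<N. exp (Re (\<zeta> n \<omega> * b n))) = (\<Prod>n<N. exp ((norm (b n))\<^sup>2 / 4))"
    by (subst indep_vars_lebesgue_integral[OF finite_lessThan ind]) (simp_all only: coeff_mgf)
  also have "\<dots> = exp ((\<Sum>n<N. (norm (b n))\<^sup>2) / 4)"
    by (simp add: exp_sum sum_divide_distrib)
  finally show ?thesis .
qed

lemma partial_sum_char:
  "expectation (\<lambda>\<omega>. iexp (Re (\<Sum>n<N. \<zeta> n \<omega> * b n))) = of_real (exp (- (\<Sum>n<N. (norm (b n))\<^sup>2) / 4))"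
proof -
  have ind: "indep_vars (\<lambda>_. borel) (\<lambda>n \<omega>. iexp (Re (\<zeta> n \<omega> * b n))) {..<N}"
    by (rule indep_vars_compose2[OF indep_vars_subset[OF indep]]) auto
  have eq: "iexp (Re (\<Sum>n<N. \<zeta> n \<omega> * b n)) = (\<Prod>n<N. iexp (Re (\<zeta> n \<omega> * b n)))" for \<omega>
    by (simp add: exp_sum[symmetric] sum_distrib_left)
  have "expectation (\<lambda>\<omega>. \<Prod>n<N. iexp (Re (\<zeta> n \<omega> * b n))) = (\<Prod>n<N. of_real (exp (- (norm (b n))\<^sup>2 / 4)))"
    by (subst indep_vars_lebesgue_integral[OF finite_lessThan ind]) (simp_all only: coeff_char)
  also have "\<dots> = of_real (exp (- (\<Sum>n<N. (norm (b n))\<^sup>2) / 4))"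
    by (simp add: exp_sum[symmetric] sum_divide_distrib sum_negf of_real_prod[symmetric] del: of_real_prod)
  finally show ?thesis unfolding eq .
qed

end

section \<open>Moments of the Gaussian entire function\<close>

text \<open>The bound \<open>x ^ n \<le> fact n * exp x\<close> at \<open>x = 4 * m\<^sup>2\<close>
  leaves a geometric factor after taking roots.\<close>

lemma power_div_sqrt_fact_le:
  assumes "m \<ge> 0"
  shows "m ^ n / sqrt (fact n) \<le> exp (2 * m\<^sup>2) * (1/2) ^ n"
proof -
  have "(2 * m) ^ n = sqrt (((2 * m) ^ n)\<^sup>2)" using assms by simp
  also have "((2 * m) ^ n)\<^sup>2 = (4 * m\<^sup>2) ^ n"
    by (simp add: power_mult_distrib power_mult[symmetric] mult.commute[of n 2]) (simp add: power_mult)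
  also have "sqrt \<dots> \<le> sqrt (fact n * exp (4 * m\<^sup>2))"
    by (intro real_sqrt_le_mono power_le_fact_exp) simp
  also have "\<dots> = sqrt (fact n) * exp (2 * m\<^sup>2)"
  proof -
    have "exp (4 * m\<^sup>2) = (exp (2 * m\<^sup>2))\<^sup>2" by (simp add: exp_double[symmetric])
    thus ?thesis by (simp add: real_sqrt_mult)
  qed
  finally show ?thesis by (simp add: power_mult_distrib power_divide field_simps)
qed

text \<open>Absolute convergence on the whole plane, tested at integer radii: as a countable
  conjunction it is measurable and can be shown almost surely radius by radius.\<close>

definition gef_conv :: "(nat \<Rightarrow> complex) \<Rightarrow> bool" where
  "gef_conv x \<longleftrightarrow> (\<forall>m::nat. summable (\<lambda>n. norm (x n) * (real m ^ n / sqrt (fact n))))"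

definition gef_series :: "(nat \<Rightarrow> complex) \<Rightarrow> complex \<Rightarrow> complex" where
  "gef_series x z = (\<Sum>n. x n * (z ^ n / complex_of_real (sqrt (fact n))))"

lemma gef_conv_summable_norm:
  assumes "gef_conv x"
  shows "summable (\<lambda>n. norm (x n * (z ^ n / complex_of_real (sqrt (fact n)))))"
proof -
  obtain m :: nat where m: "norm z \<le> real m" using real_arch_simple by blast
  show ?thesis
  proof (rule summable_comparison_test')
    show "summable (\<lambda>n. norm (x n) * (real m ^ n / sqrt (fact n)))" using assms by (simp add: gef_conv_def)
    show "norm (norm (x n * (z ^ n / complex_of_real (sqrt (fact n))))) \<le> norm (x n) * (real m ^ n / sqrt (fact n))" if "n \<ge> 0" for n
      using m by (auto simp: norm_mult norm_divide norm_power intro!: mult_left_mono divide_right_mono power_mono)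
  qed
qed

definition gef_coeff :: "(nat \<Rightarrow> complex) \<Rightarrow> nat \<Rightarrow> complex" where
  "gef_coeff x n = x n / complex_of_real (sqrt (fact n))"

lemma gef_series_DERIV:
  assumes "gef_conv x"
  shows "(gef_series x has_field_derivative (\<Sum>n. diffs (gef_coeff x) n * z ^ n)) (at z)"
proof -
  have "summable (\<lambda>n. gef_coeff x n * y ^ n)" for y
    using summable_norm_cancel[OF gef_conv_summable_norm[OF assms, of y]] by (simp add: gef_coeff_def)
  moreover have "gef_series x = (\<lambda>z. \<Sum>n. gef_coeff x n * z ^ n)"
    by (simp add: gef_series_def gef_coeff_def fun_eq_iff)
  ultimately show ?thesis using termdiffs_strong_converges_everywhere by metis
qed

lemma holomorphic_gef_series:
  assumes "gef_conv x"
  shows "gef_series x holomorphic_on A"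
  unfolding holomorphic_on_def field_differentiable_def
  using has_field_derivative_at_within[OF gef_series_DERIV[OF assms]] by blast

text \<open>Up to conjugation, the coefficients of the normalised reproducing kernel of Fock space
  at \<open>z\<close>. They form a unit vector, so the weighted values of the random series have the
  same law at all points.\<close>

definition fock_basis :: "complex \<Rightarrow> nat \<Rightarrow> complex" where
  "fock_basis z n = z ^ n / complex_of_real (sqrt (fact n)) * complex_of_real (exp (- (norm z)\<^sup>2 / 2))"

text \<open>This is the covariance of the weighted values at \<open>z\<close> and \<open>w\<close>.
  Its modulus is \<open>exp (- (norm (z - w))\<^sup>2 / 2)\<close>, so values at distant points are
  almost uncorrelated.\<close>

lemma fock_basis_sums:
  "(\<lambda>n. fock_basis z n * cnj (fock_basis w n)) sums exp (z * cnj w - of_real ((norm z)\<^sup>2 / 2) - of_real ((norm w)\<^sup>2 / 2))"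
proof -
  have eq: "fock_basis z n * cnj (fock_basis w n) =
      ((z * cnj w) ^ n /\<^sub>R fact n) * of_real (exp (- (norm z)\<^sup>2 / 2) * exp (- (norm w)\<^sup>2 / 2))" for n
  proof -
    have "complex_of_real (sqrt (fact n)) * complex_of_real (sqrt (fact n)) = of_real (fact n)"
      by (simp add: of_real_mult[symmetric] del: of_real_mult of_real_fact)
    thus ?thesis
      by (simp add: fock_basis_def power_mult_distrib scaleR_conv_of_real field_simps)
  qed
  have "exp (z * cnj w - of_real ((norm z)\<^sup>2 / 2) - of_real ((norm w)\<^sup>2 / 2)) =
     exp (z * cnj w) * of_real (exp (- (norm z)\<^sup>2 / 2) * exp (- (norm w)\<^sup>2 / 2))"
  proof -
    have "exp (z * cnj w - of_real ((norm z)\<^sup>2 / 2) - of_real ((norm w)\<^sup>2 / 2)) =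
        exp (z * cnj w + (of_real (- (norm z)\<^sup>2 / 2) + of_real (- (norm w)\<^sup>2 / 2)))"
      by (rule arg_cong[where f = exp]) simp
    thus ?thesis by (simp only: exp_add exp_of_real of_real_mult)
  qed
  thus ?thesis unfolding eq by (simp only: sums_mult2[OF exp_converges])
qed

lemma norm_fock_basis_sq_sums: "(\<lambda>n. (norm (fock_basis z n))\<^sup>2) sums 1"
proof -
  have "(\<lambda>n. fock_basis z n * cnj (fock_basis z n)) sums 1"
    using fock_basis_sums[of z z] by (simp add: complex_norm_square[symmetric])
  hence "(\<lambda>n. complex_of_real ((norm (fock_basis z n))\<^sup>2)) sums of_real 1"
    by (simp only: complex_norm_square of_real_1)
  thus ?thesis by (subst (asm) sums_of_real_iff)
qed

lemma gef_series_fock_basis: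
  assumes "gef_conv x"
  shows "summable (\<lambda>n. x n * fock_basis z n)"
    and "(\<Sum>n. x n * fock_basis z n) = gef_series x z * of_real (exp (- (norm z)\<^sup>2 / 2))"
proof -
  have s: "summable (\<lambda>n. x n * (z ^ n / complex_of_real (sqrt (fact n))))"
    by (rule summable_norm_cancel[OF gef_conv_summable_norm[OF assms]])
  show "summable (\<lambda>n. x n * fock_basis z n)"
    using summable_mult2[OF s, of "of_real (exp (- (norm z)\<^sup>2 / 2))"] by (simp add: fock_basis_def mult.assoc)
  show "(\<Sum>n. x n * fock_basis z n) = gef_series x z * of_real (exp (- (norm z)\<^sup>2 / 2))"
    using suminf_mult2[OF s, of "of_real (exp (- (norm z)\<^sup>2 / 2))"] by (simp add: fock_basis_def mult.assoc gef_series_def)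
qed

lemma fock_abs_gef_series:
  assumes "gef_conv x"
  shows "fock_abs (gef_series x) z = norm (\<Sum>n. x n * fock_basis z n)"
  unfolding gef_series_fock_basis(2)[OF assms] fock_abs_def norm_mult by simp

text \<open>The \<open>k\<close>-th power of a holomorphic function is again holomorphic, so the circle estimate holds
  for all moments.\<close>

lemma fock_abs_power_le_circle:
  assumes f: "f holomorphic_on UNIV" and t: "norm t \<le> r / 2" and r: "r > 0"
    and Y: "(\<integral>\<^sup>+\<theta>. ennreal (fock_abs f (\<xi> + of_real r * circ \<theta>) ^ k) \<partial>unit_interval) \<le> ennreal l" and l: "l \<ge> 0"
  shows "fock_abs f (\<xi> + t) ^ k \<le> 2 * exp (real k * r\<^sup>2 / 2) * l"
proof -
  let ?h = "\<lambda>t. fock_shift f \<xi> t ^ k"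
  have h: "?h holomorphic_on UNIV" by (intro holomorphic_intros holomorphic_fock_shift f)
  have nh: "norm (?h t) = fock_abs f (\<xi> + t) ^ k * exp (real k * (norm t)\<^sup>2 / 2)" for t
    by (simp add: norm_power norm_fock_shift power_mult_distrib exp_of_nat_mult[symmetric])
  have c: "continuous_on UNIV (\<lambda>\<theta>. fock_abs f (\<xi> + of_real r * circ \<theta>) ^ k)"
    by (intro continuous_on_power continuous_on_compose2[OF continuous_on_fock_abs[OF f, of UNIV]] continuous_intros) auto
  have "(\<integral>\<^sup>+\<theta>. ennreal (fock_abs f (\<xi> + of_real r * circ \<theta>) ^ k) \<partial>unit_interval) =
      ennreal (\<integral>\<theta>. fock_abs f (\<xi> + of_real r * circ \<theta>) ^ k \<partial>unit_interval)"
    by (rule nn_integral_eq_integral[OF integrable_unit_interval[OF c]]) simp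
  hence int: "(\<integral>\<theta>. fock_abs f (\<xi> + of_real r * circ \<theta>) ^ k \<partial>unit_interval) \<le> l"
    using Y l by simp
  have "fock_abs f (\<xi> + t) ^ k \<le> norm (?h t)"
    unfolding nh using mult_left_mono[of 1 "exp (real k * (norm t)\<^sup>2 / 2)" "fock_abs f (\<xi> + t) ^ k"] by simp
  also have "\<dots> \<le> r / (r - norm t) * (\<integral>\<theta>. norm (?h (of_real r * circ \<theta>)) \<partial>unit_interval)"
    by (rule norm_le_circle_mean[OF h]) (use t r in auto)
  also have "(\<integral>\<theta>. norm (?h (of_real r * circ \<theta>)) \<partial>unit_interval) =
      (\<integral>\<theta>. fock_abs f (\<xi> + of_real r * circ \<theta>) ^ k \<partial>unit_interval) * exp (real k * r\<^sup>2 / 2)"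
    unfolding nh norm_mult norm_circ by simp
  also have "r / (r - norm t) * \<dots> \<le> 2 * (l * exp (real k * r\<^sup>2 / 2))"
  proof (rule mult_mono)
    show "r / (r - norm t) \<le> 2" using t r by (simp add: field_simps)
    show "(\<integral>\<theta>. fock_abs f (\<xi> + of_real r * circ \<theta>) ^ k \<partial>unit_interval) * exp (real k * r\<^sup>2 / 2) \<le> l * exp (real k * r\<^sup>2 / 2)"
      using int by (intro mult_right_mono) auto
  qed (auto intro!: mult_nonneg_nonneg Bochner_Integration.integral_nonneg)
  finally show ?thesis by (simp add: mult_ac)
qed

context gef_coefficients
begin

lemma gef_eq_series: "gef \<zeta> L \<omega> z = gef_series (\<lambda>n. \<zeta> n \<omega>) (of_real (sqrt L) * z)"
  by (simp add: gef_def gef_series_def)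

text \<open>The modulus is dominated by exponentials in the four axis directions, so the Laplace
  transform alone bounds its mean. What matters is uniformity in \<open>n\<close>.\<close>

lemma nn_integral_norm_coeff_le: "(\<integral>\<^sup>+\<omega>. ennreal (norm (\<zeta> n \<omega>)) \<partial>M) \<le> 8"
proof -
  let ?S = "{1, -1, \<i>, -\<i>} :: complex set"
  have pw: "norm z \<le> (\<Sum>b\<in>?S. exp (Re (z * b)))" for z
  proof -
    have e: "\<bar>x\<bar> \<le> exp x + exp (-x)" for x :: real
      using exp_ge_add_one_self[of x] exp_ge_add_one_self[of "-x"] exp_ge_zero[of x] exp_ge_zero[of "-x"] by linarith
    have "norm z \<le> \<bar>Re z\<bar> + \<bar>Im z\<bar>" by (rule cmod_le)
    also have "\<dots> \<le> (exp (Re z) + exp (- Re z)) + (exp (Im z) + exp (- Im z))" by (intro add_mono e)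
    also have "\<dots> = (\<Sum>b\<in>?S. exp (Re (z * b)))" by (simp add: complex_eq_iff)
    finally show ?thesis .
  qed
  have "(\<integral>\<^sup>+\<omega>. ennreal (norm (\<zeta> n \<omega>)) \<partial>M) \<le> (\<integral>\<^sup>+\<omega>. ennreal (\<Sum>b\<in>?S. exp (Re (\<zeta> n \<omega> * b))) \<partial>M)"
    by (intro nn_integral_mono ennreal_leI pw)
  also have "\<dots> = ennreal (expectation (\<lambda>\<omega>. \<Sum>b\<in>?S. exp (Re (\<zeta> n \<omega> * b))))"
    by (rule nn_integral_eq_integral) (intro Bochner_Integration.integrable_sum coeff_mgf AE_I2 sum_nonneg exp_ge_zero)+
  also have "expectation (\<lambda>\<omega>. \<Sum>b\<in>?S. exp (Re (\<zeta> n \<omega> * b))) = (\<Sum>b\<in>?S. exp ((norm b)\<^sup>2 / 4))"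
    unfolding coeff_mgf(2)[of n, symmetric] by (rule Bochner_Integration.integral_sum) (rule coeff_mgf)
  also have "\<dots> = 4 * exp (1/4)" by (simp add: complex_eq_iff)
  also have "\<dots> \<le> 8" using exp_bound[of "1/4::real"] by (simp add: power2_eq_square)
  finally show ?thesis by (simp add: ennreal_leI)
qed

text \<open>At each integer radius the expected sum of the moduli of the terms is finite.\<close>

lemma AE_gef_conv: "AE \<omega> in M. gef_conv (\<lambda>n. \<zeta> n \<omega>)"
proof -
  have "AE \<omega> in M. summable (\<lambda>n. norm (\<zeta> n \<omega>) * (real m ^ n / sqrt (fact n)))" for m :: nat
  proof -
    let ?a = "\<lambda>n. real m ^ n / sqrt (fact n)"
    have sa: "summable ?a"
    proof (rule summable_comparison_test')
      show "summable (\<lambda>n. exp (2 * (real m)\<^sup>2) * (1/2::real) ^ n)" by (intro summable_mult summable_geometric) simp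
      show "norm (?a n) \<le> exp (2 * (real m)\<^sup>2) * (1/2) ^ n" if "n \<ge> 0" for n
        using power_div_sqrt_fact_le[of "real m" n] by simp
    qed
    have "(\<integral>\<^sup>+\<omega>. (\<Sum>n. ennreal (norm (\<zeta> n \<omega>) * ?a n)) \<partial>M) = (\<Sum>n. (\<integral>\<^sup>+\<omega>. ennreal (norm (\<zeta> n \<omega>) * ?a n) \<partial>M))"
      by (rule nn_integral_suminf) measurable
    also have "\<dots> \<le> (\<Sum>n. ennreal (8 * ?a n))"
    proof (intro suminf_le summableI)
      fix n
      have "(\<integral>\<^sup>+\<omega>. ennreal (norm (\<zeta> n \<omega>) * ?a n) \<partial>M) = (\<integral>\<^sup>+\<omega>. ennreal (norm (\<zeta> n \<omega>)) \<partial>M) * ennreal (?a n)"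
        by (subst nn_integral_multc[symmetric]) (auto simp: ennreal_mult[symmetric])
      also have "\<dots> \<le> 8 * ennreal (?a n)" by (intro mult_right_mono nn_integral_norm_coeff_le) simp
      also have "\<dots> = ennreal (8 * ?a n)" by (subst ennreal_mult) auto
      finally show "(\<integral>\<^sup>+\<omega>. ennreal (norm (\<zeta> n \<omega>) * ?a n) \<partial>M) \<le> ennreal (8 * ?a n)" .
    qed
    also have "\<dots> = ennreal (\<Sum>n. 8 * ?a n)"
      by (rule suminf_ennreal2[OF _ summable_mult[OF sa]]) simp
    also have "\<dots> < \<infinity>" by simp
    finally have "(\<integral>\<^sup>+\<omega>. (\<Sum>n. ennreal (norm (\<zeta> n \<omega>) * ?a n)) \<partial>M) \<noteq> \<infinity>" by simp
    hence "AE \<omega> in M. (\<Sum>n. ennreal (norm (\<zeta> n \<omega>) * ?a n)) \<noteq> \<infinity>"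
      by (intro nn_integral_PInf_AE) measurable
    thus ?thesis
      by (rule AE_mp) (auto intro!: AE_I2 summable_suminf_not_top)
  qed
  thus ?thesis unfolding gef_conv_def by (subst AE_all_countable) blast
qed

text \<open>Fatou's lemma yields an inequality only, which is enough for tail bounds.\<close>

lemma series_mgf_le:
  assumes s: "AE \<omega> in M. summable (\<lambda>n. \<zeta> n \<omega> * c n)" and c: "(\<lambda>n. (norm (c n))\<^sup>2) sums Q"
  shows "(\<integral>\<^sup>+\<omega>. ennreal (exp (Re (\<Sum>n. \<zeta> n \<omega> * c n))) \<partial>M) \<le> ennreal (exp (Q / 4))"
proof -
  let ?X = "\<lambda>N \<omega>. ennreal (exp (Re (\<Sum>n<N. \<zeta> n \<omega> * c n)))"
  have "AE \<omega> in M. ennreal (exp (Re (\<Sum>n. \<zeta> n \<omega> * c n))) = liminf (\<lambda>N. ?X N \<omega>)"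
    using s
  proof (eventually_elim)
    case (elim \<omega>)
    have "(\<lambda>N. ?X N \<omega>) \<longlonglongrightarrow> ennreal (exp (Re (\<Sum>n. \<zeta> n \<omega> * c n)))"
      by (intro tendsto_ennrealI tendsto_exp tendsto_Re summable_LIMSEQ elim)
    thus ?case by (intro lim_imp_Liminf[symmetric]) auto
  qed
  hence "(\<integral>\<^sup>+\<omega>. ennreal (exp (Re (\<Sum>n. \<zeta> n \<omega> * c n))) \<partial>M) = (\<integral>\<^sup>+\<omega>. liminf (\<lambda>N. ?X N \<omega>) \<partial>M)"
    by (rule nn_integral_cong_AE)
  also have "\<dots> \<le> liminf (\<lambda>N. \<integral>\<^sup>+\<omega>. ?X N \<omega> \<partial>M)"
    by (rule nn_integral_liminf) measurable
  also have "(\<lambda>N. \<integral>\<^sup>+\<omega>. ?X N \<omega> \<partial>M) = (\<lambda>N. ennreal (exp ((\<Sum>n<N. (norm (c n))\<^sup>2) / 4)))"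
    by (intro ext partial_sum_mgf)
  also have "liminf \<dots> = ennreal (exp (Q / 4))"
    by (intro lim_imp_Liminf tendsto_ennrealI tendsto_exp tendsto_divide tendsto_const c[unfolded sums_def]) auto
  finally show ?thesis .
qed

text \<open>The integrands have modulus 1, so dominated convergence gives equality here.\<close>

lemma series_char:
  assumes s: "AE \<omega> in M. summable (\<lambda>n. \<zeta> n \<omega> * c n)" and c: "(\<lambda>n. (norm (c n))\<^sup>2) sums Q"
  shows "expectation (\<lambda>\<omega>. iexp (Re (\<Sum>n. \<zeta> n \<omega> * c n))) = of_real (exp (- Q / 4))"
proof (rule LIMSEQ_unique)
  show "(\<lambda>N. expectation (\<lambda>\<omega>. iexp (Re (\<Sum>n<N. \<zeta> n \<omega> * c n)))) \<longlonglongrightarrow> expectation (\<lambda>\<omega>. iexp (Re (\<Sum>n. \<zeta> n \<omega> * c n)))"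
  proof (rule integral_dominated_convergence[where w = "\<lambda>_. 1"])
    show "AE \<omega> in M. (\<lambda>N. iexp (Re (\<Sum>n<N. \<zeta> n \<omega> * c n))) \<longlonglongrightarrow> iexp (Re (\<Sum>n. \<zeta> n \<omega> * c n))"
      using s by eventually_elim (intro tendsto_exp tendsto_mult tendsto_const tendsto_of_real tendsto_Re summable_LIMSEQ)
    show "AE \<omega> in M. norm (iexp (Re (\<Sum>n<N. \<zeta> n \<omega> * c n))) \<le> 1" for N by (intro AE_I2) simp
    show "(\<lambda>\<omega>. iexp (Re (\<Sum>n<N. \<zeta> n \<omega> * c n))) \<in> borel_measurable M" for N by measurable
    show "(\<lambda>\<omega>. iexp (Re (\<Sum>n. \<zeta> n \<omega> * c n))) \<in> borel_measurable M" by measurable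
  qed simp
  show "(\<lambda>N. expectation (\<lambda>\<omega>. iexp (Re (\<Sum>n<N. \<zeta> n \<omega> * c n)))) \<longlonglongrightarrow> of_real (exp (- Q / 4))"
    unfolding partial_sum_char
    by (intro tendsto_of_real tendsto_exp tendsto_divide tendsto_minus tendsto_const c[unfolded sums_def]) simp
qed

text \<open>For a complex number x the largest of the four values \<open>Re (x * b)\<close> is the
  sum of the absolute values of its real and imaginary parts, which dominates its modulus. Each
  exponential has mean at most \<open>exp (1/2)\<close>, because \<open>b\<close> has squared
  modulus 2 and the kernel vector has norm 1; hence the bound is uniform in
  \<open>z\<close>.\<close>

lemma nn_integral_exp_fock_abs_le:
  "(\<integral>\<^sup>+\<omega>. ennreal (exp (fock_abs (gef_series (\<lambda>n. \<zeta> n \<omega>)) z)) \<partial>M) \<le> 8"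
proof -
  let ?S = "{Complex 1 1, Complex 1 (-1), Complex (-1) 1, Complex (-1) (-1)}"
  have nS: "(norm b)\<^sup>2 = 2" if "b \<in> ?S" for b using that by (auto simp: cmod_power2)
  have pw: "exp (norm x) \<le> (\<Sum>b\<in>?S. exp (Re (x * b)))" for x
  proof -
    have "\<bar>Re x\<bar> + \<bar>Im x\<bar> = Re x - Im x \<or> \<bar>Re x\<bar> + \<bar>Im x\<bar> = Re x + Im x \<or>
        \<bar>Re x\<bar> + \<bar>Im x\<bar> = - Re x - Im x \<or> \<bar>Re x\<bar> + \<bar>Im x\<bar> = - Re x + Im x" by linarith
    hence "\<exists>b\<in>?S. \<bar>Re x\<bar> + \<bar>Im x\<bar> = Re (x * b)" by auto
    then obtain b where "b \<in> ?S" "\<bar>Re x\<bar> + \<bar>Im x\<bar> = Re (x * b)" by blast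
    hence b: "b \<in> ?S" "norm x \<le> Re (x * b)" using cmod_le[of x] by simp_all
    have "exp (norm x) \<le> exp (Re (x * b))" using b by simp
    also have "\<dots> \<le> (\<Sum>b\<in>?S. exp (Re (x * b)))"
      by (rule member_le_sum[OF b(1)]) auto
    finally show ?thesis .
  qed
  have "(\<integral>\<^sup>+\<omega>. ennreal (exp (fock_abs (gef_series (\<lambda>n. \<zeta> n \<omega>)) z)) \<partial>M) \<le>
     (\<integral>\<^sup>+\<omega>. (\<Sum>b\<in>?S. ennreal (exp (Re (\<Sum>n. \<zeta> n \<omega> * (fock_basis z n * b))))) \<partial>M)"
  proof (rule nn_integral_mono_AE)
    show "AE \<omega> in M. ennreal (exp (fock_abs (gef_series (\<lambda>n. \<zeta> n \<omega>)) z)) \<le> (\<Sum>b\<in>?S. ennreal (exp (Re (\<Sum>n. \<zeta> n \<omega> * (fock_basis z n * b)))))"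
      using AE_gef_conv
    proof eventually_elim
      case (elim \<omega>)
      have "(\<Sum>n. \<zeta> n \<omega> * (fock_basis z n * b)) = (\<Sum>n. \<zeta> n \<omega> * fock_basis z n) * b" for b
        using suminf_mult2[OF gef_series_fock_basis(1)[OF elim], of z b] by (simp add: mult.assoc)
      thus ?case
        unfolding fock_abs_gef_series[OF elim] using pw[of "\<Sum>n. \<zeta> n \<omega> * fock_basis z n"]
        by (subst sum_ennreal) (auto intro!: ennreal_leI simp del: sum.insert)
    qed
  qed
  also have "\<dots> = (\<Sum>b\<in>?S. (\<integral>\<^sup>+\<omega>. ennreal (exp (Re (\<Sum>n. \<zeta> n \<omega> * (fock_basis z n * b)))) \<partial>M))"
    by (rule nn_integral_sum) measurable
  also have "\<dots> \<le> (\<Sum>b\<in>?S. ennreal (exp (2 / 4)))"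
  proof (rule sum_mono)
    fix b assume b: "b \<in> ?S"
    show "(\<integral>\<^sup>+\<omega>. ennreal (exp (Re (\<Sum>n. \<zeta> n \<omega> * (fock_basis z n * b)))) \<partial>M) \<le> ennreal (exp (2 / 4))"
    proof (rule series_mgf_le)
      show "AE \<omega> in M. summable (\<lambda>n. \<zeta> n \<omega> * (fock_basis z n * b))"
        using AE_gef_conv
      proof eventually_elim
        case (elim \<omega>)
        from summable_mult2[OF gef_series_fock_basis(1)[OF elim], of z b] show ?case by (simp add: mult.assoc)
      qed
      show "(\<lambda>n. (norm (fock_basis z n * b))\<^sup>2) sums 2"
        using sums_mult2[OF norm_fock_basis_sq_sums, of z 2] nS[OF b] by (simp add: norm_mult power_mult_distrib)
    qed
  qed
  also have "\<dots> = ennreal (4 * exp (1/2))" by (simp add: complex_eq_iff ennreal_mult)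
  also have "\<dots> \<le> ennreal 8"
    using exp_bound[of "1/2::real"] by (intro ennreal_leI) (simp add: power2_eq_square)
  also have "ennreal 8 = 8" by simp
  finally show ?thesis .
qed

lemma prob_circle_mean_ge:
  fixes k :: nat and r :: real and \<xi> :: complex
  assumes l: "l > 0"
  defines "Y \<equiv> \<lambda>\<omega>. (\<integral>\<^sup>+\<theta>. ennreal (fock_abs (gef_series (\<lambda>n. \<zeta> n \<omega>)) (\<xi> + of_real r * circ \<theta>) ^ k) \<partial>unit_interval)"
  shows "{\<omega>\<in>space M. Y \<omega> \<ge> ennreal l} \<in> sets M"
    and "prob {\<omega>\<in>space M. Y \<omega> \<ge> ennreal l} \<le> 8 * fact k / l"
proof -
  have [measurable]: "circ \<in> borel_measurable unit_interval" by (rule measurable_unit_interval) simp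
  let ?u = "\<lambda>\<omega> z. fock_abs (gef_series (\<lambda>n. \<zeta> n \<omega>)) z"
  have m2 [measurable]: "(\<lambda>(\<omega>, \<theta>). ennreal (?u \<omega> (\<xi> + of_real r * circ \<theta>) ^ k)) \<in> borel_measurable (M \<Otimes>\<^sub>M unit_interval)"
    unfolding fock_abs_def gef_series_def by measurable
  have m1 [measurable]: "(\<lambda>\<omega>. ennreal (exp (?u \<omega> z))) \<in> borel_measurable M" for z
    unfolding fock_abs_def gef_series_def by measurable
  interpret P: pair_sigma_finite M unit_interval ..
  have Ym [measurable]: "Y \<in> borel_measurable M"
    unfolding Y_def using unit_interval.borel_measurable_nn_integral[OF m2] by simp
  show s: "{\<omega>\<in>space M. Y \<omega> \<ge> ennreal l} \<in> sets M" by measurable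
  have "(\<integral>\<^sup>+\<omega>. Y \<omega> \<partial>M) = (\<integral>\<^sup>+\<theta>. (\<integral>\<^sup>+\<omega>. ennreal (?u \<omega> (\<xi> + of_real r * circ \<theta>) ^ k) \<partial>M) \<partial>unit_interval)"
    unfolding Y_def by (rule P.Fubini'[symmetric]) (use m2 in simp)
  also have "\<dots> \<le> (\<integral>\<^sup>+\<theta>. ennreal (8 * fact k) \<partial>unit_interval)"
  proof (rule nn_integral_mono)
    fix \<theta>
    let ?z = "\<xi> + of_real r * circ \<theta>"
    have "(\<integral>\<^sup>+\<omega>. ennreal (?u \<omega> ?z ^ k) \<partial>M) \<le> (\<integral>\<^sup>+\<omega>. ennreal (fact k) * ennreal (exp (?u \<omega> ?z)) \<partial>M)"
      by (intro nn_integral_mono) (simp add: ennreal_mult[symmetric] power_le_fact_exp ennreal_leI)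
    also have "\<dots> = ennreal (fact k) * (\<integral>\<^sup>+\<omega>. ennreal (exp (?u \<omega> ?z)) \<partial>M)"
      by (rule nn_integral_cmult) measurable
    also have "\<dots> \<le> ennreal (fact k) * 8" by (intro mult_left_mono nn_integral_exp_fock_abs_le) simp
    also have "\<dots> = ennreal (8 * fact k)" by (simp add: ennreal_mult mult.commute)
    finally show "(\<integral>\<^sup>+\<omega>. ennreal (?u \<omega> ?z ^ k) \<partial>M) \<le> ennreal (8 * fact k)" .
  qed
  also have "\<dots> = ennreal (8 * fact k)" by (simp add: unit_interval.emeasure_space_1)
  finally have EY: "(\<integral>\<^sup>+\<omega>. Y \<omega> \<partial>M) \<le> ennreal (8 * fact k)" .
  have "emeasure M {\<omega>\<in>space M. Y \<omega> \<ge> ennreal l} \<le> emeasure M {\<omega>\<in>space M. 1 \<le> ennreal (1 / l) * Y \<omega>}"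
  proof (rule emeasure_mono)
    show "{\<omega>\<in>space M. Y \<omega> \<ge> ennreal l} \<subseteq> {\<omega>\<in>space M. 1 \<le> ennreal (1 / l) * Y \<omega>}"
    proof safe
      fix \<omega> assume "Y \<omega> \<ge> ennreal l"
      hence "ennreal (1/l) * ennreal l \<le> ennreal (1 / l) * Y \<omega>" by (intro mult_left_mono) auto
      thus "1 \<le> ennreal (1 / l) * Y \<omega>" using l by (simp add: ennreal_mult[symmetric])
    qed
  qed measurable
  also have "\<dots> \<le> ennreal (1 / l) * (\<integral>\<^sup>+\<omega>. Y \<omega> * indicator (space M) \<omega> \<partial>M)"
    by (rule nn_integral_Markov_inequality) auto
  also have "(\<integral>\<^sup>+\<omega>. Y \<omega> * indicator (space M) \<omega> \<partial>M) = (\<integral>\<^sup>+\<omega>. Y \<omega> \<partial>M)"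
    by (intro nn_integral_cong) auto
  also have "ennreal (1 / l) * \<dots> \<le> ennreal (1 / l) * ennreal (8 * fact k)" by (intro mult_left_mono EY) simp
  also have "\<dots> = ennreal (8 * fact k / l)" using l by (simp add: ennreal_mult[symmetric])
  finally show "prob {\<omega>\<in>space M. Y \<omega> \<ge> ennreal l} \<le> 8 * fact k / l"
    using l by (simp add: emeasure_eq_measure)
qed

end

section \<open>Small ball probabilities\<close>

text \<open>The standard normal density is at most \<open>1 / sqrt (2 * pi)\<close>, and the
  remaining Gaussian has standard deviation \<open>2 * \<tau>\<close>. This is the source of one
  factor \<open>\<tau>\<close> per sample.\<close>

lemma std_normal_gaussian_integral_le:
  assumes \<tau>: "\<tau> > 0"
  shows "integrable std_normal_distribution (\<lambda>x. exp (- x\<^sup>2 / (8 * \<tau>\<^sup>2)))"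
    and "(\<integral>x. exp (- x\<^sup>2 / (8 * \<tau>\<^sup>2)) \<partial>std_normal_distribution) \<le> 2 * \<tau>"
proof -
  interpret N: prob_space std_normal_distribution by (rule prob_space_normal_density) simp
  show i: "integrable std_normal_distribution (\<lambda>x. exp (- x\<^sup>2 / (8 * \<tau>\<^sup>2)))"
    by (rule N.integrable_const_bound[of _ 1]) (auto intro!: AE_I2)
  have "(\<integral>x. exp (- x\<^sup>2 / (8 * \<tau>\<^sup>2)) \<partial>std_normal_distribution) = (\<integral>x. std_normal_density x * exp (- x\<^sup>2 / (8 * \<tau>\<^sup>2)) \<partial>lborel)"
    by (subst integral_density) auto
  also have "\<dots> \<le> (\<integral>x. (2 * \<tau>) * normal_density 0 (2 * \<tau>) x \<partial>lborel)"
  proof (rule integral_mono)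
    show "integrable lborel (\<lambda>x. std_normal_density x * exp (- x\<^sup>2 / (8 * \<tau>\<^sup>2)))"
      using i by (subst (asm) integrable_density) auto
    show "integrable lborel (\<lambda>x. (2 * \<tau>) * normal_density 0 (2 * \<tau>) x)"
      using \<tau> by (intro integrable_mult_right integrable_normal_density) simp
    fix x :: real
    have eq: "(2 * \<tau>) * normal_density 0 (2 * \<tau>) x = (1 / sqrt (2 * pi)) * exp (- x\<^sup>2 / (8 * \<tau>\<^sup>2))"
    proof -
      have "sqrt (2 * pi * (2 * \<tau>)\<^sup>2) = sqrt (2 * pi) * (2 * \<tau>)"
        using \<tau> by (simp only: real_sqrt_mult[of "2 * pi" "(2 * \<tau>)\<^sup>2"] real_sqrt_abs)
      thus ?thesis using \<tau> unfolding normal_density_def by (simp add: power_mult_distrib)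
    qed
    have "std_normal_density x \<le> 1 / sqrt (2 * pi)"
      unfolding std_normal_density_def by (intro mult_left_le) auto
    thus "std_normal_density x * exp (- x\<^sup>2 / (8 * \<tau>\<^sup>2)) \<le> (2 * \<tau>) * normal_density 0 (2 * \<tau>) x"
      unfolding eq by (intro mult_right_mono) auto
  qed
  also have "\<dots> = 2 * \<tau>" using integral_normal_density[of "2 * \<tau>" 0] \<tau> by simp
  finally show "(\<integral>x. exp (- x\<^sup>2 / (8 * \<tau>\<^sup>2)) \<partial>std_normal_distribution) \<le> 2 * \<tau>" .
qed

text \<open>The Laplace transform of the quadratic form is turned into characteristic functions by writing
  \<open>exp (- x\<^sup>2 / 2)\<close> as the characteristic function of an auxiliary standard normal variable.
  Thus only the quadratic form of the covariance is needed, not the joint density.\<close>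

lemma (in gef_coefficients) small_ball:
  fixes J :: "'j set" and c :: "'j \<Rightarrow> nat \<Rightarrow> complex"
  assumes J: "finite J"
    and conv: "AE \<omega> in M. \<forall>j\<in>J. summable (\<lambda>n. \<zeta> n \<omega> * c j n)"
    and Q: "\<And>g :: 'j \<Rightarrow> real. \<exists>q. (\<lambda>n. (norm (\<Sum>j\<in>J. of_real (g j) * c j n))\<^sup>2) sums q \<and> (\<Sum>j\<in>J. (g j)\<^sup>2) / 2 \<le> q"
    and \<tau>: "\<tau> > 0"
  shows "{\<omega>\<in>space M. \<forall>j\<in>J. \<bar>Re (\<Sum>n. \<zeta> n \<omega> * c j n)\<bar> \<le> \<tau>} \<in> sets M"
    and "prob {\<omega>\<in>space M. \<forall>j\<in>J. \<bar>Re (\<Sum>n. \<zeta> n \<omega> * c j n)\<bar> \<le> \<tau>} \<le> (4 * \<tau>) ^ card J"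
proof -
  define X where "X j \<omega> = Re (\<Sum>n. \<zeta> n \<omega> * c j n)" for j \<omega>
  have Xm [measurable]: "X j \<in> borel_measurable M" for j unfolding X_def by measurable
  define A where "A = {\<omega>\<in>space M. \<forall>j\<in>J. \<bar>X j \<omega>\<bar> \<le> \<tau>}"
  have A: "A \<in> sets M" unfolding A_def using J by measurable
  thus "{\<omega>\<in>space M. \<forall>j\<in>J. \<bar>Re (\<Sum>n. \<zeta> n \<omega> * c j n)\<bar> \<le> \<tau>} \<in> sets M" by (simp add: A_def X_def)
  interpret N: prob_space std_normal_distribution by (rule prob_space_normal_density) simp
  interpret PS: product_prob_space "\<lambda>_::'j. std_normal_distribution" J ..
  define \<Gamma> where "\<Gamma> = PiM J (\<lambda>_::'j. std_normal_distribution)"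
  interpret \<Gamma>: prob_space \<Gamma> unfolding \<Gamma>_def by (rule prob_space_PiM) (rule N.prob_space_axioms)
  interpret P: pair_prob_space M \<Gamma> ..
  have comp [measurable]: "(\<lambda>g. g j) \<in> borel_measurable \<Gamma>" if "j \<in> J" for j
    using measurable_component_singleton[OF that, of "\<lambda>_. std_normal_distribution"] by (simp add: \<Gamma>_def)
  \<comment> \<open>Integrated over \<open>g\<close>, this gives the Gaussian function
    \<open>e\<close> of the samples; integrated over \<open>\<omega>\<close>, the characteristic
    function of a linear combination of the samples, which \<open>Q\<close> controls.\<close>
  define F where "F \<omega> g = iexp (\<Sum>j\<in>J. (X j \<omega> / \<tau>) * g j)" for \<omega> and g :: "'j \<Rightarrow> real"
  have Fm [measurable]: "(\<lambda>(\<omega>, g). F \<omega> g) \<in> borel_measurable (M \<Otimes>\<^sub>M \<Gamma>)"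
    unfolding F_def by measurable
  have Fi: "integrable (M \<Otimes>\<^sub>M \<Gamma>) (\<lambda>(\<omega>, g). F \<omega> g)"
    by (rule P.integrable_const_bound[of _ 1]) (auto intro!: AE_I2 simp: F_def)
  define e where "e \<omega> = exp (- (\<Sum>j\<in>J. (X j \<omega>)\<^sup>2) / (2 * \<tau>\<^sup>2))" for \<omega>
  have em [measurable]: "e \<in> borel_measurable M" unfolding e_def by measurable
  have inner1: "(\<integral>g. F \<omega> g \<partial>\<Gamma>) = of_real (e \<omega>)" for \<omega>
  proof -
    have "F \<omega> g = (\<Prod>j\<in>J. iexp ((X j \<omega> / \<tau>) * g j))" for g
      unfolding F_def using J by (simp add: exp_sum[symmetric] sum_distrib_left)
    hence "(\<integral>g. F \<omega> g \<partial>\<Gamma>) = (\<Prod>j\<in>J. (\<integral>x. iexp ((X j \<omega> / \<tau>) * x) \<partial>std_normal_distribution))"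
      unfolding \<Gamma>_def
      by (simp only:, intro PS.product_integral_prod J N.integrable_const_bound[of _ 1]) (auto intro!: AE_I2)
    also have "\<dots> = (\<Prod>j\<in>J. complex_of_real (exp (- (X j \<omega> / \<tau>)\<^sup>2 / 2)))"
      by (intro prod.cong refl std_normal_char)
    also have "\<dots> = of_real (e \<omega>)"
      unfolding of_real_prod[symmetric] e_def using J
      by (simp add: exp_sum[symmetric] power_divide sum_divide_distrib sum_negf mult.commute)
    finally show ?thesis .
  qed
  have inner2: "norm (\<integral>\<omega>. F \<omega> g \<partial>M) \<le> (\<Prod>j\<in>J. exp (- (g j)\<^sup>2 / (8 * \<tau>\<^sup>2)))" for g
  proof -
    obtain q where q: "(\<lambda>n. (norm (\<Sum>j\<in>J. of_real (g j) * c j n))\<^sup>2) sums q" "(\<Sum>j\<in>J. (g j)\<^sup>2) / 2 \<le> q"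
      using Q[of g] by blast
    define d where "d n = (\<Sum>j\<in>J. of_real (g j) * c j n) / of_real \<tau>" for n
    have dq: "(\<lambda>n. (norm (d n))\<^sup>2) sums (q / \<tau>\<^sup>2)"
      using sums_divide[OF q(1), of "\<tau>\<^sup>2"] by (simp add: d_def norm_divide power_divide)
    have sm: "AE \<omega> in M. (\<lambda>n. \<zeta> n \<omega> * d n) sums (\<Sum>j\<in>J. of_real (g j / \<tau>) * (\<Sum>n. \<zeta> n \<omega> * c j n))"
      using conv
    proof eventually_elim
      case (elim \<omega>)
      have "(\<lambda>n. \<Sum>j\<in>J. of_real (g j / \<tau>) * (\<zeta> n \<omega> * c j n)) sums (\<Sum>j\<in>J. of_real (g j / \<tau>) * (\<Sum>n. \<zeta> n \<omega> * c j n))"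
        by (intro sums_sum sums_mult summable_sums) (use elim in auto)
      moreover have "(\<Sum>j\<in>J. of_real (g j / \<tau>) * (\<zeta> n \<omega> * c j n)) = \<zeta> n \<omega> * d n" for n
        by (simp add: d_def sum_divide_distrib sum_distrib_left mult_ac)
      ultimately show ?case by simp
    qed
    have "(\<integral>\<omega>. F \<omega> g \<partial>M) = (\<integral>\<omega>. iexp (Re (\<Sum>n. \<zeta> n \<omega> * d n)) \<partial>M)"
    proof (rule integral_cong_AE)
      show "AE \<omega> in M. F \<omega> g = iexp (Re (\<Sum>n. \<zeta> n \<omega> * d n))"
        using sm
      proof eventually_elim
        case (elim \<omega>)
        have "Re (\<Sum>n. \<zeta> n \<omega> * d n) = (\<Sum>j\<in>J. (X j \<omega> / \<tau>) * g j)"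
          using sums_unique[OF elim, symmetric] by (simp only:) (simp add: Re_sum X_def mult_ac)
        thus ?case by (simp add: F_def)
      qed
      show "(\<lambda>\<omega>. F \<omega> g) \<in> borel_measurable M" unfolding F_def by measurable
      show "(\<lambda>\<omega>. iexp (Re (\<Sum>n. \<zeta> n \<omega> * d n))) \<in> borel_measurable M" by measurable
    qed
    also have "\<dots> = of_real (exp (- (q / \<tau>\<^sup>2) / 4))"
    proof (rule series_char[OF _ dq])
      show "AE \<omega> in M. summable (\<lambda>n. \<zeta> n \<omega> * d n)"
        using sm by eventually_elim (rule sums_summable)
    qed
    also have "norm \<dots> = exp (- (q / \<tau>\<^sup>2) / 4)" by simp
    also have "\<dots> \<le> exp (- ((\<Sum>j\<in>J. (g j)\<^sup>2) / 2 / \<tau>\<^sup>2) / 4)"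
      using divide_right_mono[OF q(2), of "\<tau>\<^sup>2"] by simp
    also have "\<dots> = (\<Prod>j\<in>J. exp (- (g j)\<^sup>2 / (8 * \<tau>\<^sup>2)))"
      using J by (simp add: exp_sum[symmetric] sum_negf sum_divide_distrib mult.commute)
    finally show ?thesis .
  qed
  note gi = std_normal_gaussian_integral_le[OF \<tau>]
  have "of_real (expectation e) = (\<integral>\<omega>. (\<integral>g. F \<omega> g \<partial>\<Gamma>) \<partial>M)"
    unfolding inner1 by simp
  also have "\<dots> = (\<integral>g. (\<integral>\<omega>. F \<omega> g \<partial>M) \<partial>\<Gamma>)"
    by (rule P.Fubini_integral[OF Fi, symmetric])
  finally have eq: "complex_of_real (expectation e) = (\<integral>g. (\<integral>\<omega>. F \<omega> g \<partial>M) \<partial>\<Gamma>)" .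
  have "expectation e \<le> norm (complex_of_real (expectation e))" by simp
  also have "\<dots> \<le> (\<integral>g. norm (\<integral>\<omega>. F \<omega> g \<partial>M) \<partial>\<Gamma>)"
    unfolding eq by (rule integral_norm_bound)
  also have "\<dots> \<le> (\<integral>g. (\<Prod>j\<in>J. exp (- (g j)\<^sup>2 / (8 * \<tau>\<^sup>2))) \<partial>\<Gamma>)"
  proof (rule integral_mono[OF _ _ inner2])
    show "integrable \<Gamma> (\<lambda>g. norm (\<integral>\<omega>. F \<omega> g \<partial>M))"
      by (intro integrable_norm P.integrable_snd[OF Fi])
    show "integrable \<Gamma> (\<lambda>g. \<Prod>j\<in>J. exp (- (g j)\<^sup>2 / (8 * \<tau>\<^sup>2)))"
      unfolding \<Gamma>_def by (rule PS.product_integrable_prod[OF J gi(1)])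
  qed
  also have "\<dots> = (\<Prod>j\<in>J. (\<integral>x. exp (- x\<^sup>2 / (8 * \<tau>\<^sup>2)) \<partial>std_normal_distribution))"
    unfolding \<Gamma>_def by (rule PS.product_integral_prod[OF J gi(1)])
  also have "\<dots> \<le> (\<Prod>j\<in>J. 2 * \<tau>)"
    by (intro prod_mono conjI gi(2) Bochner_Integration.integral_nonneg) auto
  finally have Ee: "expectation e \<le> (2 * \<tau>) ^ card J" by simp
  \<comment> \<open>Markov's inequality: on \<open>A\<close> the exponent in \<open>e\<close> is at
    most half the number of samples, and \<open>exp (1/2) \<le> 2\<close>.\<close>
  have "prob A = expectation (indicator A)" using A by simp
  also have "\<dots> \<le> expectation (\<lambda>\<omega>. 2 ^ card J * e \<omega>)"
  proof (rule integral_mono)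
    show "integrable M (indicator A :: 'a \<Rightarrow> real)"
      by (rule integrable_real_indicator[OF A]) (simp add: emeasure_eq_measure)
    show "integrable M (\<lambda>\<omega>. 2 ^ card J * e \<omega>)"
    proof (rule integrable_const_bound)
      show "AE \<omega> in M. norm (2 ^ card J * e \<omega>) \<le> 2 ^ card J"
        by (intro AE_I2) (simp add: e_def sum_nonneg)
    qed measurable
    fix \<omega>
    show "indicator A \<omega> \<le> 2 ^ card J * e \<omega>"
    proof (cases "\<omega> \<in> A")
      case True
      have "(\<Sum>j\<in>J. (X j \<omega>)\<^sup>2) \<le> (\<Sum>j\<in>J. \<tau>\<^sup>2)"
      proof (rule sum_mono)
        fix j assume "j \<in> J"
        hence "\<bar>X j \<omega>\<bar> \<le> \<tau>" using True by (simp add: A_def)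
        thus "(X j \<omega>)\<^sup>2 \<le> \<tau>\<^sup>2" by (metis abs_ge_zero power2_abs power_mono)
      qed
      hence "(\<Sum>j\<in>J. (X j \<omega>)\<^sup>2) / (2 * \<tau>\<^sup>2) \<le> (real (card J) * \<tau>\<^sup>2) / (2 * \<tau>\<^sup>2)"
        by (intro divide_right_mono) auto
      also have "\<dots> = real (card J) / 2" using \<tau> by simp
      finally have "exp (- real (card J) / 2) \<le> e \<omega>" by (simp add: e_def)
      moreover have "1 \<le> 2 ^ card J * exp (- real (card J) / 2)"
      proof -
        have "exp (real (card J) / 2) = exp (1/2) ^ card J" by (simp add: exp_of_nat_mult[symmetric])
        also have "\<dots> \<le> 2 ^ card J"
          using exp_bound[of "1/2::real"] by (intro power_mono) (simp_all add: power2_eq_square)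
        finally show ?thesis by (simp add: exp_minus field_simps)
      qed
      ultimately have "1 \<le> 2 ^ card J * e \<omega>"
        by (meson mult_left_mono order_trans zero_le_numeral zero_le_power)
      thus ?thesis using True by simp
    qed (simp add: e_def)
  qed
  also have "\<dots> = 2 ^ card J * expectation e" by simp
  also have "\<dots> \<le> 2 ^ card J * (2 * \<tau>) ^ card J" using Ee by (intro mult_left_mono) auto
  also have "\<dots> = (4 * \<tau>) ^ card J" by (subst power_mult_distrib[symmetric]) simp
  finally show "prob {\<omega>\<in>space M. \<forall>j\<in>J. \<bar>Re (\<Sum>n. \<zeta> n \<omega> * c j n)\<bar> \<le> \<tau>} \<le> (4 * \<tau>) ^ card J"
    by (simp add: A_def X_def)
qed

text \<open>Gershgorin: the Gram matrix of well separated normalised reproducing kernels is diagonally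
  dominant.\<close>

lemma fock_basis_coercive:
  fixes z :: "'j \<Rightarrow> complex" and g :: "'j \<Rightarrow> real"
  assumes J: "finite J"
    and row: "\<And>j. j \<in> J \<Longrightarrow> (\<Sum>k\<in>J - {j}. exp (- (norm (z j - z k))\<^sup>2 / 2)) \<le> 1/2"
  shows "\<exists>q. (\<lambda>n. (norm (\<Sum>j\<in>J. of_real (g j) * fock_basis (z j) n))\<^sup>2) sums q \<and> (\<Sum>j\<in>J. (g j)\<^sup>2) / 2 \<le> q"
proof -
  define K where "K j k = exp (z j * cnj (z k) - of_real ((norm (z j))\<^sup>2 / 2) - of_real ((norm (z k))\<^sup>2 / 2))" for j k
  define \<kappa> where "\<kappa> j k = (if j = k then 0 else exp (- (norm (z j - z k))\<^sup>2 / 2))" for j k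
  define q where "q = Re (\<Sum>j\<in>J. \<Sum>k\<in>J. of_real (g j * g k) * K j k)"
  have nK: "norm (K j k) = exp (- (norm (z j - z k))\<^sup>2 / 2)" for j k
  proof -
    have "(norm (z j - z k))\<^sup>2 = (norm (z j))\<^sup>2 + (norm (z k))\<^sup>2 - 2 * Re (z j * cnj (z k))"
      unfolding cmod_power2 by (simp add: power2_eq_square algebra_simps)
    hence "Re (z j * cnj (z k) - of_real ((norm (z j))\<^sup>2 / 2) - of_real ((norm (z k))\<^sup>2 / 2)) = - (norm (z j - z k))\<^sup>2 / 2"
      by simp
    thus ?thesis unfolding K_def norm_exp_eq_Re by simp
  qed
  have Kjj: "K j j = 1" for j
  proof -
    have "z j * cnj (z j) - of_real ((norm (z j))\<^sup>2 / 2) - of_real ((norm (z j))\<^sup>2 / 2) = 0"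
      by (simp add: complex_norm_square[symmetric])
    thus ?thesis by (simp only: K_def exp_zero)
  qed
  have "(\<lambda>n. \<Sum>j\<in>J. \<Sum>k\<in>J. of_real (g j * g k) * (fock_basis (z j) n * cnj (fock_basis (z k) n))) sums
     (\<Sum>j\<in>J. \<Sum>k\<in>J. of_real (g j * g k) * K j k)"
    unfolding K_def by (intro sums_sum sums_mult fock_basis_sums)
  hence "(\<lambda>n. Re (\<Sum>j\<in>J. \<Sum>k\<in>J. of_real (g j * g k) * (fock_basis (z j) n * cnj (fock_basis (z k) n)))) sums q"
    unfolding q_def by (rule sums_Re)
  moreover have "Re (\<Sum>j\<in>J. \<Sum>k\<in>J. of_real (g j * g k) * (fock_basis (z j) n * cnj (fock_basis (z k) n)))
     = (norm (\<Sum>j\<in>J. of_real (g j) * fock_basis (z j) n))\<^sup>2" for n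
  proof -
    let ?s = "\<Sum>j\<in>J. of_real (g j) * fock_basis (z j) n"
    have "(\<Sum>j\<in>J. \<Sum>k\<in>J. of_real (g j * g k) * (fock_basis (z j) n * cnj (fock_basis (z k) n))) = ?s * cnj ?s"
      by (simp add: sum_product cnj_sum mult_ac)
    also have "\<dots> = of_real ((norm ?s)\<^sup>2)" by (rule complex_norm_square[symmetric])
    finally show ?thesis by simp
  qed
  ultimately have s: "(\<lambda>n. (norm (\<Sum>j\<in>J. of_real (g j) * fock_basis (z j) n))\<^sup>2) sums q" by simp
  have sym: "\<kappa> j k = \<kappa> k j" for j k by (simp add: \<kappa>_def norm_minus_commute)
  have k0: "\<kappa> j k \<ge> 0" for j k by (simp add: \<kappa>_def)
  have rowk: "(\<Sum>k\<in>J. \<kappa> j k) \<le> 1/2" if "j \<in> J" for j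
  proof -
    have "(\<Sum>k\<in>J. \<kappa> j k) = (\<Sum>k\<in>J - {j}. \<kappa> j k)"
      by (rule sum.mono_neutral_right) (use J in \<open>auto simp: \<kappa>_def\<close>)
    also have "\<dots> = (\<Sum>k\<in>J - {j}. exp (- (norm (z j - z k))\<^sup>2 / 2))"
      by (intro sum.cong) (auto simp: \<kappa>_def)
    finally show ?thesis using row[OF that] by simp
  qed
  \<comment> \<open>Each off-diagonal term is shared equally between the two squares. By the row
    sums each share adds up to at most a quarter of the sum of squares, which leaves one half of
    it.\<close>
  have summand: "(if j = k then (g j)\<^sup>2 else 0) - \<kappa> j k * ((g j)\<^sup>2 / 2) - \<kappa> j k * ((g k)\<^sup>2 / 2) \<le> Re (of_real (g j * g k) * K j k)" for j k
  proof (cases "j = k")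
    case True
    thus ?thesis by (simp add: \<kappa>_def Kjj power2_eq_square)
  next
    case False
    have "\<bar>Re (of_real (g j * g k) * K j k)\<bar> \<le> norm (of_real (g j * g k) * K j k)" by (rule abs_Re_le_cmod)
    also have "\<dots> = \<bar>g j * g k\<bar> * \<kappa> j k" using False by (simp add: norm_mult nK \<kappa>_def abs_mult)
    also have "\<bar>g j * g k\<bar> \<le> (g j)\<^sup>2 / 2 + (g k)\<^sup>2 / 2"
      using zero_le_power2[of "\<bar>g j\<bar> - \<bar>g k\<bar>"] by (simp add: power2_diff abs_mult)
    hence "\<bar>g j * g k\<bar> * \<kappa> j k \<le> ((g j)\<^sup>2 / 2 + (g k)\<^sup>2 / 2) * \<kappa> j k" by (intro mult_right_mono k0)
    finally show ?thesis using False by (simp add: algebra_simps)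
  qed
  have "(\<Sum>j\<in>J. \<Sum>k\<in>J. (if j = k then (g j)\<^sup>2 else 0) - \<kappa> j k * ((g j)\<^sup>2 / 2) - \<kappa> j k * ((g k)\<^sup>2 / 2)) \<le> q"
    unfolding q_def Re_sum by (intro sum_mono summand)
  moreover have "(\<Sum>j\<in>J. \<Sum>k\<in>J. (if j = k then (g j)\<^sup>2 else 0) - \<kappa> j k * ((g j)\<^sup>2 / 2) - \<kappa> j k * ((g k)\<^sup>2 / 2))
     = (\<Sum>j\<in>J. (g j)\<^sup>2) - (\<Sum>j\<in>J. \<Sum>k\<in>J. \<kappa> j k * ((g j)\<^sup>2 / 2)) - (\<Sum>j\<in>J. \<Sum>k\<in>J. \<kappa> j k * ((g k)\<^sup>2 / 2))"
    using J by (simp add: sum_subtractf)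
  moreover have "(\<Sum>j\<in>J. \<Sum>k\<in>J. \<kappa> j k * ((g k)\<^sup>2 / 2)) = (\<Sum>j\<in>J. \<Sum>k\<in>J. \<kappa> j k * ((g j)\<^sup>2 / 2))"
    by (subst sum.swap) (simp add: sym)
  moreover have "(\<Sum>j\<in>J. \<Sum>k\<in>J. \<kappa> j k * ((g j)\<^sup>2 / 2)) \<le> (\<Sum>j\<in>J. (1/2) * ((g j)\<^sup>2 / 2))"
    unfolding sum_distrib_right[symmetric] by (intro sum_mono mult_right_mono rowk) auto
  moreover have "(\<Sum>j\<in>J. (1/2) * ((g j)\<^sup>2 / 2)) = (\<Sum>j\<in>J. (g j)\<^sup>2) / 4"
    by (simp add: sum_divide_distrib)
  ultimately have "(\<Sum>j\<in>J. (g j)\<^sup>2) / 2 \<le> q" by linarith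
  with s show ?thesis by blast
qed

text \<open>The indices up to \<open>a\<close> and those beyond it form two geometric series, with
  sums at most 1 / (1 - q) and q / (1 - q).\<close>

lemma sum_power_dist_le:
  fixes q :: real
  assumes q: "0 \<le> q" "q < 1"
  shows "(\<Sum>i<m. q ^ nat \<bar>int a - int i\<bar>) \<le> (1 + q) / (1 - q)"
proof -
  have geo: "(\<Sum>i<n. q ^ i) \<le> 1 / (1 - q)" for n
    using sum_le_suminf[OF summable_geometric, of q "{..<n}"] q by (simp add: suminf_geometric)
  have "(\<Sum>i<m. q ^ nat \<bar>int a - int i\<bar>) \<le> (\<Sum>i\<in>{..<Suc a} \<union> {a<..<a+Suc m}. q ^ nat \<bar>int a - int i\<bar>)"
    by (rule sum_mono2) (use q in auto)
  also have "\<dots> = (\<Sum>i<Suc a. q ^ nat \<bar>int a - int i\<bar>) + (\<Sum>i\<in>{a<..<a+Suc m}. q ^ nat \<bar>int a - int i\<bar>)"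
    by (rule sum.union_disjoint) auto
  also have "(\<Sum>i<Suc a. q ^ nat \<bar>int a - int i\<bar>) = (\<Sum>i<Suc a. q ^ i)"
    by (rule sum.reindex_bij_witness[of _ "\<lambda>i. a - i" "\<lambda>i. a - i"]) (auto simp: nat_diff_distrib of_nat_diff intro!: arg_cong[where f = "\<lambda>n. q ^ n"])
  also have "(\<Sum>i\<in>{a<..<a+Suc m}. q ^ nat \<bar>int a - int i\<bar>) = (\<Sum>i<m. q * q ^ i)"
    by (rule sum.reindex_bij_witness[of _ "\<lambda>i. a + Suc i" "\<lambda>i. i - Suc a"])
       (auto simp flip: power_Suc intro!: arg_cong[where f = "\<lambda>n. q ^ n"])
  also have "\<dots> = q * (\<Sum>i<m. q ^ i)" by (simp add: sum_distrib_left)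
  also have "(\<Sum>i<Suc a. q ^ i) + q * (\<Sum>i<m. q ^ i) \<le> 1 / (1 - q) + q * (1 / (1 - q))"
    using q by (intro add_mono mult_left_mono geo) auto
  also have "\<dots> = (1 + q) / (1 - q)" by (simp add: add_divide_distrib)
  finally show ?thesis .
qed

text \<open>The coordinates are those scaled by \<open>sqrt L\<close>; at spacing 4 neighbouring
  kernels have an inner product of modulus only \<open>exp (- 8)\<close>.\<close>

definition grid_point :: "complex \<Rightarrow> nat \<times> nat \<Rightarrow> complex" where
  "grid_point \<xi> j = \<xi> + 4 * Complex (real (fst j)) (real (snd j))"

text \<open>Integer squares dominate absolute values and \<open>exp (- 8) \<le> 1/256\<close>, so
  the full row is at most the product of two two-sided geometric sums, (257/255)^2. Removing the
  diagonal entry 1 leaves less than 1/2.\<close>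

lemma grid_row_sum_le:
  assumes j: "j \<in> {..<m} \<times> {..<m}"
  shows "(\<Sum>k\<in>{..<m} \<times> {..<m} - {j}. exp (- (norm (grid_point \<xi> j - grid_point \<xi> k))\<^sup>2 / 2)) \<le> 1/2"
proof -
  obtain a b where ab: "j = (a, b)" by fastforce
  let ?h = "\<lambda>k. exp (- (norm (grid_point \<xi> j - grid_point \<xi> k))\<^sup>2 / 2)"
  let ?q = "1/256 :: real"
  let ?d = "\<lambda>a i. nat \<bar>int a - int i\<bar>"
  have e: "exp (- 8 * (real a - real i)\<^sup>2) \<le> ?q ^ ?d a i" for a i
  proof -
    have d: "\<bar>real a - real i\<bar> = real (?d a i)" by linarith
    have "(real a - real i)\<^sup>2 = (real (?d a i))\<^sup>2" by (metis d power2_abs)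
    also have "\<dots> \<ge> real (?d a i)"
      by (metis of_nat_mono of_nat_power power2_nat_le_imp_le le_square power2_eq_square)
    finally have "exp (- 8 * (real a - real i)\<^sup>2) \<le> exp (real (?d a i) * - 8)" by simp
    also have "\<dots> = exp (- 8) ^ ?d a i" by (rule exp_of_nat_mult)
    also have "\<dots> \<le> ?q ^ ?d a i"
    proof (rule power_mono)
      have "(256::real) = 2 ^ 8" by simp
      also have "\<dots> \<le> exp 1 ^ 8" using exp_ge_add_one_self[of 1] by (intro power_mono) auto
      also have "\<dots> = exp 8" by (simp add: exp_of_nat_mult[symmetric])
      finally show "exp (- 8) \<le> ?q" by (simp add: exp_minus field_simps)
    qed simp
    finally show ?thesis .
  qed
  have h: "?h (i, k) \<le> ?q ^ ?d a i * ?q ^ ?d b k" for i k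
  proof -
    have "(norm (grid_point \<xi> j - grid_point \<xi> (i, k)))\<^sup>2 = 16 * (real a - real i)\<^sup>2 + 16 * (real b - real k)\<^sup>2"
      unfolding cmod_power2 grid_point_def ab by (simp add: power2_eq_square algebra_simps)
    hence "?h (i, k) = exp (- 8 * (real a - real i)\<^sup>2) * exp (- 8 * (real b - real k)\<^sup>2)"
      by (simp add: exp_add[symmetric])
    also have "\<dots> \<le> ?q ^ ?d a i * ?q ^ ?d b k" by (intro mult_mono e) auto
    finally show ?thesis .
  qed
  have "(\<Sum>k\<in>{..<m} \<times> {..<m} - {j}. ?h k) + ?h j = (\<Sum>k\<in>{..<m} \<times> {..<m}. ?h k)"
    using j by (subst sum.remove[of _ j]) auto
  also have "\<dots> = (\<Sum>i<m. \<Sum>k<m. ?h (i, k))" by (simp add: sum.cartesian_product)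
  also have "\<dots> \<le> (\<Sum>i<m. \<Sum>k<m. ?q ^ ?d a i * ?q ^ ?d b k)" by (intro sum_mono h)
  also have "\<dots> = (\<Sum>i<m. ?q ^ ?d a i) * (\<Sum>k<m. ?q ^ ?d b k)" by (simp only: sum_product)
  also have "\<dots> \<le> ((1 + ?q) / (1 - ?q)) * ((1 + ?q) / (1 - ?q))"
    by (intro mult_mono sum_power_dist_le sum_nonneg) auto
  also have "\<dots> \<le> 3/2" by simp
  finally show ?thesis by simp
qed

lemma (in gef_coefficients) prob_all_small:
  fixes \<xi> :: complex and m :: nat
  assumes \<tau>: "\<tau> > 0"
  defines "X \<equiv> \<lambda>\<omega> j. Re (\<Sum>n. \<zeta> n \<omega> * fock_basis (grid_point \<xi> j) n)"
  shows "{\<omega>\<in>space M. \<forall>j\<in>{..<m} \<times> {..<m}. \<bar>X \<omega> j\<bar> \<le> \<tau>} \<in> sets M"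
    and "prob {\<omega>\<in>space M. \<forall>j\<in>{..<m} \<times> {..<m}. \<bar>X \<omega> j\<bar> \<le> \<tau>} \<le> (4 * \<tau>) ^ (m * m)"
proof -
  have conv: "AE \<omega> in M. \<forall>j\<in>{..<m} \<times> {..<m}. summable (\<lambda>n. \<zeta> n \<omega> * fock_basis (grid_point \<xi> j) n)"
    using AE_gef_conv by eventually_elim (intro ballI gef_series_fock_basis)
  note S = small_ball[OF _ conv fock_basis_coercive[OF _ grid_row_sum_le] \<tau>]
  show "{\<omega>\<in>space M. \<forall>j\<in>{..<m} \<times> {..<m}. \<bar>X \<omega> j\<bar> \<le> \<tau>} \<in> sets M"
    unfolding X_def by (rule S(1)) auto
  have "prob {\<omega>\<in>space M. \<forall>j\<in>{..<m} \<times> {..<m}. \<bar>X \<omega> j\<bar> \<le> \<tau>} \<le> (4 * \<tau>) ^ card ({..<m} \<times> {..<m})"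
    unfolding X_def by (rule S(2)) auto
  thus "prob {\<omega>\<in>space M. \<forall>j\<in>{..<m} \<times> {..<m}. \<bar>X \<omega> j\<bar> \<le> \<tau>} \<le> (4 * \<tau>) ^ (m * m)"
    by (simp add: card_cartesian_product)
qed

section \<open>Simplicity of the zeros\<close>

text \<open>The derivative is given by its coefficients: it is then visibly measurable in
  \<open>x\<close> and does not depend on the constant coefficient.\<close>

definition gef_dseries :: "(nat \<Rightarrow> complex) \<Rightarrow> complex \<Rightarrow> complex" where
  "gef_dseries x z = (\<Sum>n. diffs (gef_coeff x) n * z ^ n)"

lemma gef_dseries_DERIV:
  assumes "gef_conv x"
  shows "(gef_dseries x has_field_derivative (\<Sum>n. diffs (diffs (gef_coeff x)) n * z ^ n)) (at z)"
proof -
  have "summable (\<lambda>n. gef_coeff x n * y ^ n)" for y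
    using summable_norm_cancel[OF gef_conv_summable_norm[OF assms, of y]] by (simp add: gef_coeff_def)
  hence "summable (\<lambda>n. diffs (gef_coeff x) n * y ^ n)" for y
    using termdiff_converges_all[of "gef_coeff x" y] by blast
  from termdiffs_strong_converges_everywhere[OF this] show ?thesis
    by (simp add: gef_dseries_def[abs_def])
qed

lemma holomorphic_gef_dseries:
  assumes "gef_conv x"
  shows "gef_dseries x holomorphic_on A"
  unfolding holomorphic_on_def field_differentiable_def
  using has_field_derivative_at_within[OF gef_dseries_DERIV[OF assms]] by blast

lemma gef_dseries_case_nat: "gef_dseries (case_nat s x) = gef_dseries (case_nat 0 x)"
  by (simp add: gef_dseries_def fun_eq_iff diffs_def gef_coeff_def)

lemma gef_series_case_nat:
  assumes "gef_conv (case_nat s x)"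
  shows "gef_series (case_nat s x) z = s + (\<Sum>n. x n * (z ^ Suc n / complex_of_real (sqrt (fact (Suc n)))))"
  using suminf_split_head[OF summable_norm_cancel[OF gef_conv_summable_norm[OF assms, of z]]]
  by (simp add: gef_series_def)

definition double_zero :: "(nat \<Rightarrow> complex) \<Rightarrow> bool" where
  "double_zero x \<longleftrightarrow> gef_conv x \<and> (\<exists>z. gef_series x z = 0 \<and> gef_dseries x z = 0)"

text \<open>A double zero of \<open>s + G\<close> forces \<open>- s\<close> to be a critical value of \<open>G\<close>.\<close>

lemma countable_double_zero:
  assumes "x 0 \<noteq> 0"
  shows "countable {s. double_zero (case_nat s x)}"
proof (cases "\<exists>s. gef_conv (case_nat s x)")
  case False
  thus ?thesis by (simp add: double_zero_def)
next
  case True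
  then obtain s0 where s0: "gef_conv (case_nat s0 x)" by blast
  define D where "D = gef_dseries (case_nat 0 x)"
  define T where "T z = (\<Sum>n. x n * (z ^ Suc n / complex_of_real (sqrt (fact (Suc n)))))" for z
  have hol: "D holomorphic_on UNIV"
    using holomorphic_gef_dseries[OF s0, of UNIV] gef_dseries_case_nat[of s0 x] by (simp add: D_def)
  \<comment> \<open>\<open>x 0\<close> is the linear coefficient of the series. If it is nonzero,
    the derivative does not vanish identically and has countably many zeros.\<close>
  have D0: "D 0 \<noteq> 0"
  proof -
    have "D 0 = diffs (gef_coeff (case_nat 0 x)) 0" unfolding D_def gef_dseries_def by (rule powser_zero)
    thus ?thesis using assms by (simp add: diffs_def gef_coeff_def)
  qed
  have cz: "countable {z. D z = 0}"
  proof (rule ccontr)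
    assume "\<not> countable {z. D z = 0}"
    hence "D = (\<lambda>_. 0)" by (rule holomorphic_countable_equal_UNIV[OF hol holomorphic_on_const])
    thus False using D0 by simp
  qed
  have "{s. double_zero (case_nat s x)} \<subseteq> (\<lambda>z. - T z) ` {z. D z = 0}"
  proof
    fix s assume "s \<in> {s. double_zero (case_nat s x)}"
    then obtain z where z: "gef_conv (case_nat s x)" "gef_series (case_nat s x) z = 0" "gef_dseries (case_nat s x) z = 0"
      by (auto simp: double_zero_def)
    have "s + T z = 0" using gef_series_case_nat[OF z(1), of z] z(2) by (simp add: T_def)
    moreover have "D z = 0" using z(3) gef_dseries_case_nat[of s x] by (simp add: D_def)
    ultimately show "s \<in> (\<lambda>z. - T z) ` {z. D z = 0}" by (auto simp: add_eq_0_iff2)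
  qed
  thus ?thesis using cz countable_image countable_subset by blast
qed

section \<open>Measurability and almost sure absence of double zeros\<close>

definition rat_point :: "rat \<times> rat \<Rightarrow> complex" where
  "rat_point r = Complex (of_rat (fst r)) (of_rat (snd r))"

lemma rat_point_dense:
  assumes "e > 0"
  shows "\<exists>r. norm (rat_point r - z) < e"
proof -
  obtain a where a: "Re z < of_rat a" "of_rat a < Re z + e / 2" using of_rat_dense[of "Re z" "Re z + e/2"] assms by auto
  obtain b where b: "Im z < of_rat b" "of_rat b < Im z + e / 2" using of_rat_dense[of "Im z" "Im z + e/2"] assms by auto
  have "norm (rat_point (a, b) - z) \<le> \<bar>of_rat a - Re z\<bar> + \<bar>of_rat b - Im z\<bar>"
    using cmod_le[of "rat_point (a, b) - z"] by (simp add: rat_point_def)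
  also have "\<dots> < e" using a b by linarith
  finally show ?thesis by blast
qed

text \<open>Existence of a common zero ranges over an uncountable set. By continuity and compactness
  of closed discs it amounts to approximate vanishing at rational points of a bounded region; this
  form has countable quantifiers only, hence is measurable.\<close>

lemma double_zero_iff:
  "double_zero x \<longleftrightarrow> gef_conv x \<and> (\<exists>R::nat. \<forall>k::nat. \<exists>r. norm (rat_point r) \<le> real R \<and>
     norm (gef_series x (rat_point r)) + norm (gef_dseries x (rat_point r)) < 1 / real (Suc k))"
proof (cases "gef_conv x")
  case False
  thus ?thesis by (simp add: double_zero_def)
next
  case True
  define h where "h z = norm (gef_series x z) + norm (gef_dseries x z)" for z
  have cont: "continuous_on A h" for A
    unfolding h_def
    by (intro continuous_intros holomorphic_on_imp_continuous_on holomorphic_gef_series holomorphic_gef_dseries True)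
  have "(\<exists>z. h z = 0) \<longleftrightarrow> (\<exists>R::nat. \<forall>k::nat. \<exists>r. norm (rat_point r) \<le> real R \<and> h (rat_point r) < 1 / real (Suc k))"
  proof
    assume "\<exists>z. h z = 0"
    then obtain z where z: "h z = 0" by blast
    obtain R :: nat where R: "norm z + 1 \<le> real R" using real_arch_simple by blast
    have "\<exists>r. norm (rat_point r) \<le> real R \<and> h (rat_point r) < 1 / real (Suc k)" for k :: nat
    proof -
      have "isCont h z" using cont[of UNIV] by (simp add: continuous_on_eq_continuous_at)
      then obtain d where d: "d > 0" "\<And>y. dist y z < d \<Longrightarrow> dist (h y) (h z) < 1 / real (Suc k)"
        unfolding continuous_at_eps_delta by (metis of_nat_0_less_iff zero_less_Suc zero_less_divide_1_iff)
      obtain r where r: "norm (rat_point r - z) < min d 1" using rat_point_dense[of "min d 1" z] d by auto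
      define q where "q = rat_point r"
      note q = r[folded q_def]
      have "norm q \<le> norm z + norm (q - z)" by norm
      hence "norm q \<le> real R" using q R by linarith
      moreover have "h q < 1 / real (Suc k)" using d(2)[of q] q z by (simp add: dist_norm)
      ultimately show ?thesis unfolding q_def by blast
    qed
    thus "\<exists>R::nat. \<forall>k::nat. \<exists>r. norm (rat_point r) \<le> real R \<and> h (rat_point r) < 1 / real (Suc k)" by blast
  next
    assume "\<exists>R::nat. \<forall>k::nat. \<exists>r. norm (rat_point r) \<le> real R \<and> h (rat_point r) < 1 / real (Suc k)"
    then obtain R :: nat where R: "\<And>k::nat. \<exists>r. norm (rat_point r) \<le> real R \<and> h (rat_point r) < 1 / real (Suc k)" by blast
    have "compact (cball (0::complex) (real R))" "cball (0::complex) (real R) \<noteq> {}" by auto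
    from continuous_attains_inf[OF this cont] obtain z where z: "\<And>y. y \<in> cball 0 (real R) \<Longrightarrow> h z \<le> h y" by blast
    have "h z \<le> 1 / real (Suc k)" for k
    proof -
      obtain r where "norm (rat_point r) \<le> real R" "h (rat_point r) < 1 / real (Suc k)" using R[of k] by blast
      thus ?thesis using z[of "rat_point r"] by simp
    qed
    moreover have "(\<lambda>k. 1 / real (Suc k)) \<longlonglongrightarrow> 0" by (rule LIMSEQ_Suc[OF lim_1_over_n])
    ultimately have "h z \<le> 0" by (intro LIMSEQ_le_const[of "\<lambda>k. 1 / real (Suc k)"]) auto
    moreover have "h z \<ge> 0" by (simp add: h_def)
    ultimately show "\<exists>z. h z = 0" by (intro exI[of _ z]) simp
  qed
  moreover have "(\<exists>z. h z = 0) \<longleftrightarrow> (\<exists>z. gef_series x z = 0 \<and> gef_dseries x z = 0)"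
    by (simp add: h_def add_nonneg_eq_0_iff)
  ultimately show ?thesis using True by (simp add: double_zero_def h_def)
qed

lemma summable_iff_suminf_ennreal:
  fixes f :: "nat \<Rightarrow> real"
  assumes "\<And>n. f n \<ge> 0"
  shows "summable f \<longleftrightarrow> (\<Sum>n. ennreal (f n)) \<noteq> \<top>"
proof
  assume "summable f"
  from suminf_ennreal2[OF assms this] show "(\<Sum>n. ennreal (f n)) \<noteq> \<top>" by simp
qed (use assms summable_suminf_not_top in auto)

abbreviation seq_space :: "(nat \<Rightarrow> complex) measure" where
  "seq_space \<equiv> PiM UNIV (\<lambda>_. borel)"

lemma pred_double_zero: "Measurable.pred seq_space double_zero"
proof -
  have [measurable]: "(\<lambda>x. x n) \<in> borel_measurable seq_space" for n :: nat by measurable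
  have [measurable]: "Measurable.pred seq_space gef_conv"
    unfolding gef_conv_def by (subst summable_iff_suminf_ennreal) (simp, measurable)
  have [measurable]: "(\<lambda>x. gef_series x q) \<in> borel_measurable seq_space" for q
    unfolding gef_series_def by measurable
  have [measurable]: "(\<lambda>x. gef_dseries x q) \<in> borel_measurable seq_space" for q
    unfolding gef_dseries_def diffs_def gef_coeff_def by measurable
  show ?thesis unfolding double_zero_iff by measurable
qed

definition std_complex_normal_measure :: "complex measure" where
  "std_complex_normal_measure = density lborel (\<lambda>z. ennreal (exp (- (norm z)\<^sup>2) / pi))"

lemma AE_std_complex_normal_countable:
  assumes "countable B"
  shows "AE s in std_complex_normal_measure. s \<notin> B"
proof -
  have "(\<lambda>z::complex. ennreal (exp (- (norm z)\<^sup>2) / pi)) \<in> borel_measurable lborel" by measurable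
  from AE_density[OF this] show ?thesis
    unfolding std_complex_normal_measure_def
    using AE_not_in[OF countable_imp_null_set_lborel[OF assms]] by auto
qed

text \<open>With the other coefficients fixed, the constant coefficient has a density and avoids the
  countable set of bad values. Fubini's theorem on sequence space turns this into an almost sure
  statement.\<close>

lemma (in gef_coefficients) AE_not_double_zero: "AE \<omega> in M. \<not> double_zero (\<lambda>n. \<zeta> n \<omega>)"
proof -
  let ?N = "std_complex_normal_measure"
  have dN: "distr M borel (\<zeta> n) = ?N" for n
    using distributed_distr_eq_density[OF std_complex_normal, of n]
    by (simp add: std_complex_normal_measure_def distr_cong[of M M borel lborel])
  have sN [measurable_cong]: "sets ?N = sets borel" by (simp add: std_complex_normal_measure_def)
  interpret N: prob_space ?N unfolding dN[of 0, symmetric] by (rule prob_space_distr) measurable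
  interpret S: sequence_space ?N ..
  have sS [measurable_cong]: "sets S.S = sets seq_space" by (rule sets_PiM_cong) (simp_all add: sN)
  have law: "distr M seq_space (\<lambda>\<omega> n. \<zeta> n \<omega>) = S.S"
    using indep_vars_iff_distr_eq_PiM[of "UNIV :: nat set" \<zeta> "\<lambda>_. borel"] indep by (simp add: dN restrict_def)
  note pred_double_zero [measurable]
  have "AE x in S.S. \<not> double_zero x"
  proof -
    interpret P: pair_sigma_finite ?N S.S ..
    have m [measurable]: "(\<lambda>(s, \<omega>). case_nat s \<omega>) \<in> measurable (?N \<Otimes>\<^sub>M S.S) S.S" by measurable
    have "AE \<omega> in S.S. \<omega> 0 \<noteq> 0"
      using S.AE_component[of 0 "\<lambda>s. s \<noteq> 0"] AE_std_complex_normal_countable[of "{0}"] by simp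
    hence "AE \<omega> in S.S. AE s in ?N. \<not> double_zero (case_nat s \<omega>)"
    proof eventually_elim
      case (elim \<omega>)
      show ?case using AE_std_complex_normal_countable[OF countable_double_zero[of \<omega>, OF elim]] by simp
    qed
    moreover have pm: "{x \<in> space (?N \<Otimes>\<^sub>M S.S). \<not> double_zero (case_nat (fst x) (snd x))} \<in> sets (?N \<Otimes>\<^sub>M S.S)"
      by measurable
    ultimately have "AE s in ?N. AE \<omega> in S.S. \<not> double_zero (case_nat s \<omega>)"
      using P.AE_commute[of "\<lambda>s \<omega>. \<not> double_zero (case_nat s \<omega>)"] by simp
    hence "AE x in ?N \<Otimes>\<^sub>M S.S. \<not> double_zero (case_nat (fst x) (snd x))"
      using P.AE_pair_measure[OF pm] by simp
    hence "AE x in distr (?N \<Otimes>\<^sub>M S.S) S.S (\<lambda>(s, \<omega>). case_nat s \<omega>). \<not> double_zero x"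
      by (subst AE_distr_iff[OF m]) (measurable, simp add: case_prod_beta)
    \<comment> \<open>Prepending an independent coordinate reproduces the law of the i.i.d.
      sequence.\<close>
    thus ?thesis by (simp only: S.PiM_iter)
  qed
  hence "AE x in distr M seq_space (\<lambda>\<omega> n. \<zeta> n \<omega>). \<not> double_zero x" by (simp only: law)
  moreover have "(\<lambda>\<omega> n. \<zeta> n \<omega>) \<in> measurable M seq_space"
    by (rule measurable_PiM_single') (auto simp: space_PiM)
  moreover have "{x \<in> space seq_space. \<not> double_zero x} \<in> sets seq_space" by measurable
  ultimately show ?thesis by (simp only: AE_distr_iff)
qed

section \<open>Zero counts in small discs\<close>

text \<open>The thresholds of \<open>local_event\<close>, with \<delta> =
  \<open>\<eta>\<^sup>2 / 100\<close>: the growth of \<open>k ^ k\<close> in the moment bound, the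
  factor 4 of the small ball estimate, and the rounding of the grid size.\<close>

definition large_intensity :: "real \<Rightarrow> real \<Rightarrow> bool" where
  "large_intensity \<eta> L \<longleftrightarrow> L \<ge> 1 \<and> ln (L + 1) \<le> \<eta>\<^sup>2 / 400 * L \<and> 4 \<le> exp (\<eta>\<^sup>2 / 200 * L) \<and>
     sqrt L * \<eta> / 720 - 1 \<ge> sqrt L * \<eta> / 1440"

lemma eventually_large_intensity:
  assumes "\<eta> > 0"
  shows "eventually (large_intensity \<eta>) at_top"
proof -
  have "eventually (\<lambda>L::real. L \<ge> 1) at_top" by (rule eventually_ge_at_top)
  moreover have "eventually (\<lambda>L::real. ln (L + 1) \<le> \<eta>\<^sup>2 / 400 * L) at_top" using assms by real_asymp
  moreover have "eventually (\<lambda>L::real. 4 \<le> exp (\<eta>\<^sup>2 / 200 * L)) at_top" using assms by real_asymp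
  moreover have "eventually (\<lambda>L::real. sqrt L * \<eta> / 720 - 1 \<ge> sqrt L * \<eta> / 1440) at_top" using assms by real_asymp
  ultimately show ?thesis by eventually_elim (simp add: large_intensity_def)
qed

lemma norm_grid_point_diff_le:
  assumes "j \<in> {..<m} \<times> {..<m}"
  shows "norm (grid_point \<xi> j - \<xi>) \<le> 8 * real m"
proof -
  have "norm (grid_point \<xi> j - \<xi>) = 4 * norm (Complex (real (fst j)) (real (snd j)))"
    by (simp add: grid_point_def norm_mult)
  also have "norm (Complex (real (fst j)) (real (snd j))) \<le> real (fst j) + real (snd j)"
    using cmod_le[of "Complex (real (fst j)) (real (snd j))"] by simp
  also have "\<dots> \<le> 2 * real m" using assms by auto
  finally show ?thesis by simp
qed

text \<open>The number of samples at which all values are tiny is of order \<open>L\<close>, and each contributes a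
  factor \<open>exp (- \<delta> L)\<close>; the moment of order \<open>L\<close> controls the maximum. Both probabilities are
  therefore of order \<open>exp (- \<kappa> L\<^sup>2)\<close>.\<close>

lemma (in gef_coefficients) local_event:
  fixes w :: complex
  assumes \<eta>: "0 < \<eta>" "\<eta> \<le> 1" and L: "large_intensity \<eta> L"
  defines "u \<equiv> \<lambda>\<omega> z. fock_abs (gef_series (\<lambda>n. \<zeta> n \<omega>)) (of_real (sqrt L) * z)"
  shows "\<exists>E\<in>sets M. prob E \<le> 17 * exp (- (\<eta>^4 / (400 * 1440\<^sup>2)) * L\<^sup>2) \<and>
    (\<forall>\<omega>\<in>space M - E. gef_conv (\<lambda>n. \<zeta> n \<omega>) \<longrightarrow>
       (\<forall>t. norm t \<le> \<eta> / 20 \<longrightarrow> u \<omega> (w + t) \<le> exp (\<eta>\<^sup>2 / 100 * L)) \<and>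
       (\<exists>t. norm t \<le> \<eta> / 90 \<and> exp (- (\<eta>\<^sup>2 / 100 * L)) \<le> u \<omega> (w + t)))"
proof -
  define \<delta> where "\<delta> = \<eta>\<^sup>2 / 100"
  have \<delta>: "\<delta> > 0" using \<eta> by (simp add: \<delta>_def)
  have L1: "L \<ge> 1" "ln (L + 1) \<le> \<delta> / 4 * L" "4 \<le> exp (\<delta> / 2 * L)" "sqrt L * \<eta> / 720 - 1 \<ge> sqrt L * \<eta> / 1440"
    using L by (auto simp: large_intensity_def \<delta>_def)
  have sL: "sqrt L > 0" "(sqrt L)\<^sup>2 = L" using L1 by simp_all
  define \<xi> where "\<xi> = of_real (sqrt L) * w"
  define k where "k = nat \<lceil>L\<rceil>"
  have k: "real k \<ge> L" "real k \<le> L + 1" "k \<ge> 1" using L1(1) unfolding k_def by linarith+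
  \<comment> \<open>\<open>l\<close> and \<open>r\<close> are matched: \<open>r\<close> is twice the
    radius \<open>\<eta> / 20\<close> in scaled coordinates, so that
    \<open>r\<^sup>2 = \<delta> * L\<close>, and then
    \<open>2 * exp (real k * r\<^sup>2 / 2) * l\<close> equals
    \<open>exp (\<delta> * L) ^ k\<close>.\<close>
  define l where "l = exp (real k * \<delta> * L / 2) / 2"
  have l: "l > 0" by (simp add: l_def)
  define r where "r = 2 * (\<eta> / 20) * sqrt L"
  have r: "r > 0" using \<eta> sL by (simp add: r_def)
  have r2: "r\<^sup>2 = \<delta> * L" using sL by (simp add: r_def \<delta>_def power_mult_distrib power_divide)
  define E1 where "E1 = {\<omega>\<in>space M. (\<integral>\<^sup>+\<theta>. ennreal (fock_abs (gef_series (\<lambda>n. \<zeta> n \<omega>)) (\<xi> + of_real r * circ \<theta>) ^ k) \<partial>unit_interval) \<ge> ennreal l}"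
  have E1: "E1 \<in> sets M" "prob E1 \<le> 8 * fact k / l"
    unfolding E1_def by (rule prob_circle_mean_ge[OF l])+
  \<comment> \<open>The grid reaches at most \<open>8 * real m\<close> from its corner; with 720 = 8
    * 90 it stays in the disc of radius \<open>\<eta> / 90\<close> in the original
    coordinates.\<close>
  define m where "m = nat \<lfloor>sqrt L * \<eta> / 720\<rfloor>"
  have m: "real m \<le> sqrt L * \<eta> / 720" "real m \<ge> sqrt L * \<eta> / 1440"
    using L1(4) sL \<eta> mult_pos_pos[OF sL(1) \<eta>(1)] unfolding m_def by linarith+
  define \<tau> where "\<tau> = exp (- \<delta> * L)"
  have \<tau>: "\<tau> > 0" by (simp add: \<tau>_def)
  define E2 where "E2 = {\<omega>\<in>space M. \<forall>j\<in>{..<m} \<times> {..<m}. \<bar>Re (\<Sum>n. \<zeta> n \<omega> * fock_basis (grid_point \<xi> j) n)\<bar> \<le> \<tau>}"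
  have E2: "E2 \<in> sets M" "prob E2 \<le> (4 * \<tau>) ^ (m * m)"
    unfolding E2_def by (rule prob_all_small[OF \<tau>])+
  have p1: "prob E1 \<le> 16 * exp (- (\<delta> / 4) * L\<^sup>2)"
  proof -
    have "(fact k :: real) \<le> real k ^ k" using fact_le_power[of k, where 'a = real] by simp
    also have "\<dots> = exp (real k * ln (real k))" using k by (simp add: exp_of_nat_mult)
    also have "ln (real k) \<le> \<delta> / 4 * L" using k L1(1,2) ln_mono[of "real k" "L + 1"] by linarith
    finally have fk: "(fact k :: real) \<le> exp (real k * (\<delta> / 4 * L))"
      by (simp add: mult_left_mono)
    have "8 * fact k / l = 16 * fact k * exp (- (real k * \<delta> * L / 2))"
      by (simp add: l_def exp_minus field_simps)
    also have "\<dots> \<le> 16 * exp (real k * (\<delta> / 4 * L)) * exp (- (real k * \<delta> * L / 2))"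
      using fk by (intro mult_right_mono mult_left_mono) auto
    also have "\<dots> = 16 * exp (- (\<delta> / 4) * (real k * L))"
      by (simp add: mult.assoc exp_add[symmetric] algebra_simps)
    also have "\<dots> \<le> 16 * exp (- (\<delta> / 4) * L\<^sup>2)"
    proof -
      have "L\<^sup>2 \<le> real k * L" using k L1 by (simp add: power2_eq_square mult_right_mono)
      thus ?thesis using \<delta> by (simp add: mult_left_mono)
    qed
    finally show ?thesis using E1 by linarith
  qed
  have p2: "prob E2 \<le> exp (- (\<delta> * \<eta>\<^sup>2 / (4 * 1440\<^sup>2)) * L\<^sup>2)"
  proof -
    have "4 * \<tau> \<le> exp (\<delta> / 2 * L) * \<tau>" using L1(3) \<tau> by (intro mult_right_mono) auto
    also have "\<dots> = exp (- (\<delta> / 2) * L)" by (simp add: \<tau>_def exp_add[symmetric] algebra_simps)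
    finally have "(4 * \<tau>) ^ (m * m) \<le> exp (- (\<delta> / 2) * L) ^ (m * m)" using \<tau> by (intro power_mono) auto
    also have "\<dots> = exp (- (\<delta> / 2) * L * (real m * real m))"
      by (simp add: exp_of_nat_mult[symmetric] algebra_simps)
    also have "\<dots> \<le> exp (- (\<delta> * \<eta>\<^sup>2 / (4 * 1440\<^sup>2)) * L\<^sup>2)"
    proof -
      have "(sqrt L * \<eta> / 1440) * (sqrt L * \<eta> / 1440) \<le> real m * real m"
        using m sL \<eta> by (intro mult_mono) auto
      moreover have "(sqrt L * \<eta> / 1440) * (sqrt L * \<eta> / 1440) = L * \<eta>\<^sup>2 / 1440\<^sup>2"
        using sL by (simp add: power2_eq_square)
      ultimately have mm: "L * \<eta>\<^sup>2 / 1440\<^sup>2 \<le> real m * real m" by simp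
      have "(\<delta> * \<eta>\<^sup>2 / (4 * 1440\<^sup>2)) * L\<^sup>2 \<le> (\<delta> / 2) * L * (L * \<eta>\<^sup>2 / 1440\<^sup>2)"
        using \<delta> L1(1) by (simp add: power2_eq_square field_simps)
      also have "\<dots> \<le> (\<delta> / 2) * L * (real m * real m)"
        using mm \<delta> L1(1) by (intro mult_left_mono) auto
      finally show ?thesis by simp
    qed
    finally show ?thesis using E2 by linarith
  qed
  have kap: "\<delta> * \<eta>\<^sup>2 / (4 * 1440\<^sup>2) = \<eta>^4 / (400 * 1440\<^sup>2)"
    by (simp add: \<delta>_def power2_eq_square power4_eq_xxxx)
  show ?thesis
  proof (intro bexI[of _ "E1 \<union> E2"] conjI ballI impI allI)
    show "E1 \<union> E2 \<in> sets M" using E1 E2 by blast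
    have "prob (E1 \<union> E2) \<le> prob E1 + prob E2" by (rule measure_Un_le[OF E1(1) E2(1)])
    also have "prob E1 \<le> 16 * exp (- (\<eta>^4 / (400 * 1440\<^sup>2)) * L\<^sup>2)"
    proof -
      have "\<eta>\<^sup>2 \<le> 1" using \<eta> by (simp add: power_le_one)
      hence "\<delta> * \<eta>\<^sup>2 / (4 * 1440\<^sup>2) \<le> \<delta> / 4" using \<delta> by (simp add: field_simps)
      hence "(\<eta>^4 / (400 * 1440\<^sup>2)) * L\<^sup>2 \<le> (\<delta> / 4) * L\<^sup>2" unfolding kap[symmetric] by (intro mult_right_mono) auto
      thus ?thesis using p1 by (smt (verit) exp_le_cancel_iff mult_minus_left)
    qed
    finally show "prob (E1 \<union> E2) \<le> 17 * exp (- (\<eta>^4 / (400 * 1440\<^sup>2)) * L\<^sup>2)"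
      using p2 unfolding kap by simp
  next
    fix \<omega> t assume \<omega>: "\<omega> \<in> space M - (E1 \<union> E2)" and c: "gef_conv (\<lambda>n. \<zeta> n \<omega>)" and t: "norm (t::complex) \<le> \<eta> / 20"
    have "u \<omega> (w + t) ^ k \<le> 2 * exp (real k * r\<^sup>2 / 2) * l"
      unfolding u_def distrib_left \<xi>_def[symmetric]
    proof (rule fock_abs_power_le_circle[OF holomorphic_gef_series[OF c] _ r])
      show "norm (of_real (sqrt L) * t) \<le> r / 2"
        using t sL by (simp add: norm_mult r_def mult.commute mult_right_mono)
    qed (use \<omega> l in \<open>auto simp: E1_def\<close>)
    also have "\<dots> = exp (\<delta> * L) ^ k"
      unfolding r2 l_def by (simp add: exp_of_nat_mult[symmetric] exp_add[symmetric] algebra_simps)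
    finally have "u \<omega> (w + t) \<le> exp (\<delta> * L)"
      using k by (subst (asm) power_mono_iff) (auto simp: u_def)
    thus "u \<omega> (w + t) \<le> exp (\<eta>\<^sup>2 / 100 * L)" by (simp add: \<delta>_def)
  next
    fix \<omega> assume \<omega>: "\<omega> \<in> space M - (E1 \<union> E2)" and c: "gef_conv (\<lambda>n. \<zeta> n \<omega>)"
    then obtain j where j: "j \<in> {..<m} \<times> {..<m}" "\<tau> < \<bar>Re (\<Sum>n. \<zeta> n \<omega> * fock_basis (grid_point \<xi> j) n)\<bar>"
      by (force simp: E2_def not_le)
    define t where "t = (grid_point \<xi> j - \<xi>) / of_real (sqrt L)"
    have gp: "of_real (sqrt L) * (w + t) = grid_point \<xi> j"
      using sL by (simp add: t_def \<xi>_def distrib_left)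
    have "\<tau> \<le> norm (\<Sum>n. \<zeta> n \<omega> * fock_basis (grid_point \<xi> j) n)"
      using j(2) abs_Re_le_cmod less_imp_le order_trans less_le_trans by blast
    hence "\<tau> \<le> u \<omega> (w + t)" unfolding u_def gp fock_abs_gef_series[OF c] .
    moreover have "norm t \<le> \<eta> / 90"
    proof -
      have "norm t = norm (grid_point \<xi> j - \<xi>) / sqrt L" using sL by (simp add: t_def norm_divide)
      also have "\<dots> \<le> 8 * (sqrt L * \<eta> / 720) / sqrt L"
      proof (rule divide_right_mono)
        show "norm (grid_point \<xi> j - \<xi>) \<le> 8 * (sqrt L * \<eta> / 720)"
          using norm_grid_point_diff_le[OF j(1), of \<xi>] m(1) by linarith
      qed (use sL in simp)
      also have "\<dots> = \<eta> / 90" using sL by simp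
      finally show ?thesis .
    qed
    ultimately show "\<exists>t. norm t \<le> \<eta> / 90 \<and> exp (- (\<eta>\<^sup>2 / 100 * L)) \<le> u \<omega> (w + t)"
      by (auto simp: \<tau>_def \<delta>_def)
  qed
qed


text \<open>Finiteness comes with the bound, so zeros need to be counted in finite subsets
  only.\<close>

lemma finite_card_le_if_finite_subsets:
  assumes "\<And>F. finite F \<Longrightarrow> F \<subseteq> S \<Longrightarrow> real (card F) \<le> B"
  shows "finite S" "real (card S) \<le> B"
proof -
  have "card F \<le> nat \<lfloor>B\<rfloor>" if "finite F" "F \<subseteq> S" for F
    using assms[OF that] by (simp add: le_nat_floor)
  thus "finite S" using finite_if_finite_subsets_card_bdd[of S "nat \<lfloor>B\<rfloor>"] by blast
  thus "real (card S) \<le> B" using assms by blast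
qed

text \<open>The twisted shift and the scaling by \<open>sqrt L\<close> move the disc to the origin.
  Zeros correspond, and the weight becomes \<open>exp (L * (norm t)\<^sup>2 / 2)\<close>, the
  situation of the deterministic counting lemmas.\<close>

lemma gef_zero_counts:
  fixes w :: complex and x :: "nat \<Rightarrow> complex"
  assumes conv: "gef_conv x" and nd: "\<not> double_zero x" and \<eta>: "0 < \<eta>" "\<eta> \<le> 1/10" and L: "L > 0"
  defines "u \<equiv> \<lambda>z. fock_abs (gef_series x) (of_real (sqrt L) * z)"
  assumes up: "\<And>t. norm t \<le> 1 \<Longrightarrow> u (w + t) \<le> exp (\<eta>\<^sup>2 / 100 * L)"
    and low: "\<And>y. norm y \<le> \<eta> \<Longrightarrow> \<exists>t. norm (t - y) \<le> \<eta> / 60 \<and> exp (- (\<eta>\<^sup>2 / 100 * L)) \<le> u (w + t)"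
  defines "Z \<equiv> {z. gef_series x (of_real (sqrt L) * z) = 0 \<and> dist z w < \<eta>}"
  shows "finite Z" "real (card Z) \<le> 20 * \<eta>\<^sup>2 * L" "\<eta>\<^sup>2 / 100 * L \<le> real (card Z)"
proof -
  have sL: "sqrt L > 0" "(sqrt L)\<^sup>2 = L" using L by simp_all
  define f where "f = gef_series x"
  define \<xi> where "\<xi> = of_real (sqrt L) * w"
  define G where "G t = fock_shift f \<xi> (of_real (sqrt L) * t)" for t
  have hol_f: "f holomorphic_on A" for A unfolding f_def by (rule holomorphic_gef_series[OF conv])
  have holG: "G holomorphic_on UNIV"
    unfolding G_def
    by (rule holomorphic_on_compose_gen[OF _ holomorphic_fock_shift[OF hol_f], of "\<lambda>t. of_real (sqrt L) * t" UNIV UNIV, unfolded o_def])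
       (intro holomorphic_intros, simp)
  have nG: "norm (G t) = u (w + t) * exp (L * ((norm t)\<^sup>2 / 2))" for t
    using sL by (simp add: G_def norm_fock_shift u_def f_def \<xi>_def distrib_left norm_mult power_mult_distrib)
  have G0: "G t = 0 \<longleftrightarrow> gef_series x (of_real (sqrt L) * (w + t)) = 0" for t
    by (simp add: G_def fock_shift_def f_def \<xi>_def distrib_left)
  define S where "S = {t. norm t < \<eta> \<and> G t = 0}"
  have ZS: "Z = (+) w ` S"
  proof -
    have "z \<in> Z \<Longrightarrow> z \<in> (+) w ` S" for z
      by (rule image_eqI[of _ _ "z - w"]) (auto simp: Z_def S_def G0 dist_norm)
    moreover have "t \<in> S \<Longrightarrow> w + t \<in> Z" for t by (auto simp: Z_def S_def G0 dist_norm)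
    ultimately show ?thesis by blast
  qed
  have cZ: "card Z = card S" unfolding ZS by (rule card_image) simp
  obtain z0 where z0: "norm z0 \<le> \<eta> / 60" "exp (- (\<eta>\<^sup>2 / 100 * L)) \<le> u (w + z0)" using low[of 0] \<eta> by auto
  have Gz0: "exp (- (\<eta>\<^sup>2 / 100 * L)) \<le> norm (G z0)"
  proof -
    have "u (w + z0) * 1 \<le> u (w + z0) * exp (L * ((norm z0)\<^sup>2 / 2))"
      using L by (intro mult_left_mono) (auto simp: u_def)
    thus ?thesis unfolding nG using z0(2) by linarith
  qed
  have bound: "real (card F) \<le> 20 * \<eta>\<^sup>2 * L" if F: "finite F" "F \<subseteq> S" for F
  proof -
    have "2 ^ card F * norm (G z0) \<le> exp (\<eta>\<^sup>2 / 100 * L) * exp (L * ((5 * \<eta>)\<^sup>2 / 2))"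
    proof (rule card_zeros_upper[OF holG \<eta>(1)])
      show "norm (G t) \<le> exp (\<eta>\<^sup>2 / 100 * L) * exp (L * ((5 * \<eta>)\<^sup>2 / 2))" if "norm t = 5 * \<eta>" for t
        unfolding nG that using up[of t] that \<eta> by (intro mult_right_mono) auto
    qed (use F z0 \<eta> in \<open>auto simp: S_def\<close>)
    hence "2 ^ card F * exp (- (\<eta>\<^sup>2 / 100 * L)) \<le> exp (\<eta>\<^sup>2 / 100 * L) * exp (L * ((5 * \<eta>)\<^sup>2 / 2))"
      using Gz0 by (meson mult_left_mono order_trans zero_le_numeral zero_le_power)
    hence "2 ^ card F \<le> exp (\<eta>\<^sup>2 / 100 * L) * exp (L * ((5 * \<eta>)\<^sup>2 / 2)) * exp (\<eta>\<^sup>2 / 100 * L)"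
      by (simp add: exp_minus field_simps)
    also have "\<dots> = exp (\<eta>\<^sup>2 / 100 * L + L * ((5 * \<eta>)\<^sup>2 / 2) + \<eta>\<^sup>2 / 100 * L)"
      by (simp only: exp_add)
    also have "\<eta>\<^sup>2 / 100 * L + L * ((5 * \<eta>)\<^sup>2 / 2) + \<eta>\<^sup>2 / 100 * L = 313/25 * (\<eta>\<^sup>2 * L)"
      by (simp add: power_mult_distrib field_simps)
    finally have "ln (2 ^ card F) \<le> 313/25 * (\<eta>\<^sup>2 * L)"
      using ln_le_cancel_iff[of "2 ^ card F" "exp (313/25 * (\<eta>\<^sup>2 * L))"] by simp
    \<comment> \<open>The exponent 313/25 is 2/100 + 25/2; divided by 2/3 it becomes 18.78, which is
      below 20.\<close>
    moreover have "real (card F) * (2/3) \<le> real (card F) * ln 2"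
      using ln2_ge_two_thirds by (intro mult_left_mono) auto
    moreover have "ln (2 ^ card F) = real (card F) * ln (2::real)" by (simp add: ln_realpow)
    moreover have "\<eta>\<^sup>2 * L \<ge> 0" using L by simp
    ultimately show ?thesis by linarith
  qed
  note fS = finite_card_le_if_finite_subsets[OF bound]
  show "finite Z" unfolding ZS using fS(1) by simp
  show "real (card Z) \<le> 20 * \<eta>\<^sup>2 * L" unfolding cZ by (rule fS(2))
  have "\<eta>\<^sup>2 / 100 * L \<le> real (card S)"
  proof (rule card_zeros_lower[OF holG \<eta>(1) L _ _ S_def fS(1)])
    show "norm (G t) \<le> exp (L * (\<eta>\<^sup>2 / 100 + (norm t)\<^sup>2 / 2))" if "norm t \<le> 2 * \<eta>" for t
    proof -
      have "norm (G t) \<le> exp (\<eta>\<^sup>2 / 100 * L) * exp (L * ((norm t)\<^sup>2 / 2))"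
        unfolding nG using up[of t] that \<eta> by (intro mult_right_mono) auto
      also have "\<dots> = exp (L * (\<eta>\<^sup>2 / 100 + (norm t)\<^sup>2 / 2))" by (simp add: exp_add[symmetric] algebra_simps)
      finally show ?thesis .
    qed
    show "\<exists>t. norm (t - y) \<le> \<eta> / 60 \<and> exp (L * ((norm t)\<^sup>2 / 2 - \<eta>\<^sup>2 / 100)) \<le> norm (G t)" if "norm y \<le> \<eta>" for y
    proof -
      obtain t where t: "norm (t - y) \<le> \<eta> / 60" "exp (- (\<eta>\<^sup>2 / 100 * L)) \<le> u (w + t)" using low[OF \<open>norm y \<le> \<eta>\<close>] by blast
      have "exp (L * ((norm t)\<^sup>2 / 2 - \<eta>\<^sup>2 / 100)) = exp (- (\<eta>\<^sup>2 / 100 * L)) * exp (L * ((norm t)\<^sup>2 / 2))"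
        by (simp add: exp_add[symmetric] algebra_simps)
      also have "\<dots> \<le> norm (G t)" unfolding nG using t(2) by (intro mult_right_mono) auto
      finally show ?thesis using t(1) by blast
    qed
    \<comment> \<open>At a zero only the derivative of the series survives in the product rule, so a
      multiple zero of \<open>G\<close> would be a double zero of the series.\<close>
    show "deriv G t \<noteq> 0" if "t \<in> S" for t
    proof
      assume d0: "deriv G t = 0"
      let ?s = "of_real (sqrt L) :: complex"
      have f0: "f (\<xi> + ?s * t) = 0" using that by (simp add: S_def G0 f_def \<xi>_def distrib_left)
      have "((\<lambda>t. f (\<xi> + ?s * t)) has_field_derivative gef_dseries x (\<xi> + ?s * t) * ?s) (at t)"
      proof (rule DERIV_chain2[of f])
        show "(f has_field_derivative gef_dseries x (\<xi> + ?s * t)) (at (\<xi> + ?s * t))"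
          unfolding f_def gef_dseries_def by (rule gef_series_DERIV[OF conv])
      qed (auto intro!: derivative_eq_intros)
      moreover have "((\<lambda>t. exp (- (?s * t * cnj \<xi>) - of_real ((norm \<xi>)\<^sup>2 / 2))) has_field_derivative
          exp (- (?s * t * cnj \<xi>) - of_real ((norm \<xi>)\<^sup>2 / 2)) * (- (?s * cnj \<xi>))) (at t)"
        by (auto intro!: derivative_eq_intros)
      note DERIV_mult[OF calculation this]
      hence "(G has_field_derivative gef_dseries x (\<xi> + ?s * t) * ?s * exp (- (?s * t * cnj \<xi>) - of_real ((norm \<xi>)\<^sup>2 / 2))) (at t)"
        unfolding G_def[abs_def] fock_shift_def f0 by simp
      hence "gef_dseries x (\<xi> + ?s * t) * ?s * exp (- (?s * t * cnj \<xi>) - of_real ((norm \<xi>)\<^sup>2 / 2)) = 0"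
        using d0 DERIV_imp_deriv by metis
      hence "gef_dseries x (\<xi> + ?s * t) = 0" using sL L by simp
      thus False using nd conv f0 by (auto simp: double_zero_def f_def)
    qed
  qed
  thus "\<eta>\<^sup>2 / 100 * L \<le> real (card Z)" unfolding cZ .
qed

section \<open>Nets and the union bound\<close>

definition net :: "real \<Rightarrow> nat \<Rightarrow> complex set" where
  "net h n = (\<lambda>(a, b). of_real h * Complex (real_of_int a) (real_of_int b)) ` ({- int n..int n} \<times> {- int n..int n})"

lemma finite_net: "finite (net h n)"
  by (simp add: net_def)

lemma card_net_le: "card (net h n) \<le> (2 * n + 1) * (2 * n + 1)"
proof -
  have "card (net h n) \<le> card ({- int n..int n} \<times> {- int n..int n})"
    unfolding net_def by (rule card_image_le) simp
  also have "\<dots> = (2 * n + 1) * (2 * n + 1)"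
  proof -
    have "nat (int n - - int n + 1) = 2 * n + 1" by linarith
    thus ?thesis by (simp add: card_cartesian_product)
  qed
  finally show ?thesis .
qed

lemma net_dense:
  assumes h: "h > 0" and z: "norm z + h \<le> h * real n"
  shows "\<exists>w\<in>net h n. norm (z - w) \<le> 2 * h"
proof -
  define a where "a = \<lfloor>Re z / h\<rfloor>"
  define b where "b = \<lfloor>Im z / h\<rfloor>"
  have fl: "\<bar>x - h * real_of_int \<lfloor>x / h\<rfloor>\<bar> \<le> h" for x
  proof -
    have "real_of_int \<lfloor>x / h\<rfloor> * h \<le> x"
      by (subst pos_le_divide_eq[OF h, symmetric]) (rule of_int_floor_le)
    moreover have "x \<le> (real_of_int \<lfloor>x / h\<rfloor> + 1) * h"
      by (subst pos_divide_le_eq[OF h, symmetric]) (rule real_of_int_floor_add_one_ge)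
    ultimately show ?thesis using h by (simp add: algebra_simps abs_le_iff)
  qed
  have rng: "\<lfloor>x / h\<rfloor> \<in> {- int n..int n}" if "\<bar>x\<bar> \<le> norm z" for x
  proof -
    have "\<bar>x\<bar> \<le> (real n - 1) * h"
      using that z unfolding left_diff_distrib mult.commute[of "real n"] by linarith
    hence "\<bar>x\<bar> / h \<le> real n - 1" using h by (simp only: pos_divide_le_eq)
    moreover have "\<bar>x / h\<bar> = \<bar>x\<bar> / h" using h by simp
    ultimately have "\<bar>x / h\<bar> \<le> real n - 1" by linarith
    hence "- real n \<le> x / h" "x / h < real n + 1" unfolding abs_le_iff by linarith+
    thus ?thesis by (simp add: le_floor_iff floor_le_iff)
  qed
  let ?w = "of_real h * Complex (real_of_int a) (real_of_int b)"
  have "?w \<in> net h n"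
    unfolding net_def using rng[OF abs_Re_le_cmod] rng[OF abs_Im_le_cmod] by (force simp: a_def b_def)
  moreover have "norm (z - ?w) \<le> \<bar>Re z - h * real_of_int a\<bar> + \<bar>Im z - h * real_of_int b\<bar>"
    using cmod_le[of "z - ?w"] by simp
  hence "norm (z - ?w) \<le> 2 * h" using fl[of "Re z"] fl[of "Im z"] by (simp add: a_def b_def)
  ultimately show ?thesis by blast
qed

text \<open>This is the source of the factor \<open>real d\<close> in the union bound. The summand 3
  leaves room for all points up to radius \<open>sqrt (2 * real d) + 2\<close> and one mesh
  width.\<close>

lemma card_net_radius_le:
  assumes h: "0 < h" "h \<le> 1" and d: "d \<ge> 1"
  defines "n \<equiv> nat \<lceil>(sqrt (2 * real d) + 3) / h\<rceil>"
  shows "real (card (net h n)) \<le> (13 / h)\<^sup>2 * real d"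
proof -
  have sd: "sqrt (real d) \<ge> 1" using d by simp
  have "sqrt (2 * real d) = sqrt 2 * sqrt (real d)" by (simp add: real_sqrt_mult)
  also have "\<dots> \<le> 2 * sqrt (real d)" by (intro mult_right_mono real_le_lsqrt) auto
  finally have "sqrt (2 * real d) + 3 \<le> 5 * sqrt (real d)" using sd by linarith
  hence "(sqrt (2 * real d) + 3) / h \<le> 5 * sqrt (real d) / h"
    using h by (intro divide_right_mono) auto
  moreover have n: "real n \<le> (sqrt (2 * real d) + 3) / h + 1"
    using of_int_ceiling_le_add_one[of "(sqrt (2 * real d) + 3) / h"] h by (simp add: n_def of_nat_nat)
  ultimately have "2 * real n + 1 \<le> 10 * sqrt (real d) / h + 3" by simp
  also have "3 \<le> 3 * sqrt (real d) / h"
  proof -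
    have "3 * h \<le> 3 * sqrt (real d)" using h sd by linarith
    thus ?thesis using h by (simp add: pos_le_divide_eq)
  qed
  finally have "2 * real n + 1 \<le> 13 / h * sqrt (real d)" by (simp add: add_divide_distrib[symmetric])
  hence "(2 * real n + 1) * (2 * real n + 1) \<le> (13 / h * sqrt (real d)) * (13 / h * sqrt (real d))"
    by (intro mult_mono) auto
  also have "\<dots> = (13 / h)\<^sup>2 * real d" by (simp add: power2_eq_square)
  finally have "(2 * real n + 1) * (2 * real n + 1) \<le> (13 / h)\<^sup>2 * real d" .
  moreover have "real (card (net h n)) \<le> (2 * real n + 1) * (2 * real n + 1)"
    using of_nat_mono[OF card_net_le[of h n], where 'a = real] by (simp add: algebra_simps)
  ultimately show ?thesis by linarith
qed

definition lattice_rate :: "real \<Rightarrow> real" where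
  "lattice_rate \<eta> = \<eta>^4 / (400 * 1440\<^sup>2)"

text \<open>The union runs over a net only. The radii in \<open>local_event\<close> are larger, for
  the upper bound, and smaller, for the lower bound, than those needed for counting, so that the
  estimates pass from the net to all points at once.\<close>

lemma (in gef_coefficients) good_event:
  assumes \<eta>: "0 < \<eta>" "\<eta> \<le> 1/10" and L: "large_intensity \<eta> L" and d: "d \<ge> 1"
  shows "\<exists>E\<in>sets M. prob E \<le> 17 * (5200 / \<eta>)\<^sup>2 * real d * exp (- lattice_rate \<eta> * L\<^sup>2) \<and>
    (\<forall>\<omega>\<in>space M - E. finite (gef_zeros \<zeta> L \<omega> \<inter> ball 0 (sqrt (2 * real d))) \<and>
      (\<forall>\<xi>. real (card {z\<in>gef_zeros \<zeta> L \<omega> \<inter> ball 0 (sqrt (2 * real d)). dist z \<xi> < \<eta>}) \<le> 20 * \<eta>\<^sup>2 * L) \<and>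
      (\<forall>\<xi>. norm \<xi> \<le> sqrt (2 * real d) - 1 \<longrightarrow>
        \<eta>\<^sup>2 / 100 * L \<le> real (card {z\<in>gef_zeros \<zeta> L \<omega> \<inter> ball 0 (sqrt (2 * real d)). dist z \<xi> < \<eta>})))"
proof -
  define R where "R = sqrt (2 * real d)"
  \<comment> \<open>Every point is then within \<open>2 * h = \<eta> / 200\<close> of the net, and
    \<open>\<eta> / 200 + \<eta> / 90 \<le> \<eta> / 60\<close>. The constant 5200 is 13 *
    400.\<close>
  define h where "h = \<eta> / 400"
  have h: "0 < h" "h \<le> 1" using \<eta> by (simp_all add: h_def)
  define n where "n = nat \<lceil>(R + 3) / h\<rceil>"
  have R0: "R \<ge> 0" by (simp add: R_def)
  have L1: "L \<ge> 1" using L by (simp add: large_intensity_def)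
  let ?x = "\<lambda>\<omega> n. \<zeta> n \<omega>"
  define u where "u \<omega> z = fock_abs (gef_series (?x \<omega>)) (of_real (sqrt L) * z)" for \<omega> z
  let ?good = "\<lambda>w \<omega>. (\<forall>t. norm t \<le> \<eta> / 20 \<longrightarrow> u \<omega> (w + t) \<le> exp (\<eta>\<^sup>2 / 100 * L)) \<and>
       (\<exists>t. norm t \<le> \<eta> / 90 \<and> exp (- (\<eta>\<^sup>2 / 100 * L)) \<le> u \<omega> (w + t))"
  have "\<forall>w. \<exists>E. E \<in> sets M \<and> prob E \<le> 17 * exp (- lattice_rate \<eta> * L\<^sup>2) \<and> (\<forall>\<omega>\<in>space M - E. gef_conv (?x \<omega>) \<longrightarrow> ?good w \<omega>)"
    using local_event[OF \<eta>(1) _ L] \<eta> unfolding u_def lattice_rate_def by (simp add: Bex_def)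
  then obtain Ew where Ew: "\<And>w. Ew w \<in> sets M" "\<And>w. prob (Ew w) \<le> 17 * exp (- lattice_rate \<eta> * L\<^sup>2)"
    "\<And>w \<omega>. \<omega> \<in> space M - Ew w \<Longrightarrow> gef_conv (?x \<omega>) \<Longrightarrow> ?good w \<omega>" by metis
  have "AE \<omega> in M. gef_conv (?x \<omega>) \<and> \<not> double_zero (?x \<omega>)"
    using AE_gef_conv AE_not_double_zero by eventually_elim simp
  then obtain N where N: "{\<omega>\<in>space M. \<not> (gef_conv (?x \<omega>) \<and> \<not> double_zero (?x \<omega>))} \<subseteq> N" "emeasure M N = 0" "N \<in> sets M"
    by (rule AE_E)
  define E where "E = (\<Union>w\<in>net h n. Ew w) \<union> N"
  have U: "(\<Union>w\<in>net h n. Ew w) \<in> sets M" using finite_net Ew(1) by blast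
  have E: "E \<in> sets M" unfolding E_def using U N by blast
  have "prob E \<le> prob (\<Union>w\<in>net h n. Ew w) + prob N" unfolding E_def by (rule measure_Un_le[OF U N(3)])
  also have "prob N = 0" using N(2) by (simp add: measure_def)
  also have "prob (\<Union>w\<in>net h n. Ew w) \<le> (\<Sum>w\<in>net h n. prob (Ew w))"
    by (rule measure_subadditive_finite[OF finite_net]) (use Ew(1) in \<open>auto simp: emeasure_eq_measure\<close>)
  also have "\<dots> \<le> (\<Sum>w\<in>net h n. 17 * exp (- lattice_rate \<eta> * L\<^sup>2))" by (intro sum_mono Ew(2))
  also have "\<dots> = real (card (net h n)) * (17 * exp (- lattice_rate \<eta> * L\<^sup>2))" by simp
  also have "\<dots> \<le> ((13 / h)\<^sup>2 * real d) * (17 * exp (- lattice_rate \<eta> * L\<^sup>2))"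
    unfolding n_def R_def by (intro mult_right_mono card_net_radius_le h d) auto
  finally have pE: "prob E \<le> 17 * (5200 / \<eta>)\<^sup>2 * real d * exp (- lattice_rate \<eta> * L\<^sup>2)"
    by (simp add: h_def mult_ac)
  have good: "finite (gef_zeros \<zeta> L \<omega> \<inter> ball 0 R) \<and>
      (\<forall>\<xi>. real (card {z\<in>gef_zeros \<zeta> L \<omega> \<inter> ball 0 R. dist z \<xi> < \<eta>}) \<le> 20 * \<eta>\<^sup>2 * L) \<and>
      (\<forall>\<xi>. norm \<xi> \<le> R - 1 \<longrightarrow> \<eta>\<^sup>2 / 100 * L \<le> real (card {z\<in>gef_zeros \<zeta> L \<omega> \<inter> ball 0 R. dist z \<xi> < \<eta>}))"
    if \<omega>: "\<omega> \<in> space M - E" for \<omega>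
  proof -
    have conv: "gef_conv (?x \<omega>)" and nd: "\<not> double_zero (?x \<omega>)" using \<omega> N(1) by (auto simp: E_def)
    have near: "\<exists>w. norm (z - w) \<le> \<eta> / 200 \<and> ?good w \<omega>" if z: "norm z \<le> R + 2" for z
    proof -
      have "(R + 3) / h \<le> real n" using R0 h unfolding n_def by (simp add: of_nat_ceiling)
      hence "R + 3 \<le> h * real n" using h by (simp add: pos_divide_le_eq mult.commute)
      hence "norm z + h \<le> h * real n" using z h by linarith
      from net_dense[OF h(1) this] obtain w where w: "w \<in> net h n" "norm (z - w) \<le> 2 * h" by blast
      have "?good w \<omega>" using \<omega> w(1) by (intro Ew(3) conv) (auto simp: E_def)
      thus ?thesis using w(2) by (auto simp: h_def)
    qed
    have up: "u \<omega> z \<le> exp (\<eta>\<^sup>2 / 100 * L)" if z: "norm z \<le> R + 2" for z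
    proof -
      obtain w where w: "norm (z - w) \<le> \<eta> / 200" "?good w \<omega>" using near[OF z] by blast
      have "norm (z - w) \<le> \<eta> / 20" using w(1) \<eta> by linarith
      hence "u \<omega> (w + (z - w)) \<le> exp (\<eta>\<^sup>2 / 100 * L)" using w(2) by blast
      thus ?thesis by simp
    qed
    have low: "\<exists>z. norm (z - y) \<le> \<eta> / 60 \<and> exp (- (\<eta>\<^sup>2 / 100 * L)) \<le> u \<omega> z" if z: "norm y \<le> R + 2" for y
    proof -
      obtain w where w: "norm (y - w) \<le> \<eta> / 200" "?good w \<omega>" using near[OF z] by blast
      then obtain t where t: "norm t \<le> \<eta> / 90" "exp (- (\<eta>\<^sup>2 / 100 * L)) \<le> u \<omega> (w + t)" by blast
      have "norm (w + t - y) \<le> norm t + norm (y - w)" by norm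
      hence "norm (w + t - y) \<le> \<eta> / 60" using t(1) w(1) \<eta> by linarith
      thus ?thesis using t(2) by blast
    qed
    define Z where "Z w = {z. gef_series (?x \<omega>) (of_real (sqrt L) * z) = 0 \<and> dist z w < \<eta>}" for w
    have Zc: "finite (Z w)" "real (card (Z w)) \<le> 20 * \<eta>\<^sup>2 * L" "\<eta>\<^sup>2 / 100 * L \<le> real (card (Z w))" if w: "norm w \<le> R + 1" for w
    proof -
      have up': "fock_abs (gef_series (?x \<omega>)) (of_real (sqrt L) * (w + t)) \<le> exp (\<eta>\<^sup>2 / 100 * L)" if "norm t \<le> 1" for t
        using up[of "w + t"] norm_triangle_ineq[of w t] w that unfolding u_def by linarith
      have low': "\<exists>t. norm (t - y) \<le> \<eta> / 60 \<and> exp (- (\<eta>\<^sup>2 / 100 * L)) \<le> fock_abs (gef_series (?x \<omega>)) (of_real (sqrt L) * (w + t))" if "norm y \<le> \<eta>" for y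
      proof -
        have "norm (w + y) \<le> R + 2" using norm_triangle_ineq[of w y] w that \<eta> by linarith
        from low[OF this] obtain z where z: "norm (z - (w + y)) \<le> \<eta> / 60" "exp (- (\<eta>\<^sup>2 / 100 * L)) \<le> u \<omega> z" by blast
        show ?thesis by (rule exI[of _ "z - w"]) (use z in \<open>auto simp: u_def algebra_simps\<close>)
      qed
      have L0: "L > 0" using L1 by simp
      note C = gef_zero_counts[OF conv nd \<eta> L0 up' low']
      show "finite (Z w)" unfolding Z_def by (rule C(1))
      show "real (card (Z w)) \<le> 20 * \<eta>\<^sup>2 * L" unfolding Z_def by (rule C(2))
      show "\<eta>\<^sup>2 / 100 * L \<le> real (card (Z w))" unfolding Z_def by (rule C(3))
    qed
    have sub: "{z\<in>gef_zeros \<zeta> L \<omega> \<inter> ball 0 R. dist z \<xi> < \<eta>} \<subseteq> Z \<xi>" for \<xi>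
      by (auto simp: Z_def gef_zeros_def gef_eq_series)
    have fin: "finite (gef_zeros \<zeta> L \<omega> \<inter> ball 0 R)"
    proof -
      have cov: "cball 0 R \<subseteq> (\<Union>w\<in>cball (0::complex) R. ball w \<eta>)" using \<eta> by auto
      obtain C :: "complex set" where C: "C \<subseteq> cball 0 R" "finite C" "cball 0 R \<subseteq> (\<Union>w\<in>C. ball w \<eta>)"
        by (rule compactE_image[OF compact_cball _ cov]) auto
      have "gef_zeros \<zeta> L \<omega> \<inter> ball 0 R \<subseteq> (\<Union>w\<in>C. Z w)"
      proof
        fix z assume z: "z \<in> gef_zeros \<zeta> L \<omega> \<inter> ball 0 R"
        hence "z \<in> cball 0 R" by auto
        then obtain w where "w \<in> C" "dist w z < \<eta>" using C(3) by fastforce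
        thus "z \<in> (\<Union>w\<in>C. Z w)" using z by (auto simp: Z_def gef_zeros_def gef_eq_series dist_commute)
      qed
      moreover have "finite (\<Union>w\<in>C. Z w)"
      proof (rule finite_UN_I[OF C(2)])
        fix w assume "w \<in> C"
        thus "finite (Z w)" using C(1) by (intro Zc(1)) (force simp: dist_norm)
      qed
      ultimately show ?thesis by (rule finite_subset)
    qed
    moreover have "real (card {z\<in>gef_zeros \<zeta> L \<omega> \<inter> ball 0 R. dist z \<xi> < \<eta>}) \<le> 20 * \<eta>\<^sup>2 * L" for \<xi>
    proof (cases "norm \<xi> \<le> R + 1")
      case True
      have "card {z\<in>gef_zeros \<zeta> L \<omega> \<inter> ball 0 R. dist z \<xi> < \<eta>} \<le> card (Z \<xi>)"
        by (rule card_mono[OF Zc(1)[OF True] sub])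
      thus ?thesis using Zc(2)[OF True] by linarith
    next
      case False
      \<comment> \<open>A disc about a point beyond radius \<open>R + 1\<close> does not reach the
        truncated zero set, so the upper count holds for all centres.\<close>
      have e: "{z\<in>gef_zeros \<zeta> L \<omega> \<inter> ball 0 R. dist z \<xi> < \<eta>} = {}"
      proof -
        have False if "norm z < R" "dist z \<xi> < \<eta>" for z
        proof -
          have "norm \<xi> \<le> norm z + dist z \<xi>" unfolding dist_norm by norm
          thus False using that False \<eta> by linarith
        qed
        thus ?thesis by auto
      qed
      show ?thesis unfolding e using L1 by simp
    qed
    moreover have "\<eta>\<^sup>2 / 100 * L \<le> real (card {z\<in>gef_zeros \<zeta> L \<omega> \<inter> ball 0 R. dist z \<xi> < \<eta>})" if \<xi>: "norm \<xi> \<le> R - 1" for \<xi>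
    proof -
      \<comment> \<open>Up to radius \<open>R - 1\<close> the truncation to \<open>ball 0 R\<close>
        removes no zero from the disc; beyond it, the tail estimate takes over.\<close>
      have "{z\<in>gef_zeros \<zeta> L \<omega> \<inter> ball 0 R. dist z \<xi> < \<eta>} = Z \<xi>"
      proof -
        have "norm z < R" if "dist z \<xi> < \<eta>" for z
        proof -
          have "norm z \<le> norm \<xi> + dist z \<xi>" unfolding dist_norm by norm
          thus ?thesis using that \<xi> \<eta> by linarith
        qed
        thus ?thesis by (auto simp: Z_def gef_zeros_def gef_eq_series)
      qed
      moreover have "norm \<xi> \<le> R + 1" using \<xi> by simp
      ultimately show ?thesis using Zc(3) by simp
    qed
    ultimately show ?thesis by blast
  qed
  show ?thesis using E pE good unfolding R_def by blast
qed

text \<open>The largest radius that \<open>sampling_from_counts\<close> admits: six times it is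
  1/4.\<close>

definition cell_radius :: real where "cell_radius = 1/24"

text \<open>The square of \<open>cell_radius\<close> in the counts cancels against that in the area
  of the averaging disc. Both constants are therefore multiples of \<open>L\<close>, and their ratio
  \<open>4000 * 12 powr p\<close> depends on \<open>p\<close> only.\<close>

lemma (in gef_coefficients) sampling_event:
  assumes p: "p \<ge> 1" and L: "large_intensity cell_radius L" and d: "d \<ge> 1"
    and tail: "\<And>f::complex poly. degree f \<le> d \<Longrightarrow>
      (\<integral>z. indicator (- cball 0 (sqrt (2 * real d) - 1)) z * fock_abs (poly f) z powr p \<partial>lborel)
        \<le> (\<integral>z. fock_abs (poly f) z powr p \<partial>lborel) / 4"
  shows "\<exists>E\<in>sets M. prob E \<le> 17 * (5200 / cell_radius)\<^sup>2 * real d * exp (- lattice_rate cell_radius * L\<^sup>2) \<and>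
    (\<forall>\<omega>\<in>space M - E. sampling_inequalities p d (gef_zeros \<zeta> L \<omega> \<inter> ball 0 (sqrt (2 * real d)))
        (L / (100 * p * 4 powr p)) (40 * 3 powr p * L / p))"
proof -
  have m: "0 < cell_radius" "cell_radius \<le> 1/10" "cell_radius \<le> 1/24" by (simp_all add: cell_radius_def)
  have L1: "L \<ge> 1" using L by (simp add: large_intensity_def)
  obtain E where E: "E \<in> sets M" "prob E \<le> 17 * (5200 / cell_radius)\<^sup>2 * real d * exp (- lattice_rate cell_radius * L\<^sup>2)"
    and G: "\<And>\<omega>. \<omega> \<in> space M - E \<Longrightarrow> finite (gef_zeros \<zeta> L \<omega> \<inter> ball 0 (sqrt (2 * real d)))"
      "\<And>\<omega> \<xi>. \<omega> \<in> space M - E \<Longrightarrow> real (card {z\<in>gef_zeros \<zeta> L \<omega> \<inter> ball 0 (sqrt (2 * real d)). dist z \<xi> < cell_radius}) \<le> 20 * cell_radius\<^sup>2 * L"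
      "\<And>\<omega> \<xi>. \<omega> \<in> space M - E \<Longrightarrow> norm \<xi> \<le> sqrt (2 * real d) - 1 \<Longrightarrow>
        cell_radius\<^sup>2 / 100 * L \<le> real (card {z\<in>gef_zeros \<zeta> L \<omega> \<inter> ball 0 (sqrt (2 * real d)). dist z \<xi> < cell_radius})"
    using good_event[OF m(1,2) L d] by blast
  have "sampling_inequalities p d (gef_zeros \<zeta> L \<omega> \<inter> ball 0 (sqrt (2 * real d)))
        (L / (100 * p * 4 powr p)) (40 * 3 powr p * L / p)" if \<omega>: "\<omega> \<in> space M - E" for \<omega>
    unfolding sampling_inequalities_def
  proof (intro allI impI)
    fix f :: "complex poly" assume f: "degree f \<le> d"
    let ?Z = "gef_zeros \<zeta> L \<omega> \<inter> ball 0 (sqrt (2 * real d))"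
    define I where "I = (\<integral>z. fock_abs (poly f) z powr p \<partial>lborel)"
    define S where "S = (\<Sum>z\<in>?Z. fock_abs (poly f) z powr p)"
    have N1: "cell_radius\<^sup>2 / 100 * L > 0" using m L1 by simp
    note C = sampling_from_counts[OF p G(1)[OF \<omega>] m(1,3) N1 G(2)[OF \<omega>] G(3)[OF \<omega>] tail[OF f], folded I_def S_def]
    have fn: "fock_norm_pow p (poly f) = p / (2 * pi) * I"
      unfolding fock_norm_pow_def I_def fock_abs_powr ..
    have S: "(\<Sum>z\<in>?Z. norm (poly f z) powr p * exp (- p * (norm z)\<^sup>2 / 2)) = S"
      unfolding S_def fock_abs_powr ..
    have m2: "cell_radius\<^sup>2 > 0" using m by simp
    have "cell_radius\<^sup>2 * (L * I) \<le> cell_radius\<^sup>2 * (200 * 4 powr p * pi * S)" using C(2) by (simp add: field_simps)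
    hence "L * I \<le> 200 * 4 powr p * pi * S" using m2 by (simp only: mult_le_cancel_left_pos)
    hence lo: "L / (100 * p * 4 powr p) * (p / (2 * pi) * I) \<le> S" using p by (simp add: field_simps)
    have "cell_radius\<^sup>2 * (pi * S) \<le> cell_radius\<^sup>2 * (3 powr p * 20 * L * I)" using C(1) by (simp add: field_simps)
    hence "pi * S \<le> 3 powr p * 20 * L * I" using m2 by (simp only: mult_le_cancel_left_pos)
    hence "S \<le> 40 * 3 powr p * L / p * (p / (2 * pi) * I)" using p by (simp add: field_simps)
    with lo show "L / (100 * p * 4 powr p) * fock_norm_pow p (poly f)
        \<le> (\<Sum>z\<in>?Z. norm (poly f z) powr p * exp (- p * (norm z)\<^sup>2 / 2)) \<and>
      (\<Sum>z\<in>?Z. norm (poly f z) powr p * exp (- p * (norm z)\<^sup>2 / 2))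
        \<le> 40 * 3 powr p * L / p * fock_norm_pow p (poly f)"
      unfolding fn S by blast
  qed
  with E show ?thesis by blast
qed

section \<open>The failure probability\<close>

lemma log_star_ge_1: "log_star x \<ge> 1"
  by (simp add: log_star_def)

lemma le_exp_log_star:
  assumes "x > 0"
  shows "x \<le> exp (log_star x)"
proof -
  have "x = exp (ln x)" using assms by simp
  also have "\<dots> \<le> exp (log_star x)" by (simp add: log_star_def)
  finally show ?thesis .
qed

lemma log_star_mono:
  assumes "0 < x" "x \<le> y"
  shows "log_star x \<le> log_star y"
  using assms unfolding log_star_def by (intro max.mono) auto

text \<open>Here \<open>x\<close> stands for log_* d. Since 1 + 2 \<epsilon> exceeds both other
  exponents, the expression is eventually negative; on the remaining bounded range the positive
  terms are bounded by monotonicity.\<close>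

lemma rate_beats_cardinality:
  fixes \<epsilon> \<kappa> :: real
  assumes \<epsilon>: "\<epsilon> > 0" and \<kappa>: "\<kappa> > 0"
  shows "\<exists>S. \<forall>x\<ge>1. x + x powr (1 + \<epsilon> / 2) - \<kappa> * x powr (1 + 2 * \<epsilon>) \<le> S"
proof -
  have "eventually (\<lambda>x. x + x powr (1 + \<epsilon> / 2) - \<kappa> * x powr (1 + 2 * \<epsilon>) \<le> 0) at_top"
    using \<epsilon> \<kappa> by real_asymp
  then obtain x0 where x0: "\<And>x. x \<ge> x0 \<Longrightarrow> x + x powr (1 + \<epsilon> / 2) - \<kappa> * x powr (1 + 2 * \<epsilon>) \<le> 0"
    unfolding eventually_at_top_linorder by blast
  have "x + x powr (1 + \<epsilon> / 2) - \<kappa> * x powr (1 + 2 * \<epsilon>) \<le> max 0 (x0 + x0 powr (1 + \<epsilon> / 2))" if "x \<ge> 1" for x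
  proof (cases "x \<ge> x0")
    case True
    thus ?thesis using x0 by (simp add: le_max_iff_disj)
  next
    case False
    have "x powr (1 + \<epsilon> / 2) \<le> x0 powr (1 + \<epsilon> / 2)" using False that \<epsilon> by (intro powr_mono2) auto
    moreover have "\<kappa> * x powr (1 + 2 * \<epsilon>) \<ge> 0" using \<kappa> by simp
    ultimately show ?thesis using False by (simp add: le_max_iff_disj)
  qed
  thus ?thesis by blast
qed

text \<open>The last clause serves the cases in which the exceptional event is the whole space.
  There log_* d is bounded, by its value at \<open>d1\<close> or, since \<open>L\<close> is at least
  its square root, by \<open>L0\<^sup>2\<close>; the second summand of the constant makes the bound
  at least 1.\<close>

lemma failure_probability_bound:
  fixes d1 :: nat
  assumes \<epsilon>: "\<epsilon> > 0" and \<kappa>: "\<kappa> > 0" and K: "K > 0" and L0: "L0 \<ge> 1"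
  shows "\<exists>C>0. \<forall>d\<ge>1. \<forall>L. L \<ge> log_star (real d) powr (1 / 2 + \<epsilon>) \<longrightarrow>
    (K * real d * exp (- \<kappa> * L\<^sup>2) \<le> C * exp (- (log_star (real d) powr (1 + \<epsilon> / 2)))) \<and>
    (d < d1 \<or> L < L0 \<longrightarrow> 1 \<le> C * exp (- (log_star (real d) powr (1 + \<epsilon> / 2))))"
proof -
  obtain S where S: "\<And>x. x \<ge> 1 \<Longrightarrow> x + x powr (1 + \<epsilon> / 2) - \<kappa> * x powr (1 + 2 * \<epsilon>) \<le> S"
    using rate_beats_cardinality[OF \<epsilon> \<kappa>] by blast
  define x1 where "x1 = max (log_star (real d1)) (L0\<^sup>2)"
  define C where "C = K * exp S + exp (x1 powr (1 + \<epsilon> / 2))"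
  have "K * exp S > 0" using K by simp
  hence C: "C > 0" unfolding C_def by (intro add_pos_pos) auto
  have "K * real d * exp (- \<kappa> * L\<^sup>2) \<le> C * exp (- (log_star (real d) powr (1 + \<epsilon> / 2))) \<and>
    (d < d1 \<or> L < L0 \<longrightarrow> 1 \<le> C * exp (- (log_star (real d) powr (1 + \<epsilon> / 2))))"
    if d: "d \<ge> 1" and L: "L \<ge> log_star (real d) powr (1 / 2 + \<epsilon>)" for d :: nat and L
  proof
    define x where "x = log_star (real d)"
    have x: "x \<ge> 1" by (simp add: x_def log_star_ge_1)
    have L': "L \<ge> x powr (1 / 2 + \<epsilon>)" using L by (simp add: x_def)
    have "x powr (1 + 2 * \<epsilon>) = (x powr (1 / 2 + \<epsilon>))\<^sup>2"
      using x by (simp add: power2_eq_square powr_add[symmetric])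
    also have "\<dots> \<le> L\<^sup>2" using L' by (intro power_mono) auto
    finally have "exp (- \<kappa> * L\<^sup>2) \<le> exp (- \<kappa> * x powr (1 + 2 * \<epsilon>))" using \<kappa> by simp
    moreover have "real d \<le> exp x" unfolding x_def by (rule le_exp_log_star) (use d in simp)
    ultimately have "real d * exp (- \<kappa> * L\<^sup>2) \<le> exp x * exp (- \<kappa> * x powr (1 + 2 * \<epsilon>))"
      by (intro mult_mono) auto
    also have "\<dots> = exp (x - \<kappa> * x powr (1 + 2 * \<epsilon>))" by (simp add: exp_add[symmetric])
    also have "\<dots> \<le> exp (S + - (x powr (1 + \<epsilon> / 2)))" using S[OF x] by simp
    also have "\<dots> = exp S * exp (- (x powr (1 + \<epsilon> / 2)))" by (rule exp_add)
    finally have "K * (real d * exp (- \<kappa> * L\<^sup>2)) \<le> K * (exp S * exp (- (x powr (1 + \<epsilon> / 2))))"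
      using K by (intro mult_left_mono) auto
    also have "\<dots> \<le> C * exp (- (x powr (1 + \<epsilon> / 2)))" by (simp add: C_def distrib_right)
    finally show "K * real d * exp (- \<kappa> * L\<^sup>2) \<le> C * exp (- (log_star (real d) powr (1 + \<epsilon> / 2)))"
      by (simp add: x_def mult.assoc)
    show "d < d1 \<or> L < L0 \<longrightarrow> 1 \<le> C * exp (- (log_star (real d) powr (1 + \<epsilon> / 2)))"
    proof
      assume small: "d < d1 \<or> L < L0"
      have "x \<le> x1"
      proof (cases "d < d1")
        case True
        hence "x \<le> log_star (real d1)" unfolding x_def using d by (intro log_star_mono) auto
        thus ?thesis by (simp add: x1_def)
      next
        case False
        hence "L < L0" using small by simp
        have "sqrt x = x powr (1/2)" using x by (simp add: powr_half_sqrt)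
        also have "\<dots> \<le> x powr (1/2 + \<epsilon>)" using x \<epsilon> by (intro powr_mono) auto
        also have "\<dots> \<le> L0" using L' \<open>L < L0\<close> by linarith
        finally have "x \<le> L0\<^sup>2" by (rule sqrt_le_D)
        thus ?thesis by (simp add: x1_def)
      qed
      hence "x powr (1 + \<epsilon> / 2) \<le> x1 powr (1 + \<epsilon> / 2)" using x \<epsilon> by (intro powr_mono2) auto
      hence "1 \<le> exp (x1 powr (1 + \<epsilon> / 2)) * exp (- (x powr (1 + \<epsilon> / 2)))"
        by (simp add: exp_add[symmetric])
      also have "\<dots> \<le> C * exp (- (x powr (1 + \<epsilon> / 2)))" using \<open>K * exp S > 0\<close> by (simp add: C_def distrib_right)
      finally show "1 \<le> C * exp (- (log_star (real d) powr (1 + \<epsilon> / 2)))" by (simp add: x_def)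
    qed
  qed
  with C show ?thesis by blast
qed

text \<open>Eventually the exponent exceeds 2 log d, so the terms are comparable with 1 / d^2.
  Summability yields the simultaneous statement by the Borel-Cantelli argument.\<close>

lemma summable_failure_probability:
  assumes \<epsilon>: "\<epsilon> > 0"
  shows "summable (\<lambda>d::nat. C * exp (- (log_star (real d) powr (1 + \<epsilon> / 2))))"
proof (rule summable_mult, rule summable_comparison_test_ev)
  have "eventually (\<lambda>x::real. 2 * x \<le> x powr (1 + \<epsilon> / 2)) at_top" using \<epsilon> by real_asymp
  moreover have "filterlim (\<lambda>d::nat. ln (real d)) at_top sequentially" by real_asymp
  ultimately have "eventually (\<lambda>d::nat. 2 * ln (real d) \<le> ln (real d) powr (1 + \<epsilon> / 2)) sequentially"
    by (rule eventually_compose_filterlim)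
  moreover have "eventually (\<lambda>d::nat. ln (real d) \<ge> 1) sequentially" by real_asymp
  ultimately show "eventually (\<lambda>d::nat. norm (exp (- (log_star (real d) powr (1 + \<epsilon> / 2)))) \<le> inverse (real d ^ 2)) sequentially"
    using eventually_ge_at_top[of "1::nat"]
  proof eventually_elim
    case (elim d)
    have "log_star (real d) = ln (real d)" using elim by (simp add: log_star_def)
    hence "exp (- (log_star (real d) powr (1 + \<epsilon> / 2))) \<le> exp (- (2 * ln (real d)))" using elim by simp
    also have "\<dots> = inverse (real d ^ 2)" using elim by (simp add: exp_minus exp_double)
    finally show ?case by simp
  qed
  show "summable (\<lambda>d::nat. inverse (real d ^ 2))" by (rule inverse_power_summable) simp
qed

lemma (in finite_measure) measure_Union_tail_le:
  fixes E :: "nat \<Rightarrow> 'a set" and f :: "nat \<Rightarrow> real"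
  assumes E: "\<And>d. d \<ge> n \<Longrightarrow> E d \<in> sets M" and le: "\<And>d. d \<ge> n \<Longrightarrow> measure M (E d) \<le> f d"
    and f: "summable f"
  shows "(\<Union>d\<in>{n..}. E d) \<in> sets M" "measure M (\<Union>d\<in>{n..}. E d) \<le> (\<Sum>i. f (i + n))"
proof -
  have U: "(\<Union>d\<in>{n..}. E d) = (\<Union>i. E (i + n))"
  proof -
    have "{n..} = range (\<lambda>i. i + n)" by (auto simp: image_iff nat_le_iff_add add.commute)
    thus ?thesis by auto
  qed
  have r: "range (\<lambda>i. E (i + n)) \<subseteq> sets M" using E by auto
  show "(\<Union>d\<in>{n..}. E d) \<in> sets M" unfolding U using r by (rule sets.countable_UN)
  have fs: "summable (\<lambda>i. f (i + n))" using f by (rule summable_ignore_initial_segment)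
  have ms: "summable (\<lambda>i. measure M (E (i + n)))"
    by (rule summable_comparison_test'[OF fs]) (use le in simp)
  have "measure M (\<Union>i. E (i + n)) \<le> (\<Sum>i. measure M (E (i + n)))"
    by (rule finite_measure_subadditive_countably[OF r ms])
  also have "\<dots> \<le> (\<Sum>i. f (i + n))" by (rule suminf_le[OF _ ms fs]) (use le in simp)
  finally show "measure M (\<Union>d\<in>{n..}. E d) \<le> (\<Sum>i. f (i + n))" unfolding U .
qed

text \<open>The constants \<open>A' d\<close> and \<open>B' d\<close> are multiples of
  \<open>L d\<close>, so only their ratio is bounded uniformly. The index function
  \<open>d\<^sub>0\<close> precedes \<open>L\<close> and the probability space, because the failure
  bounds to be summed involve neither.\<close>

theorem proposition1p4:
  fixes p :: real
  assumes "1 \<le> p"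
  shows "\<exists>A>0. \<exists>B>0. \<forall>\<epsilon>>0. \<exists>c>0. \<exists>C>0. \<exists>d\<^sub>0 :: real \<Rightarrow> nat.
    \<forall>L :: nat \<Rightarrow> real. (\<forall>d\<ge>1. L d \<ge> log_star (real d) powr (1 / 2 + \<epsilon>)) \<longrightarrow>
      (\<exists>A' B' :: nat \<Rightarrow> real.
        (\<forall>d\<ge>1. A' d > 0 \<and> B' d > 0 \<and> B' d / A' d \<le> B / A) \<and>
        (\<forall>(M :: 'a measure) \<zeta>. gef_coefficients M \<zeta> \<longrightarrow>
          (\<forall>d\<ge>1. \<exists>E\<in>sets M.
             measure M E \<le> C * exp (- c * log_star (real d) powr (1 + \<epsilon> / 2)) \<and>
             (\<forall>\<omega>\<in>space M - E.
                sampling_inequalities p d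
                  (gef_zeros \<zeta> (L d) \<omega> \<inter> ball 0 (sqrt (2 * real d))) (A' d) (B' d))) \<and>
          (\<forall>\<delta>>0. d\<^sub>0 \<delta> \<ge> 1 \<and>
             (\<exists>E\<in>sets M. measure M E \<le> \<delta> \<and>
               (\<forall>\<omega>\<in>space M - E. \<forall>d\<ge>d\<^sub>0 \<delta>.
                  sampling_inequalities p d
                    (gef_zeros \<zeta> (L d) \<omega> \<inter> ball 0 (sqrt (2 * real d))) (A' d) (B' d))))))"
proof -
  note p = assms
  obtain d1 :: nat where d1: "\<And>d (f :: complex poly). d \<ge> d1 \<Longrightarrow> degree f \<le> d \<Longrightarrow>
      (\<integral>z. indicator (- cball 0 (sqrt (2 * real d) - 1)) z * fock_abs (poly f) z powr p \<partial>lborel)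
        \<le> (\<integral>z. fock_abs (poly f) z powr p \<partial>lborel) / 4"
    using fock_tail[OF p] by blast
  have "eventually (large_intensity cell_radius) at_top" by (rule eventually_large_intensity) (simp add: cell_radius_def)
  then obtain L1 where L1: "\<And>L. L \<ge> L1 \<Longrightarrow> large_intensity cell_radius L"
    unfolding eventually_at_top_linorder by blast
  define L0 where "L0 = max 1 L1"
  have L0: "L0 \<ge> 1" "\<And>L. L \<ge> L0 \<Longrightarrow> large_intensity cell_radius L" using L1 by (auto simp: L0_def)
  define K where "K = 17 * (5200 / cell_radius)\<^sup>2"
  define \<kappa> where "\<kappa> = lattice_rate cell_radius"
  have K: "K > 0" and \<kappa>: "\<kappa> > 0" by (simp_all add: K_def \<kappa>_def lattice_rate_def cell_radius_def)
  have witnesses: "\<exists>C>0. \<exists>d\<^sub>0 :: real \<Rightarrow> nat.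
    \<forall>L :: nat \<Rightarrow> real. (\<forall>d\<ge>1. L d \<ge> log_star (real d) powr (1 / 2 + \<epsilon>)) \<longrightarrow>
      (\<exists>A' B' :: nat \<Rightarrow> real.
        (\<forall>d\<ge>1. A' d > 0 \<and> B' d > 0 \<and> B' d / A' d \<le> (4000 * 12 powr p) / 1) \<and>
        (\<forall>(M :: 'a measure) \<zeta>. gef_coefficients M \<zeta> \<longrightarrow>
          (\<forall>d\<ge>1. \<exists>E\<in>sets M.
             measure M E \<le> C * exp (- 1 * log_star (real d) powr (1 + \<epsilon> / 2)) \<and>
             (\<forall>\<omega>\<in>space M - E.
                sampling_inequalities p d
                  (gef_zeros \<zeta> (L d) \<omega> \<inter> ball 0 (sqrt (2 * real d))) (A' d) (B' d))) \<and>
          (\<forall>\<delta>>0. d\<^sub>0 \<delta> \<ge> 1 \<and>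
             (\<exists>E\<in>sets M. measure M E \<le> \<delta> \<and>
               (\<forall>\<omega>\<in>space M - E. \<forall>d\<ge>d\<^sub>0 \<delta>.
                  sampling_inequalities p d
                    (gef_zeros \<zeta> (L d) \<omega> \<inter> ball 0 (sqrt (2 * real d))) (A' d) (B' d))))))"
    if \<epsilon>: "\<epsilon> > 0" for \<epsilon> :: real
  proof -
    obtain C where C: "C > 0" and
      Cd: "\<And>d L. d \<ge> 1 \<Longrightarrow> L \<ge> log_star (real d) powr (1 / 2 + \<epsilon>) \<Longrightarrow>
        K * real d * exp (- \<kappa> * L\<^sup>2) \<le> C * exp (- (log_star (real d) powr (1 + \<epsilon> / 2)))"
      "\<And>d L. d \<ge> 1 \<Longrightarrow> L \<ge> log_star (real d) powr (1 / 2 + \<epsilon>) \<Longrightarrow> d < d1 \<or> L < L0 \<Longrightarrow>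
        1 \<le> C * exp (- (log_star (real d) powr (1 + \<epsilon> / 2)))"
      using failure_probability_bound[OF \<epsilon> \<kappa> K L0(1), of d1] by blast
    define f where "f d = C * exp (- (log_star (real d) powr (1 + \<epsilon> / 2)))" for d :: nat
    have f: "summable f" unfolding f_def by (rule summable_failure_probability[OF \<epsilon>])
    \<comment> \<open>Tails of the convergent series tend to 0. The index starts at 1 at least, as
      the failure bounds hold from there on.\<close>
    have "\<exists>n\<ge>1. (\<Sum>i. f (i + n)) \<le> \<delta>" if \<delta>: "\<delta> > 0" for \<delta>
    proof -
      obtain N where N: "\<And>n. n \<ge> N \<Longrightarrow> norm (\<Sum>i. f (i + n)) < \<delta>"
        using suminf_exist_split[OF \<delta> f] by blast
      have "(\<Sum>i. f (i + max 1 N)) \<le> \<delta>" using N[of "max 1 N"] by simp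
      thus ?thesis by (intro exI[of _ "max 1 N"]) simp
    qed
    then obtain d0 :: "real \<Rightarrow> nat" where d0: "\<And>\<delta>. \<delta> > 0 \<Longrightarrow> d0 \<delta> \<ge> 1" "\<And>\<delta>. \<delta> > 0 \<Longrightarrow> (\<Sum>i. f (i + d0 \<delta>)) \<le> \<delta>"
      by metis
    show ?thesis
    proof (rule exI[of _ C], intro conjI C, rule exI[of _ d0], intro allI impI)
      fix L :: "nat \<Rightarrow> real" assume L: "\<forall>d\<ge>1. L d \<ge> log_star (real d) powr (1 / 2 + \<epsilon>)"
      define A' where "A' d = L d / (100 * p * 4 powr p)" for d
      define B' where "B' d = 40 * 3 powr p * L d / p" for d
      let ?good = "\<lambda>(M :: 'a measure) \<zeta> d \<omega>. sampling_inequalities p d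
                  (gef_zeros \<zeta> (L d) \<omega> \<inter> ball 0 (sqrt (2 * real d))) (A' d) (B' d)"
      have Lpos: "L d > 0" if "d \<ge> 1" for d
      proof -
        have "0 < log_star (real d) powr (1 / 2 + \<epsilon>)" using log_star_ge_1[of "real d"] by simp
        thus ?thesis using L that by (meson less_le_trans)
      qed
      have ratio: "A' d > 0 \<and> B' d > 0 \<and> B' d / A' d \<le> (4000 * 12 powr p) / 1" if d: "d \<ge> 1" for d
      proof -
        have "(12::real) powr p = 3 powr p * 4 powr p" by (simp flip: powr_mult)
        hence "B' d / A' d = 4000 * 12 powr p" using Lpos[OF d] p by (simp add: A'_def B'_def field_simps)
        thus ?thesis using Lpos[OF d] p by (simp add: A'_def B'_def)
      qed
      have main: "\<exists>E\<in>sets M. measure M E \<le> f d \<and> (\<forall>\<omega>\<in>space M - E. ?good M \<zeta> d \<omega>)"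
        if gef: "gef_coefficients M \<zeta>" and d: "d \<ge> 1" for M :: "'a measure" and \<zeta> d
      proof -
        interpret gef_coefficients M \<zeta> by (rule gef)
        have Ld: "L d \<ge> log_star (real d) powr (1 / 2 + \<epsilon>)" using L d by blast
        show ?thesis
        proof (cases "d < d1 \<or> L d < L0")
          case True
          \<comment> \<open>The bound is at least 1 here, so the whole space serves as exceptional
            event.\<close>
          from Cd(2)[OF d Ld True] show ?thesis
            by (intro bexI[of _ "space M"]) (auto simp: prob_space f_def)
        next
          case False
          obtain E where E: "E \<in> sets M" "prob E \<le> K * real d * exp (- \<kappa> * (L d)\<^sup>2)" "\<forall>\<omega>\<in>space M - E. ?good M \<zeta> d \<omega>"
            using sampling_event[OF p L0(2) d d1, of "L d"] False unfolding K_def \<kappa>_def A'_def B'_def by auto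
          have "prob E \<le> f d" unfolding f_def using E(2) Cd(1)[OF d Ld] by linarith
          thus ?thesis using E by blast
        qed
      qed
      have all: "\<exists>E\<in>sets M. measure M E \<le> \<delta> \<and> (\<forall>\<omega>\<in>space M - E. \<forall>d\<ge>d0 \<delta>. ?good M \<zeta> d \<omega>)"
        if gef: "gef_coefficients M \<zeta>" and \<delta>: "\<delta> > 0" for M :: "'a measure" and \<zeta> \<delta>
      proof -
        interpret gef_coefficients M \<zeta> by (rule gef)
        have "\<forall>d. \<exists>E. d \<ge> 1 \<longrightarrow> E \<in> sets M \<and> measure M E \<le> f d \<and> (\<forall>\<omega>\<in>space M - E. ?good M \<zeta> d \<omega>)"
          using main[OF gef] by blast
        then obtain E where E: "\<And>d. d \<ge> 1 \<Longrightarrow> E d \<in> sets M" "\<And>d. d \<ge> 1 \<Longrightarrow> measure M (E d) \<le> f d"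
          "\<And>d \<omega>. d \<ge> 1 \<Longrightarrow> \<omega> \<in> space M - E d \<Longrightarrow> ?good M \<zeta> d \<omega>" by metis
        have ge1: "d \<ge> 1" if "d \<ge> d0 \<delta>" for d using that d0(1)[OF \<delta>] by linarith
        note U = measure_Union_tail_le[of "d0 \<delta>" E f, OF E(1)[OF ge1] E(2)[OF ge1] f]
        show ?thesis
        proof (intro bexI[of _ "\<Union>d\<in>{d0 \<delta>..}. E d"] conjI ballI allI impI)
          show "prob (\<Union>d\<in>{d0 \<delta>..}. E d) \<le> \<delta>" using U(2) d0(2)[OF \<delta>] by linarith
          show "(\<Union>d\<in>{d0 \<delta>..}. E d) \<in> sets M" by (rule U(1))
          fix \<omega> d assume "\<omega> \<in> space M - (\<Union>d\<in>{d0 \<delta>..}. E d)" "d \<ge> d0 \<delta>"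
          thus "?good M \<zeta> d \<omega>" using E(3)[OF ge1] by blast
        qed
      qed
      show "\<exists>A' B' :: nat \<Rightarrow> real.
        (\<forall>d\<ge>1. A' d > 0 \<and> B' d > 0 \<and> B' d / A' d \<le> (4000 * 12 powr p) / 1) \<and>
        (\<forall>(M :: 'a measure) \<zeta>. gef_coefficients M \<zeta> \<longrightarrow>
          (\<forall>d\<ge>1. \<exists>E\<in>sets M.
             measure M E \<le> C * exp (- 1 * log_star (real d) powr (1 + \<epsilon> / 2)) \<and>
             (\<forall>\<omega>\<in>space M - E.
                sampling_inequalities p d
                  (gef_zeros \<zeta> (L d) \<omega> \<inter> ball 0 (sqrt (2 * real d))) (A' d) (B' d))) \<and>
          (\<forall>\<delta>>0. d0 \<delta> \<ge> 1 \<and>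
             (\<exists>E\<in>sets M. measure M E \<le> \<delta> \<and>
               (\<forall>\<omega>\<in>space M - E. \<forall>d\<ge>d0 \<delta>.
                  sampling_inequalities p d
                    (gef_zeros \<zeta> (L d) \<omega> \<inter> ball 0 (sqrt (2 * real d))) (A' d) (B' d)))))"
      proof (rule exI[of _ A'], rule exI[of _ B'], intro conjI allI impI)
        fix M :: "'a measure" and \<zeta> and d :: nat assume "gef_coefficients M \<zeta>" "1 \<le> d"
        from main[OF this] show "\<exists>E\<in>sets M. measure M E \<le> C * exp (- 1 * log_star (real d) powr (1 + \<epsilon> / 2)) \<and> (\<forall>\<omega>\<in>space M - E. ?good M \<zeta> d \<omega>)"
          by (simp add: f_def)
      qed (use ratio all d0(1) in blast)+
    qed
  qed
  \<comment> \<open>Only the quotient of the first two constants enters, so the first is 1 and the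
    second carries the ratio; the rate is 1 because the gap between the exponents 1 + 2 \<epsilon>
    and 1 + \<epsilon> / 2 absorbs every smaller rate into the constant.\<close>
  show ?thesis
    by (rule exI[of _ "1::real"], rule conjI, simp, rule exI[of _ "4000 * 12 powr p"], rule conjI, simp,
        intro allI impI, rule exI[of _ "1::real"], rule conjI, simp, erule witnesses)
qed

end
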